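(* Let $D$ be a normal crossing divisor in $\mathbb{P}^2$. Then $\mathbb{P}^2\setminus D$ is dominable by $\mathbb{C}^2$ if and only if $\deg D\le 3$.
   Context: $\mathbb{P}^2$ is the complex projective plane. A normal crossing divisor $D$ is a reduced curve such that around any point there is a local holomorphic coordinate system $(z_1,z_2)$ centered at the point in which $D$ is defined by $1=0$ (empty), $z_1=0$ or $z_1z_2=0$ (components of $D$ may be singular at nodes). A complex surface $X$ is dominable by $\mathbb{C}^2$ if there is a holomorphic map $F:\mathbb{C}^2\to X$ whose Jacobian determinant is not identically zero. *)

theory Defs
  imports
    "HOL-Analysis.Analysis"
    "HOL-Library.Poly_Mapping"
    "HOL-Computational_Algebra.Squarefree"
begin

section \<open>The complex projective plane\<close>

definition proportional :: "complex ^ 3 \<Rightarrow> complex ^ 3 \<Rightarrow> bool" where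
  "proportional z w \<longleftrightarrow> z \<noteq> 0 \<and> w \<noteq> 0 \<and> (\<exists>c. w = c *s z)"

lemma proportional_scalar_nonzero:
  assumes "proportional z w"
  obtains c where "c \<noteq> 0" "w = c *s z"
  using assms by (auto simp: proportional_def)

lemma part_equivp_proportional: "part_equivp proportional"
proof (rule part_equivpI)
  show "\<exists>z. proportional z z"
    by (rule exI[of _ "axis 1 1"]) (auto simp: proportional_def axis_eq_0_iff intro: exI[of _ 1])
  show "symp proportional"
  proof (rule sympI)
    fix z w assume zw: "proportional z w"
    then obtain c where "c \<noteq> 0" "w = c *s z" by (rule proportional_scalar_nonzero)
    then have "z = inverse c *s w" by (simp add: vector_smult_assoc)
    with zw show "proportional w z" unfolding proportional_def by blast
  qed
  show "transp proportional"
    by (rule transpI) (auto simp: proportional_def vector_smult_assoc)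
qed

quotient_type P2 = "complex ^ 3" / partial: proportional
  morphisms rep_P2 proj
  by (rule part_equivp_proportional)

text \<open>
  For \<open>z \<noteq> 0\<close>, \<open>proj z\<close> is the point \<open>[z $ 1 : z $ 2 : z $ 3]\<close>. The topology is the quotient
  topology from \<open>- {0}\<close>.
\<close>

instantiation P2 :: topological_space
begin

definition open_P2 :: "P2 set \<Rightarrow> bool" where
  "open_P2 U \<longleftrightarrow> open {z. z \<noteq> 0 \<and> proj z \<in> U}"

instance
proof
  have "{z :: complex ^ 3. z \<noteq> 0 \<and> proj z \<in> UNIV} = - {0}" by auto
  then show "open (UNIV :: P2 set)" unfolding open_P2_def by (simp add: open_Compl)
next
  fix S T :: "P2 set"
  assume "open S" "open T"
  moreover have "{z. z \<noteq> 0 \<and> proj z \<in> S \<inter> T}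
      = {z. z \<noteq> 0 \<and> proj z \<in> S} \<inter> {z. z \<noteq> 0 \<and> proj z \<in> T}" by auto
  ultimately show "open (S \<inter> T)" unfolding open_P2_def by (simp add: open_Int)
next
  fix K :: "P2 set set"
  assume "\<forall>S\<in>K. open S"
  moreover have "{z. z \<noteq> 0 \<and> proj z \<in> \<Union>K} = (\<Union>S\<in>K. {z. z \<noteq> 0 \<and> proj z \<in> S})" by auto
  ultimately show "open (\<Union>K)" unfolding open_P2_def by (auto intro!: open_UN)
qed

end

lift_definition in_affine :: "3 \<Rightarrow> P2 \<Rightarrow> bool" is "\<lambda>i z. z $ i \<noteq> 0"
  by (auto simp: proportional_def)

definition affine_dom :: "3 \<Rightarrow> P2 set" where
  "affine_dom i = {p. in_affine i p}"

text \<open>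
  The standard affine charts \<open>affine_dom i \<rightarrow> \<complex>\<^sup>2\<close>; the value of \<open>affine_chart i\<close>
  outside \<open>affine_dom i\<close> is irrelevant. \<open>affine_param i\<close> is the inverse of the chart.
\<close>

lift_definition affine_chart :: "3 \<Rightarrow> P2 \<Rightarrow> complex ^ 2" is
  "\<lambda>i z. if i = 1 then vector [z $ 2 / z $ 1, z $ 3 / z $ 1]
         else if i = 2 then vector [z $ 1 / z $ 2, z $ 3 / z $ 2]
         else vector [z $ 1 / z $ 3, z $ 2 / z $ 3]"
  by (auto elim!: proportional_scalar_nonzero)

definition affine_param :: "3 \<Rightarrow> complex ^ 2 \<Rightarrow> P2" where
  "affine_param i u =
     proj (if i = 1 then vector [1, u $ 1, u $ 2]
           else if i = 2 then vector [u $ 1, 1, u $ 2]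
           else vector [u $ 1, u $ 2, 1])"


section \<open>Holomorphic maps and dominability\<close>

text \<open>
  \<open>has_jacobian f A x\<close>: \<open>f\<close> is complex differentiable at \<open>x\<close>, with complex Jacobian matrix \<open>A\<close>.
  Holomorphy on an open set is complex differentiability at each of its points.
\<close>

definition has_jacobian :: "(complex ^ 'n \<Rightarrow> complex ^ 'm) \<Rightarrow> complex ^ 'n ^ 'm \<Rightarrow> complex ^ 'n \<Rightarrow> bool"
  where "has_jacobian f A x \<longleftrightarrow> (f has_derivative (\<lambda>v. A *v v)) (at x)"

definition holomorphic_into_P2 :: "(complex ^ 2 \<Rightarrow> P2) \<Rightarrow> (complex ^ 2) set \<Rightarrow> bool" where
  "holomorphic_into_P2 F V \<longleftrightarrow> open V \<and> continuous_on V F \<and>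
     (\<forall>i. \<forall>w\<in>V. F w \<in> affine_dom i \<longrightarrow> (\<exists>A. has_jacobian (affine_chart i \<circ> F) A w))"

definition holomorphic_from_P2 :: "(P2 \<Rightarrow> complex ^ 2) \<Rightarrow> P2 set \<Rightarrow> bool" where
  "holomorphic_from_P2 f U \<longleftrightarrow> open U \<and>
     (\<forall>i u. affine_param i u \<in> U \<longrightarrow> (\<exists>A. has_jacobian (f \<circ> affine_param i) A u))"

text \<open>
  Non-vanishing of the Jacobian determinant at a point does not depend on the chart around its image.
\<close>

definition dominable_by_C2 :: "P2 set \<Rightarrow> bool" where
  "dominable_by_C2 X \<longleftrightarrow>
     (\<exists>F. holomorphic_into_P2 F UNIV \<and> range F \<subseteq> X \<and>
        (\<exists>w i A. F w \<in> affine_dom i \<and> has_jacobian (affine_chart i \<circ> F) A w \<and> det A \<noteq> 0))"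


section \<open>Normal crossing divisors\<close>

definition coordinate_system :: "P2 set \<Rightarrow> (P2 \<Rightarrow> complex ^ 2) \<Rightarrow> bool" where
  "coordinate_system U \<phi> \<longleftrightarrow> inj_on \<phi> U \<and>
     holomorphic_from_P2 \<phi> U \<and> holomorphic_into_P2 (inv_into U \<phi>) (\<phi> ` U)"

text \<open>
  A reduced curve is identified with its set of points, so that being defined by an equation
  in local coordinates is an equality of sets.
\<close>

definition normal_crossing :: "P2 set \<Rightarrow> bool" where
  "normal_crossing D \<longleftrightarrow>
     (\<forall>p. \<exists>U \<phi>. p \<in> U \<and> coordinate_system U \<phi> \<and> \<phi> p = 0 \<and>
        (D \<inter> U = {} \<or>
         D \<inter> U = {q \<in> U. \<phi> q $ 1 = 0} \<or>
         D \<inter> U = {q \<in> U. \<phi> q $ 1 * \<phi> q $ 2 = 0}))"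

text \<open>Polynomials in three variables: finitely supported maps from exponents to coefficients.\<close>

type_synonym poly3 = "(3 \<Rightarrow>\<^sub>0 nat) \<Rightarrow>\<^sub>0 complex"

definition poly3_eval :: "poly3 \<Rightarrow> complex ^ 3 \<Rightarrow> complex" where
  "poly3_eval P z = (\<Sum>m\<in>Poly_Mapping.keys P.
     Poly_Mapping.lookup P m * (\<Prod>i\<in>UNIV. z $ i ^ Poly_Mapping.lookup m i))"

definition homogeneous :: "nat \<Rightarrow> poly3 \<Rightarrow> bool" where
  "homogeneous d P \<longleftrightarrow> (\<forall>m\<in>Poly_Mapping.keys P. (\<Sum>i\<in>UNIV. Poly_Mapping.lookup m i) = d)"

definition zero_locus :: "poly3 \<Rightarrow> P2 set" where
  "zero_locus P = proj ` {z. z \<noteq> 0 \<and> poly3_eval P z = 0}"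

text \<open>
  \<open>squarefree P\<close> implies \<open>P \<noteq> 0\<close> and expresses that the divisor of \<open>P\<close> is reduced, so its degree
  is \<open>d\<close>. The case \<open>d = 0\<close> is the zero divisor, with empty support.
\<close>

definition reduced_curve :: "P2 set \<Rightarrow> nat \<Rightarrow> bool" where
  "reduced_curve D d \<longleftrightarrow> (\<exists>P. squarefree P \<and> homogeneous d P \<and> D = zero_locus P)"

definition normal_crossing_divisor :: "P2 set \<Rightarrow> nat \<Rightarrow> bool" where
  "normal_crossing_divisor D d \<longleftrightarrow> reduced_curve D d \<and> normal_crossing D"

end

theory Submission
  imports
    Defs
    "HOL-Complex_Analysis.Conformal_Mappings"
    "HOL-Computational_Algebra.Polynomial_Factorial"
    "HOL-Computational_Algebra.Field_as_Ring"
    "HOL-Computational_Algebra.Fundamental_Theorem_Algebra"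
    "HOL-Real_Asymp.Real_Asymp"
begin

text \<open>
  Let \<open>P\<close> be the form of degree \<open>d\<close> that defines the curve. Maps into the complement of the curve are
  studied through their lifts \<open>f\<close> to \<open>\<complex>\<^sup>3\<close>, for which \<open>wronski f\<close>, the determinant of \<open>f\<close> and its two
  partial derivatives \<open>f1\<close> and \<open>f2\<close>, plays the role of the Jacobian determinant.

  Normal crossings enter through the second derivatives of \<open>P\<close>: at a singular point \<open>z\<close> the Hessian of
  \<open>P\<close> has no kernel besides the line through \<open>z\<close> (\<open>singular_point_is_node\<close>, \<open>hessian_nondegenerate\<close>). The
  curve is given as a point set, so this uses that \<open>P\<close> is squarefree: the singular points are finite
  in number (\<open>finite_singular_set\<close>), and the minimum modulus principle shows that \<open>P\<close> vanishes to the
  least possible order even at such an isolated point.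

  For \<open>d \<ge> 4\<close> a map from \<open>\<complex>\<^sup>2\<close> has local lifts with \<open>P f = 1\<close>, unique up to roots of unity. With \<open>h =
  (norm f)\<^sup>2\<close>, with \<open>G\<close> the squared norm of the gradient of \<open>P\<close> at \<open>f\<close>, and with suitable constants, the
  density \<open>v = (cmod (wronski f))\<^sup>2 * h powr \<kappa> * exp (A * h powr (- q) + A * (G / h ^ (d - 1)) powr
  \<delta>)\<close> is therefore a function on \<open>\<complex>\<^sup>2\<close>. It has negative curvature: the sum of the Levi forms of \<open>ln v\<close> in
  the two coordinate directions is at least \<open>c * sqrt v\<close> where \<open>v > 0\<close>, for some \<open>c > 0\<close>
  (\<open>curvature_estimate\<close>). The Fubini-Study form coming from \<open>h powr \<kappa>\<close> does not see the component of \<open>f1\<close>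
  and \<open>f2\<close> along \<open>f\<close>, which moves the point towards the curve; the term with \<open>q\<close> does. The term with \<open>\<delta>\<close>
  makes the remaining components count enough near the nodes, where \<open>G\<close> is small, because of the
  nondegeneracy of the Hessian. The exponent is \<open>\<kappa> = d - 7 / 2\<close>; the condition \<open>\<kappa> > 0\<close> is where \<open>d \<ge> 4\<close> is
  needed, in accordance with the degree \<open>d - 3\<close> of the logarithmic canonical bundle. By the maximum
  principle on large balls, \<open>v\<close> is zero (\<open>not_dominable_of_degree_ge_4\<close>).

  For \<open>d \<le> 3\<close> there are explicit entire lifts. In degree at most two the form is affine in one
  coordinate after a linear change, and can be given a value without zeros. A cubic that is smooth,
  or has a node and is not a triangle, is \<open>X * Q + Y ^ 3\<close> in suitable coordinates. At a node this is
  read off from the Taylor expansion; on a smooth cubic it is the expansion at a flex, which exists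
  by the minimum principle for the Hessian determinant (\<open>ex_flex\<close>). Planes through points of the line
  \<open>X = 0\<close> cut the surface \<open>P = 1\<close> in conics, and the Hamiltonian flows on these conics are entire and
  sweep out an open set of the surface (\<open>dominable_cubic_normal_form\<close>).
\<close>

section \<open>Polynomial functions on \<open>\<complex>\<^sup>3\<close>\<close>

text \<open>
  Rule induction over these closure properties replaces calculations with monomials, for example in
  the proof that partial derivatives commute.
\<close>

inductive polyfun :: "(complex ^ 3 \<Rightarrow> complex) \<Rightarrow> bool" where
  polyfun_const: "polyfun (\<lambda>z. c)"
| polyfun_coord: "polyfun (\<lambda>z. z $ k)"
| polyfun_add: "polyfun f \<Longrightarrow> polyfun g \<Longrightarrow> polyfun (\<lambda>z. f z + g z)"
| polyfun_mult: "polyfun f \<Longrightarrow> polyfun g \<Longrightarrow> polyfun (\<lambda>z. f z * g z)"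

lemma polyfun_sum: "(\<And>i. i \<in> I \<Longrightarrow> polyfun (f i)) \<Longrightarrow> polyfun (\<lambda>z. \<Sum>i\<in>I. f i z)"
  by (induction I rule: infinite_finite_induct) (auto intro: polyfun.intros)

lemma polyfun_prod: "(\<And>i. i \<in> I \<Longrightarrow> polyfun (f i)) \<Longrightarrow> polyfun (\<lambda>z. \<Prod>i\<in>I. f i z)"
  by (induction I rule: infinite_finite_induct) (auto intro: polyfun.intros)

lemma polyfun_power: "polyfun f \<Longrightarrow> polyfun (\<lambda>z. f z ^ n)"
  by (induction n) (auto intro: polyfun.intros)

lemma polyfun_minus: "polyfun f \<Longrightarrow> polyfun (\<lambda>z. - f z)"
  using polyfun_mult[OF polyfun_const[of "-1"], of f] by simp

lemma polyfun_diff: "polyfun f \<Longrightarrow> polyfun g \<Longrightarrow> polyfun (\<lambda>z. f z - g z)"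
  using polyfun_add[OF _ polyfun_minus, of f g] by simp

lemma polyfun_poly3_eval: "polyfun (poly3_eval P)"
  unfolding poly3_eval_def
  by (intro polyfun_sum polyfun_mult polyfun_const polyfun_prod polyfun_power polyfun_coord)

lemma polyfun_compose:
  assumes "polyfun f" "\<And>k. polyfun (\<lambda>z. L z $ k)"
  shows "polyfun (\<lambda>z. f (L z))"
  using assms by (induction) (auto intro: polyfun.intros)

lemma polyfun_matrix: "polyfun f \<Longrightarrow> polyfun (\<lambda>z. f ((M :: complex^3^3) *v z))"
  by (rule polyfun_compose)
     (auto simp: matrix_vector_mult_def intro!: polyfun_sum polyfun_mult polyfun_const polyfun_coord)

definition monomial_value :: "(3 \<Rightarrow>\<^sub>0 nat) \<Rightarrow> complex ^ 3 \<Rightarrow> complex" where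
  "monomial_value m z = (\<Prod>i\<in>UNIV. z $ i ^ Poly_Mapping.lookup m i)"

lemma monomial_value_add: "monomial_value (m + n) z = monomial_value m z * monomial_value n z"
  by (simp add: monomial_value_def lookup_add power_add prod.distrib)

lemma poly3_eval_superset:
  assumes "finite A" "Poly_Mapping.keys P \<subseteq> A"
  shows "poly3_eval P z = (\<Sum>m\<in>A. Poly_Mapping.lookup P m * monomial_value m z)"
  unfolding poly3_eval_def monomial_value_def
  by (rule sum.mono_neutral_left) (use assms in \<open>auto simp: in_keys_iff\<close>)

lemma poly3_eval_add: "poly3_eval (P + Q) z = poly3_eval P z + poly3_eval Q z"
proof -
  let ?A = "Poly_Mapping.keys P \<union> Poly_Mapping.keys Q"
  have "Poly_Mapping.keys (P + Q) \<subseteq> ?A" by (rule keys_add)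
  then show ?thesis
    by (simp add: poly3_eval_superset[of ?A] lookup_add distrib_right sum.distrib)
qed

lemma poly3_eval_zero [simp]: "poly3_eval 0 z = 0"
  by (simp add: poly3_eval_def)

lemma poly3_eval_sum: "poly3_eval (\<Sum>i\<in>I. P i) z = (\<Sum>i\<in>I. poly3_eval (P i) z)"
  by (induction I rule: infinite_finite_induct) (auto simp: poly3_eval_add)

lemma poly3_eval_single: "poly3_eval (Poly_Mapping.single m c) z = c * monomial_value m z"
  by (subst poly3_eval_superset[of "{m}"]) auto

lemma poly_mapping_eq_sum_singles:
  "P = (\<Sum>m\<in>Poly_Mapping.keys P. Poly_Mapping.single m (Poly_Mapping.lookup P m))"
proof (rule poly_mapping_eqI)
  fix k
  show "Poly_Mapping.lookup P k = Poly_Mapping.lookup (\<Sum>m\<in>Poly_Mapping.keys P. Poly_Mapping.single m (Poly_Mapping.lookup P m)) k"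
    by (simp add: lookup_sum lookup_single when_def sum.delta in_keys_iff)
qed

lemma poly3_eval_mult: "poly3_eval (P * Q) z = poly3_eval P z * poly3_eval Q z"
proof -
  have "P * Q = (\<Sum>m\<in>Poly_Mapping.keys P. \<Sum>n\<in>Poly_Mapping.keys Q.
      Poly_Mapping.single (m + n) (Poly_Mapping.lookup P m * Poly_Mapping.lookup Q n))"
    by (subst poly_mapping_eq_sum_singles[of P], subst poly_mapping_eq_sum_singles[of Q])
       (simp add: sum_product mult_single)
  then have "poly3_eval (P * Q) z = (\<Sum>m\<in>Poly_Mapping.keys P. \<Sum>n\<in>Poly_Mapping.keys Q.
      (Poly_Mapping.lookup P m * monomial_value m z) * (Poly_Mapping.lookup Q n * monomial_value n z))"
    by (simp add: poly3_eval_sum poly3_eval_single monomial_value_add mult_ac)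
  also have "\<dots> = poly3_eval P z * poly3_eval Q z"
    by (simp add: sum_product poly3_eval_def monomial_value_def)
  finally show ?thesis .
qed

lemma poly3_eval_one [simp]: "poly3_eval 1 z = 1"
  using poly3_eval_single[of 0 1 z] by (simp add: monomial_value_def)

lemma polyfun_imp_poly3_eval:
  assumes "polyfun f"
  obtains P where "poly3_eval P = f"
proof -
  from assms have "\<exists>P. poly3_eval P = f"
  proof induction
    case (polyfun_const c)
    show ?case
      by (rule exI[of _ "Poly_Mapping.single 0 c"]) (auto simp: poly3_eval_single monomial_value_def)
  next
    case (polyfun_coord k)
    have "(\<Prod>i\<in>UNIV. z $ i ^ (if k = i then Suc 0 else 0)) = z $ k" for z :: "complex ^ 3"
    proof -
      have "(\<Prod>i\<in>UNIV. z $ i ^ (if k = i then Suc 0 else 0)) = (\<Prod>i\<in>UNIV. (if k = i then z $ i else 1))"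
        by (rule prod.cong) auto
      then show ?thesis by simp
    qed
    then show ?case
      by (intro exI[of _ "Poly_Mapping.single (Poly_Mapping.single k 1) 1"] ext)
         (simp add: poly3_eval_single monomial_value_def lookup_single when_def)
  next
    case (polyfun_add f g)
    then obtain P Q where "poly3_eval P = f" "poly3_eval Q = g" by auto
    then show ?case by (intro exI[of _ "P + Q"]) (auto simp: poly3_eval_add)
  next
    case (polyfun_mult f g)
    then obtain P Q where "poly3_eval P = f" "poly3_eval Q = g" by auto
    then show ?case by (intro exI[of _ "P * Q"]) (auto simp: poly3_eval_mult)
  qed
  then show ?thesis using that by auto
qed

text \<open>
  Iterated univariate polynomials with \<open>z\<close> as the outermost variable: the degree, derivation,
  pseudo-division and prime factorization of the ring \<open>\<complex>[x][y][z]\<close> eliminate \<open>z\<close> below.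
\<close>

definition eval3 :: "complex poly poly poly \<Rightarrow> complex ^ 3 \<Rightarrow> complex" where
  "eval3 p z = poly (poly (poly p [:[:z $ 3:]:]) [:z $ 2:]) (z $ 1)"

lemma eval3_add: "eval3 (p + q) z = eval3 p z + eval3 q z"
  and eval3_mult: "eval3 (p * q) z = eval3 p z * eval3 q z"
  by (simp_all add: eval3_def)

lemma eval3_sum: "eval3 (\<Sum>i\<in>I. p i) z = (\<Sum>i\<in>I. eval3 (p i) z)"
  by (induction I rule: infinite_finite_induct) (auto simp: eval3_add eval3_def[of 0])

lemma poly_eq_0_of_infinite_roots:
  fixes p :: "'a::idom poly"
  assumes "inj h" "infinite (UNIV :: 'b set)" "\<And>c::'b. poly p (h c) = 0"
  shows "p = 0"
proof (rule ccontr)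
  assume "p \<noteq> 0"
  then have "finite {x. poly p x = 0}" by (rule poly_roots_finite)
  moreover have "range h \<subseteq> {x. poly p x = 0}" using assms(3) by auto
  ultimately have "finite (range h)" using finite_subset by blast
  with assms(1,2) show False using finite_imageD by blast
qed

lemma poly2_eq_0:
  fixes p :: "complex poly poly"
  assumes "\<And>x y. poly (poly p [:y:]) x = 0"
  shows "p = 0"
proof (rule poly_eq_0_of_infinite_roots[where h = "\<lambda>c::complex. [:c:]"])
  show "poly p [:c:] = 0" for c
    using assms[of c] poly_all_0_iff_0 by blast
qed (auto simp: inj_def infinite_UNIV_char_0)

lemma eval3_eq_0:
  assumes "\<And>z. eval3 p z = 0"
  shows "p = 0"
proof (rule poly_eq_0_of_infinite_roots[where h = "\<lambda>c::complex. [:[:c:]:]"])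
  show "poly p [:[:c:]:] = 0" for c
  proof (rule poly2_eq_0)
    fix x y
    show "poly (poly (poly p [:[:c:]:]) [:y:]) x = 0"
      using assms[of "vector [x, y, c]"] by (simp add: eval3_def)
  qed
qed (auto simp: inj_def infinite_UNIV_char_0)

definition nested_poly :: "poly3 \<Rightarrow> complex poly poly poly" where
  "nested_poly P = (\<Sum>m\<in>Poly_Mapping.keys P.
     monom (monom (monom (Poly_Mapping.lookup P m) (Poly_Mapping.lookup m 1)) (Poly_Mapping.lookup m 2)) (Poly_Mapping.lookup m 3))"

lemma eval3_nested_poly: "eval3 (nested_poly P) z = poly3_eval P z"
proof -
  have "eval3 (monom (monom (monom c i) j) k) z = c * (z $ 1 ^ i * z $ 2 ^ j * z $ 3 ^ k)" for c i j k
    by (simp add: eval3_def poly_monom mult_ac)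
  then show ?thesis
    unfolding nested_poly_def poly3_eval_def eval3_sum UNIV_3
    by (simp add: mult_ac)
qed

lemma nested_poly_eq_0:
  assumes "nested_poly P = 0"
  shows "P = 0"
proof (rule ccontr)
  assume "P \<noteq> 0"
  then obtain m where m: "m \<in> Poly_Mapping.keys P" using keys_eq_empty by blast
  let ?l = "Poly_Mapping.lookup"
  have eq: "?l m' 3 = ?l m 3 \<and> ?l m' 2 = ?l m 2 \<and> ?l m' 1 = ?l m 1 \<longleftrightarrow> m' = m" for m'
    by (auto intro!: poly_mapping_eqI simp: forall_3 intro: ext) (metis exhaust_3)
  have "coeff (coeff (coeff (nested_poly P) (?l m 3)) (?l m 2)) (?l m 1) =
        (\<Sum>m'\<in>Poly_Mapping.keys P. if m' = m then ?l P m' else 0)"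
    unfolding nested_poly_def coeff_sum
    by (rule sum.cong[OF refl]) (use eq in \<open>auto simp: coeff_monom\<close>)
  also have "\<dots> = ?l P m" using m by simp
  finally show False using assms m by (simp add: in_keys_iff)
qed

text \<open>
  A factorization of the function defined by \<open>P\<close> is thus a factorization of \<open>P\<close>, to which
  squarefreeness applies.
\<close>

lemma poly3_eval_inject:
  assumes "poly3_eval P = poly3_eval Q"
  shows "P = Q"
proof -
  have "poly3_eval (P - Q) z = 0" for z
    using poly3_eval_add[of "P - Q" Q z] assms by simp
  then have "nested_poly (P - Q) = 0" by (intro eval3_eq_0) (simp add: eval3_nested_poly)
  then show ?thesis using nested_poly_eq_0 by fastforce
qed

lemma polyfun_imp_eval3:
  assumes "polyfun f"
  obtains p where "eval3 p = f"
  using polyfun_imp_poly3_eval[OF assms] eval3_nested_poly by (metis ext)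

lemma polyfun_eval3: "polyfun (eval3 p)"
proof -
  have a: "polyfun (\<lambda>z. poly p (z $ 1))" for p
  proof (induction p)
    case (pCons c p)
    show ?case using polyfun_add[OF polyfun_const polyfun_mult[OF polyfun_coord pCons(2)]] by simp
  qed (simp add: polyfun_const)
  have b: "polyfun (\<lambda>z. poly (poly p [:z $ 2:]) (z $ 1))" for p
  proof (induction p)
    case (pCons c p)
    show ?case using polyfun_add[OF a polyfun_mult[OF polyfun_coord pCons(2)]] by simp
  qed (simp add: polyfun_const)
  have "polyfun (\<lambda>z. poly (poly (poly p [:[:z $ 3:]:]) [:z $ 2:]) (z $ 1))"
  proof (induction p)
    case (pCons c p)
    show ?case using polyfun_add[OF b polyfun_mult[OF polyfun_coord pCons(2)]] by simp
  qed (simp add: polyfun_const)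
  then show ?thesis by (simp add: eval3_def[abs_def])
qed

lemma polyfun_line:
  assumes "polyfun f"
  obtains q where "\<And>t. f (a + t *s b) = poly q t"
proof -
  from assms have "\<exists>q. \<forall>t. f (a + t *s b) = poly q t"
  proof induction
    case (polyfun_const c)
    show ?case by (rule exI[of _ "[:c:]"]) auto
  next
    case (polyfun_coord k)
    show ?case by (rule exI[of _ "[:a $ k, b $ k:]"]) auto
  next
    case (polyfun_add f g)
    then obtain q r where "\<forall>t. f (a + t *s b) = poly q t" "\<forall>t. g (a + t *s b) = poly r t" by auto
    then show ?case by (intro exI[of _ "q + r"]) auto
  next
    case (polyfun_mult f g)
    then obtain q r where "\<forall>t. f (a + t *s b) = poly q t" "\<forall>t. g (a + t *s b) = poly r t" by auto
    then show ?case by (intro exI[of _ "q * r"]) auto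
  qed
  then show ?thesis using that by auto
qed

section \<open>Gradients and Hessians\<close>

text \<open>
  This is a value of the real Frechet derivative. For the functions considered below that
  derivative is complex linear, and hence equal to \<open>grad\<close>.
\<close>

definition pd :: "(complex ^ 'n \<Rightarrow> complex) \<Rightarrow> 'n::finite \<Rightarrow> complex ^ 'n \<Rightarrow> complex" where
  "pd f k z = frechet_derivative f (at z) (axis k 1)"

definition grad :: "(complex ^ 'n::finite \<Rightarrow> complex) \<Rightarrow> complex ^ 'n \<Rightarrow> complex ^ 'n \<Rightarrow> complex" where
  "grad f z v = (\<Sum>k\<in>UNIV. pd f k z * v $ k)"

definition hess :: "(complex ^ 'n::finite \<Rightarrow> complex) \<Rightarrow> complex ^ 'n \<Rightarrow> complex ^ 'n \<Rightarrow> complex ^ 'n \<Rightarrow> complex" where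
  "hess f z u v = (\<Sum>k\<in>UNIV. \<Sum>l\<in>UNIV. pd (pd f k) l z * u $ k * v $ l)"

lemma pd_eqI:
  assumes "(f has_derivative (\<lambda>v. \<Sum>k\<in>UNIV. g k * v $ k)) (at z)"
  shows "pd f k z = g k"
proof -
  have "frechet_derivative f (at z) = (\<lambda>v. \<Sum>k\<in>UNIV. g k * v $ k)"
    using assms by (metis frechet_derivative_at)
  then show ?thesis by (simp add: pd_def axis_def if_distrib cong: if_cong)
qed

lemma has_derivative_vec_nth: "((\<lambda>z. z $ k) has_derivative (\<lambda>v. v $ k)) F"
  by (rule bounded_linear.has_derivative[OF bounded_linear_vec_nth has_derivative_ident])

lemma polyfun_has_derivative_aux:
  assumes "polyfun f"
  shows "\<exists>g. (\<forall>k. polyfun (g k)) \<and> (\<forall>z. (f has_derivative (\<lambda>v. \<Sum>k\<in>UNIV. g k z * v $ k)) (at z))"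
  using assms
proof induction
  case (polyfun_const c)
  show ?case by (rule exI[of _ "\<lambda>k z. 0"]) (auto intro: polyfun.intros)
next
  case (polyfun_coord k)
  have "(\<Sum>l\<in>UNIV. (if l = k then 1 else 0) * v $ l) = v $ k" for v :: "complex ^ 3"
    by (simp add: if_distrib if_distribR cong: if_cong)
  then show ?case
    by (intro exI[of _ "\<lambda>l z. if l = k then 1 else 0"]) (auto intro: polyfun.intros has_derivative_vec_nth)
next
  case (polyfun_add f g)
  then obtain f' g' where f: "\<forall>k. polyfun (f' k)" "\<forall>z. (f has_derivative (\<lambda>v. \<Sum>k\<in>UNIV. f' k z * v $ k)) (at z)"
    and g: "\<forall>k. polyfun (g' k)" "\<forall>z. (g has_derivative (\<lambda>v. \<Sum>k\<in>UNIV. g' k z * v $ k)) (at z)" by blast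
  show ?case
  proof (intro exI[of _ "\<lambda>k z. f' k z + g' k z"] conjI allI)
    show "((\<lambda>z. f z + g z) has_derivative (\<lambda>v. \<Sum>k\<in>UNIV. (f' k z + g' k z) * v $ k)) (at z)" for z
      using has_derivative_add[OF f(2)[rule_format] g(2)[rule_format], of z]
      by (simp add: distrib_right sum.distrib)
  qed (use f g in \<open>auto intro: polyfun.intros\<close>)
next
  case (polyfun_mult f g)
  then obtain f' g' where f: "\<forall>k. polyfun (f' k)" "\<forall>z. (f has_derivative (\<lambda>v. \<Sum>k\<in>UNIV. f' k z * v $ k)) (at z)"
    and g: "\<forall>k. polyfun (g' k)" "\<forall>z. (g has_derivative (\<lambda>v. \<Sum>k\<in>UNIV. g' k z * v $ k)) (at z)" by blast
  show ?case
  proof (intro exI[of _ "\<lambda>k z. f z * g' k z + f' k z * g z"] conjI allI)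
    show "((\<lambda>z. f z * g z) has_derivative (\<lambda>v. \<Sum>k\<in>UNIV. (f z * g' k z + f' k z * g z) * v $ k)) (at z)" for z
      by (rule has_derivative_eq_rhs[OF has_derivative_mult[OF f(2)[rule_format] g(2)[rule_format], of z]])
         (simp add: algebra_simps sum.distrib sum_distrib_left sum_distrib_right fun_eq_iff)
    show "polyfun (\<lambda>z. f z * g' k z + f' k z * g z)" for k
      using f g polyfun_mult.hyps by (intro polyfun.intros(3,4)) auto
  qed
qed

lemma
  assumes "polyfun f"
  shows polyfun_pd: "polyfun (pd f k)"
    and polyfun_has_derivative: "(f has_derivative grad f z) (at z)"
proof -
  obtain g where g: "\<forall>k. polyfun (g k)" "\<forall>z. (f has_derivative (\<lambda>v. \<Sum>k\<in>UNIV. g k z * v $ k)) (at z)"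
    using polyfun_has_derivative_aux[OF assms] by blast
  have eq: "pd f k z = g k z" for k z
    using pd_eqI[OF g(2)[rule_format]] .
  then have "pd f k = g k" for k by auto
  with g(1) show "polyfun (pd f k)" by simp
  show "(f has_derivative grad f z) (at z)"
    unfolding grad_def[abs_def] using g(2) eq by simp
qed

lemma polyfun_continuous: "polyfun f \<Longrightarrow> continuous_on S f"
  by (rule has_derivative_continuous_on) (rule has_derivative_at_withinI[OF polyfun_has_derivative])

lemma pd_const: "pd (\<lambda>z. c) k = (\<lambda>z. 0)"
  by (rule ext, rule pd_eqI[where g = "\<lambda>k. 0"]) auto

lemma pd_coord: "pd (\<lambda>z :: complex ^ 3. z $ l) k = (\<lambda>z. if k = l then 1 else 0)"
proof (rule ext, rule pd_eqI)
  fix z :: "complex ^ 3"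
  have "(\<Sum>k\<in>UNIV. (if k = l then 1 else 0) * v $ k) = v $ l" for v :: "complex ^ 3"
    by (simp add: if_distrib if_distribR cong: if_cong)
  then show "((\<lambda>z. z $ l) has_derivative (\<lambda>v. \<Sum>k\<in>UNIV. (if k = l then 1 else 0) * v $ k)) (at z)"
    by (auto intro: has_derivative_vec_nth)
qed

lemma pd_add:
  assumes "polyfun f" "polyfun g"
  shows "pd (\<lambda>z. f z + g z) k = (\<lambda>z. pd f k z + pd g k z)"
proof (rule ext, rule pd_eqI)
  fix z
  show "((\<lambda>z. f z + g z) has_derivative (\<lambda>v. \<Sum>k\<in>UNIV. (pd f k z + pd g k z) * v $ k)) (at z)"
    using has_derivative_add[OF polyfun_has_derivative[OF assms(1)] polyfun_has_derivative[OF assms(2)], of z]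
    by (simp add: distrib_right sum.distrib grad_def)
qed

lemma pd_mult:
  assumes "polyfun f" "polyfun g"
  shows "pd (\<lambda>z. f z * g z) k = (\<lambda>z. f z * pd g k z + pd f k z * g z)"
proof (rule ext, rule pd_eqI)
  fix z
  show "((\<lambda>z. f z * g z) has_derivative (\<lambda>v. \<Sum>k\<in>UNIV. (f z * pd g k z + pd f k z * g z) * v $ k)) (at z)"
    by (rule has_derivative_eq_rhs[OF has_derivative_mult[OF polyfun_has_derivative[OF assms(1)] polyfun_has_derivative[OF assms(2)], of z]])
       (simp add: algebra_simps sum.distrib sum_distrib_left sum_distrib_right fun_eq_iff grad_def)
qed

lemma pd_commute:
  assumes "polyfun f"
  shows "pd (pd f k) l = pd (pd f l) k"
  using assms
proof induction
  case (polyfun_const c) then show ?case by (simp add: pd_const)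
next
  case (polyfun_coord j) then show ?case by (simp add: pd_coord pd_const)
next
  case (polyfun_add f g)
  then show ?case by (simp add: pd_add polyfun_pd)
next
  case (polyfun_mult f g)
  then show ?case
    by (simp add: pd_mult pd_add polyfun_pd polyfun.intros) (simp add: algebra_simps)
qed

lemma hess_commute: "polyfun f \<Longrightarrow> hess f z u v = hess f z v u"
  unfolding hess_def
  by (subst sum.swap) (simp add: pd_commute[of f] mult_ac)

lemma grad_add: "grad f z (u + v) = grad f z u + grad f z v"
  and grad_scale: "grad f z (c *s v) = c * grad f z v"
  and grad_diff: "grad f z (u - v) = grad f z u - grad f z v"
  by (simp_all add: grad_def algebra_simps sum.distrib sum_distrib_left sum_subtractf)

lemma hess_add_left: "hess f z (u + u') v = hess f z u v + hess f z u' v"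
  and hess_scale_left: "hess f z (c *s u) v = c * hess f z u v"
  and hess_add_right: "hess f z v (u + u') = hess f z v u + hess f z v u'"
  and hess_scale_right: "hess f z v (c *s u) = c * hess f z v u"
  by (simp_all add: hess_def algebra_simps sum.distrib sum_distrib_left sum_subtractf)

section \<open>Homogeneous forms\<close>

definition form :: "nat \<Rightarrow> (complex ^ 3 \<Rightarrow> complex) \<Rightarrow> bool" where
  "form d p \<longleftrightarrow> polyfun p \<and> (\<forall>c z. p (c *s z) = c ^ d * p z)"

lemma formD: "form d p \<Longrightarrow> polyfun p" "form d p \<Longrightarrow> p (c *s z) = c ^ d * p z"
  by (auto simp: form_def)

lemma form_poly3_eval:
  assumes "homogeneous d P"
  shows "form d (poly3_eval P)"
  unfolding form_def
proof (intro conjI allI polyfun_poly3_eval)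
  fix c :: complex and z :: "complex ^ 3"
  have "monomial_value m (c *s z) = c ^ d * monomial_value m z" if "m \<in> Poly_Mapping.keys P" for m
  proof -
    have "monomial_value m (c *s z) = c ^ (\<Sum>i\<in>UNIV. Poly_Mapping.lookup m i) * monomial_value m z"
      by (simp add: monomial_value_def power_mult_distrib prod.distrib power_sum)
    with assms that show ?thesis by (simp add: homogeneous_def)
  qed
  then show "poly3_eval P (c *s z) = c ^ d * poly3_eval P z"
    by (simp add: poly3_eval_superset[of "Poly_Mapping.keys P"] sum_distrib_left mult_ac)
qed

lemma has_derivative_line: "((\<lambda>c. a + c *s (b :: complex ^ 'n::finite)) has_derivative (\<lambda>c. c *s b)) (at t)"
proof -
  have "bounded_linear (\<lambda>c. c *s b)"
    unfolding linear_conv_bounded_linear[symmetric]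
    by (rule linearI) (auto simp: vec_eq_iff algebra_simps)
  from bounded_linear.has_derivative[OF this has_derivative_ident]
  show ?thesis by (rule has_derivative_add_const[of _ _ _ a, simplified add.commute[of _ a]])
qed

lemma polyfun_line_derivative:
  assumes "polyfun f"
  shows "((\<lambda>c. f (a + c *s b)) has_field_derivative grad f (a + t *s b) b) (at t)"
  using has_derivative_compose[OF has_derivative_line polyfun_has_derivative[OF assms]]
  by (simp add: has_field_derivative_def grad_scale mult_commute_abs)

lemma Euler:
  assumes "form d p"
  shows "grad p z z = of_nat d * p z"
proof -
  have "((\<lambda>c. p (0 + c *s z)) has_field_derivative grad p (0 + 1 *s z) z) (at 1)"
    by (rule polyfun_line_derivative[OF formD(1)[OF assms]])
  moreover have "((\<lambda>c. c ^ d * p z) has_field_derivative of_nat d * p z) (at 1)"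
    by (auto intro!: derivative_eq_intros)
  ultimately show ?thesis
    using formD(2)[OF assms] DERIV_unique by fastforce
qed

lemma polyfun_eq_on_punctured_line:
  assumes "polyfun f" "polyfun g" "\<And>c. c \<noteq> 0 \<Longrightarrow> f (c *s a) = g (c *s a)"
  shows "f 0 = g 0"
proof -
  obtain q where q: "\<And>t. f (0 + t *s a) - g (0 + t *s a) = poly q t"
    using polyfun_line[OF polyfun_diff[OF assms(1,2)]] by blast
  have "q = 0"
  proof (rule poly_eq_0_of_infinite_roots[where h = "\<lambda>n. of_nat (Suc n)"])
    show "poly q (of_nat (Suc n)) = 0" for n
      unfolding q[symmetric] using assms(3) by (simp del: of_nat_Suc)
  qed (auto simp: inj_def)
  then show ?thesis using q[of 0] by simp
qed

text \<open>
  Differentiating \<open>p (c *s z) = c ^ Suc d * p z\<close> along a line gives the claim for \<open>c \<noteq> 0\<close>. At \<open>c = 0\<close> the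
  homogeneity just obtained determines the value of the derivative at the origin: by polynomial
  interpolation if \<open>d = 0\<close>, and by comparison with \<open>c = 2\<close> otherwise.
\<close>

lemma form_pd:
  assumes "form (Suc d) p"
  shows "form d (pd p k)"
  unfolding form_def
proof (intro conjI allI)
  note pf = formD(1)[OF assms]
  show pfk: "polyfun (pd p k)" by (rule polyfun_pd[OF pf])
  have *: "pd p k (c *s z) = c ^ d * pd p k z" if c: "c \<noteq> 0" for c z
  proof -
    have "((\<lambda>t. p (c *s z + t *s axis k 1)) has_field_derivative pd p k (c *s z)) (at 0)"
      using polyfun_line_derivative[OF pf, of "c *s z" "axis k 1" 0]
      by (simp add: grad_def axis_def if_distrib cong: if_cong)
    moreover have "((\<lambda>t. c ^ Suc d * p (z + (t / c) *s axis k 1)) has_field_derivative c ^ d * pd p k z) (at 0)"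
    proof -
      have "((\<lambda>t. p (z + t *s axis k 1)) has_field_derivative pd p k z) (at (0 / c))"
        using polyfun_line_derivative[OF pf, of z "axis k 1" 0]
        by (simp add: grad_def axis_def if_distrib cong: if_cong)
      from DERIV_chain2[where f = "\<lambda>t. p (z + t *s axis k 1)" and g = "\<lambda>t. t / c" and Db = "1 / c" and s = UNIV, OF this]
      have "((\<lambda>t. p (z + (t / c) *s axis k 1)) has_field_derivative pd p k z * (1 / c)) (at 0)"
        by (simp add: DERIV_cdivide[OF DERIV_ident])
      from DERIV_cmult[OF this, of "c ^ Suc d"] c show ?thesis by (simp add: field_simps)
    qed
    moreover have "p (c *s z + t *s axis k 1) = c ^ Suc d * p (z + (t / c) *s axis k 1)" for t
      using formD(2)[OF assms, of c "z + (t / c) *s axis k 1"] c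
      by (simp add: vector_add_ldistrib vector_smult_assoc)
    ultimately show ?thesis using DERIV_unique by fastforce
  qed
  fix c :: complex and z :: "complex ^ 3"
  show "pd p k (c *s z) = c ^ d * pd p k z"
  proof (cases "c = 0")
    case False with * show ?thesis by blast
  next
    case True
    show ?thesis
    proof (cases "d = 0")
      case True
      have "pd p k 0 = (\<lambda>_. pd p k z) (0 :: complex ^ 3)"
        by (rule polyfun_eq_on_punctured_line[OF pfk polyfun_const]) (use * True in auto)
      with True \<open>c = 0\<close> show ?thesis by simp
    next
      case False
      have "pd p k 0 = 2 ^ d * pd p k 0" using *[of 2 0] by simp
      then have "(2 ^ d - 1) * pd p k 0 = 0" by (simp add: algebra_simps)
      moreover have "(2 ^ d :: complex) \<noteq> 1"
      proof
        assume "(2 ^ d :: complex) = 1"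
        then have "norm (2 ^ d :: complex) = 1" by simp
        then have "(2 :: real) ^ d = 1" by (simp add: norm_power)
        with False show False by (metis one_less_power one_less_numeral_iff semiring_norm(76) less_irrefl gr0I)
      qed
      ultimately show ?thesis using True False by simp
    qed
  qed
qed

lemma Euler_hess:
  assumes "form (Suc d) p"
  shows "hess p z z v = of_nat d * grad p z v"
proof -
  have "hess p z z v = hess p z v z" using hess_commute formD(1)[OF assms] by blast
  also have "\<dots> = (\<Sum>k\<in>UNIV. v $ k * grad (pd p k) z z)"
    unfolding hess_def grad_def by (simp add: sum_distrib_left mult_ac)
  also have "\<dots> = of_nat d * grad p z v"
    by (simp add: Euler[OF form_pd[OF assms]]) (simp add: grad_def sum_distrib_left mult_ac)
  finally show ?thesis .
qed

section \<open>The singular points of a reduced plane curve\<close>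

lemma proj_eq_iff:
  assumes "z \<noteq> 0" "w \<noteq> 0"
  shows "proj z = proj w \<longleftrightarrow> (\<exists>c. c \<noteq> 0 \<and> w = c *s z)"
proof -
  have "proportional u u" if "u \<noteq> 0" for u
    unfolding proportional_def using that by (auto intro: exI[of _ 1])
  then have "proportional z w \<longleftrightarrow> proj z = proj w"
    using Quotient_rel[OF Quotient_P2, of z w] assms by blast
  then show ?thesis using assms by (auto simp: proportional_def)
qed

lemma proj_scale: "c \<noteq> 0 \<Longrightarrow> z \<noteq> 0 \<Longrightarrow> proj (c *s z) = proj z"
  using proj_eq_iff[of z "c *s z"] by auto

lemma proj_surj: obtains z where "z \<noteq> 0" "p = proj z"
proof -
  have "\<exists>z. z \<noteq> 0 \<and> p = proj z"
    by (induction p rule: P2.abs_induct) (auto simp: proportional_def)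
  then show ?thesis using that by blast
qed

lemma complete_basis:
  assumes "u \<noteq> (0 :: complex ^ 3)"
  obtains M N :: "complex ^ 3 ^ 3" where "M ** N = mat 1" "N ** M = mat 1" "M *v axis 3 1 = u"
proof -
  obtain k where k: "u $ k \<noteq> 0" using assms by (auto simp: vec_eq_iff)
  define e e' :: "complex ^ 3" where "e = (if k = 1 then axis 2 1 else axis 1 1)"
    and "e' = (if k = 3 then axis 2 1 else axis 3 1)"
  define M :: "complex ^ 3 ^ 3" where "M = (\<chi> i j. if j = 1 then e $ i else if j = 2 then e' $ i else u $ i)"
  have "det M \<noteq> 0"
    using k exhaust_3[of k] by (auto simp: det_3 M_def e_def e'_def axis_def)
  then obtain N where "M ** N = mat 1" "N ** M = mat 1"
    unfolding invertible_det_nz[symmetric] invertible_def by blast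
  moreover have "M *v axis 3 1 = u"
    by (simp add: vec_eq_iff matrix_vector_mult_def M_def axis_def sum_3)
  ultimately show ?thesis using that by blast
qed

lemma form_matrix:
  assumes "form d p"
  shows "form d (\<lambda>z. p ((M :: complex^3^3) *v z))"
  unfolding form_def
proof (intro conjI allI)
  show "polyfun (\<lambda>z. p (M *v z))" using polyfun_matrix formD(1)[OF assms] .
  show "p (M *v (c *s z)) = c ^ d * p (M *v z)" for c z
    using formD(2)[OF assms] by (simp add: vector_scalar_commute)
qed

lemma form_0_const: "form 0 p \<Longrightarrow> p z = p 0"
  using formD(2)[of 0 p 0 z] by simp

lemma form_at_0: "form (Suc d) p \<Longrightarrow> p 0 = 0"
  using formD(2)[of "Suc d" p 0 0] by simp

definition specialize :: "complex \<Rightarrow> complex \<Rightarrow> complex poly poly poly \<Rightarrow> complex poly" where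
  "specialize x y p = map_poly (\<lambda>c. poly (poly c [:y:]) x) p"

lemma poly_specialize: "poly (specialize x y p) z = eval3 p (vector [x, y, z])"
proof -
  have "poly (specialize x y p) z = poly (poly (poly p [:[:z:]:]) [:y:]) x"
    unfolding specialize_def by (induction p) (simp_all add: map_poly_pCons)
  then show ?thesis by (simp add: eval3_def)
qed

lemma pderiv_specialize: "pderiv (specialize x y p) = specialize x y (pderiv p)"
  unfolding specialize_def
  by (rule poly_eqI) (simp add: coeff_pderiv coeff_map_poly)

lemma poly3_has_zero:
  assumes "degree p > 0"
  obtains z where "eval3 p z = 0"
proof -
  have "lead_coeff p \<noteq> 0" using assms by auto
  then obtain x y where xy: "poly (poly (lead_coeff p) [:y:]) x \<noteq> 0" using poly2_eq_0 by blast
  then have "coeff (specialize x y p) (degree p) \<noteq> 0" by (simp add: specialize_def coeff_map_poly)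
  then have "degree (specialize x y p) > 0" using assms le_degree by fastforce
  then have "\<not> constant (poly (specialize x y p))" by (simp add: constant_degree)
  then show ?thesis using fundamental_theorem_of_algebra that poly_specialize by metis
qed

lemma prime_factor_of_positive_degree:
  fixes m :: "complex poly poly poly"
  assumes "degree m > 0"
  obtains q where "prime q" "q dvd m" "degree q > 0"
proof -
  have "degree m > 0 \<longrightarrow> (\<exists>q. prime q \<and> q dvd m \<and> degree q > 0)"
  proof (induction m rule: prime_divisors_induct)
    case (unit x)
    then show ?case by (auto simp: is_unit_poly_iff)
  next
    case (factor p x)
    show ?case
    proof (cases "degree p > 0")
      case True with factor show ?thesis by auto
    next
      case False
      then show ?thesis using factor degree_mult_le[of p x] by (auto simp: dvd_mult)
    qed
  qed auto
  with assms that show ?thesis by blast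
qed

text \<open>
  Let \<open>m\<close> have the least degree in \<open>z\<close> among the nonzero elements of the ideal generated by \<open>q\<close> and its
  \<open>z\<close>-derivative. If that degree is zero, \<open>m\<close> is an eliminant. Otherwise pseudo-division by \<open>m\<close> shows that
  a prime factor \<open>s\<close> of \<open>m\<close> of positive degree divides the whole ideal, and a common prime factor of \<open>q\<close>
  and its derivative is a multiple factor of \<open>q\<close>.
\<close>

lemma elimination_or_square:
  fixes q :: "complex poly poly poly"
  assumes "degree q > 0"
  obtains (eliminant) A B R where "R \<noteq> 0" "A * q + B * pderiv q = [:R:]"
    | (square) s b where "q = s * s * b" "degree s > 0"
proof -
  define I where "I = {m. \<exists>A B. m = A * q + B * pderiv q}"
  have q: "q \<in> I" unfolding I_def by (rule CollectI, rule exI[of _ 1], rule exI[of _ 0]) simp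
  have dq: "pderiv q \<in> I" unfolding I_def by (rule CollectI, rule exI[of _ 0], rule exI[of _ 1]) simp
  have lin: "a * f + b * g \<in> I" if fI: "f \<in> I" and gI: "g \<in> I" for a b f g
  proof -
    obtain A B where f: "f = A * q + B * pderiv q" using fI unfolding I_def by auto
    obtain C D where g: "g = C * q + D * pderiv q" using gI unfolding I_def by auto
    from f g
    have "a * f + b * g = (a * A + b * C) * q + (a * B + b * D) * pderiv q"
      by (simp add: algebra_simps)
    then show ?thesis unfolding I_def by blast
  qed
  have "q \<noteq> 0" using assms by auto
  then obtain m where m: "m \<in> I" "m \<noteq> 0" and min: "\<And>r. r \<in> I \<Longrightarrow> r \<noteq> 0 \<Longrightarrow> degree m \<le> degree r"
    using ex_has_least_nat[of "\<lambda>r. r \<in> I \<and> r \<noteq> 0" q degree] q by blast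
  show ?thesis
  proof (cases "degree m = 0")
    case True
    then obtain R where R: "m = [:R:]" by (metis degree_eq_zeroE)
    obtain A B where "m = A * q + B * pderiv q" using m(1) unfolding I_def by auto
    with R m(2) show ?thesis by (intro that(1)[of R A B]) auto
  next
    case False
    then obtain s where s: "prime s" "s dvd m" "degree s > 0"
      using prime_factor_of_positive_degree by blast
    have sdvd: "s dvd f" if f: "f \<in> I" for f
    proof -
      obtain a g where a: "a \<noteq> 0" "smult a f = m * g + pseudo_mod f m"
        using pseudo_mod(1)[OF m(2)] by blast
      have "pseudo_mod f m = [:a:] * f + (- g) * m" using a(2) by simp
      then have "pseudo_mod f m \<in> I" by (metis lin[OF f m(1)])
      then have "pseudo_mod f m = 0" using min pseudo_mod(2)[OF m(2), of f] by force
      then have "s dvd [:a:] * f" using a(2) s(2) by (simp add: dvd_trans[OF s(2)])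
      moreover have "\<not> s dvd [:a:]"
        using s(3) a(1) dvd_imp_degree_le[of s "[:a:]"] by auto
      ultimately show ?thesis using s(1) prime_dvd_mult_iff by blast
    qed
    obtain c where c: "q = s * c" using sdvd[OF q] by (auto elim: dvdE)
    have "pderiv q = s * pderiv c + c * pderiv s" unfolding c by (simp add: pderiv_mult)
    with sdvd[OF dq] have "s dvd c * pderiv s" by (metis dvd_add_right_iff dvd_triv_left)
    moreover have "\<not> s dvd pderiv s"
    proof
      assume "s dvd pderiv s"
      moreover have "pderiv s \<noteq> 0" using s(3) by (simp add: pderiv_eq_0_iff)
      ultimately have "degree s \<le> degree (pderiv s)" by (rule dvd_imp_degree_le)
      with s(3) show False by (simp add: degree_pderiv)
    qed
    ultimately have "s dvd c" using s(1) prime_dvd_mult_iff by blast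
    then obtain b where "c = s * b" by (auto elim: dvdE)
    with c have "q = s * s * b" by (simp add: mult_ac)
    with s(3) that(2) show ?thesis by blast
  qed
qed

lemma grad_chain_matrix:
  assumes "polyfun p"
  shows "grad (\<lambda>z. p ((M :: complex^3^3) *v z)) z v = grad p (M *v z) (M *v v)"
proof -
  have "((\<lambda>c. p (M *v (z + c *s v))) has_field_derivative grad (\<lambda>z. p (M *v z)) (z + 0 *s v) v) (at 0)"
    by (rule polyfun_line_derivative[OF polyfun_matrix[OF assms, of M]])
  moreover have "((\<lambda>c. p (M *v z + c *s (M *v v))) has_field_derivative grad p (M *v z + 0 *s (M *v v)) (M *v v)) (at 0)"
    by (rule polyfun_line_derivative[OF assms])
  moreover have "M *v (z + c *s v) = M *v z + c *s (M *v v)" for c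
    by (simp add: vec_eq_iff matrix_vector_mult_def sum_distrib_left algebra_simps sum.distrib)
  ultimately show ?thesis using DERIV_unique by fastforce
qed

text \<open>
  In coordinates in which the curve avoids \<open>[0 : 0 : 1]\<close>, only finitely many of its points lie over
  each \<open>[x : y]\<close>. A squarefree form has no multiple factor, so there is an eliminant \<open>R x y\<close>; it
  vanishes at every multiple of a singular point and leaves finitely many possible \<open>[x : y]\<close>.
\<close>

theorem finite_singular_set:
  assumes sqf: "squarefree P" and hom: "homogeneous d P"
  shows "finite (proj ` {z. z \<noteq> 0 \<and> poly3_eval P z = 0 \<and> (\<forall>v. grad (poly3_eval P) z v = 0)})"
proof (cases d)
  case 0
  have f0: "form 0 (poly3_eval P)" using form_poly3_eval[OF hom] 0 by simp
  have "P \<noteq> 0" using sqf by auto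
  have False if z: "poly3_eval P z = 0" for z
  proof -
    have "poly3_eval P w = poly3_eval 0 w" for w
      using form_0_const[OF f0, of w] form_0_const[OF f0, of z] z by simp
    then have "poly3_eval P = poly3_eval 0" by (rule ext)
    then show False using poly3_eval_inject \<open>P \<noteq> 0\<close> by blast
  qed
  then have "{z. z \<noteq> 0 \<and> poly3_eval P z = 0 \<and> (\<forall>v. grad (poly3_eval P) z v = 0)} = {}" by auto
  then show ?thesis by (simp only: image_empty finite.emptyI)
next
  case (Suc d')
  define p where "p = poly3_eval P"
  have fp: "form d p" unfolding p_def by (rule form_poly3_eval[OF hom])
  have fp': "form (Suc d') p" using fp Suc by simp
  have "P \<noteq> 0" using sqf by auto
  then obtain u where u: "p u \<noteq> 0"
    using poly3_eval_inject[of P 0] unfolding p_def by (metis poly3_eval_zero ext)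
  have "u \<noteq> 0" using u form_at_0[OF fp'] by auto
  then obtain M N :: "complex ^ 3 ^ 3" where M: "M ** N = mat 1" "N ** M = mat 1" "M *v axis 3 1 = u"
    by (rule complete_basis)
  define p' where "p' = (\<lambda>z. p (M *v z))"
  have fp1: "form d p'" unfolding p'_def by (rule form_matrix[OF fp])
  then have fp1': "form (Suc d') p'" using Suc by simp
  have pu: "p' (axis 3 1) \<noteq> 0" using u M by (simp add: p'_def)
  obtain q where q: "eval3 q = p'" using polyfun_imp_eval3 formD(1)[OF fp1] by blast
  have spec: "poly (specialize x y q) z = p' (vector [x, y, z])" for x y z
    by (simp add: poly_specialize q)
  have ax: "axis 3 1 = (vector [0, 0, 1] :: complex ^ 3)"
    by (simp add: vec_eq_iff forall_3 axis_def)
  have degq: "degree q > 0"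
  proof (rule ccontr)
    assume "\<not> degree q > 0"
    then obtain R where "q = [:R:]" by (metis degree_eq_zeroE gr0I)
    then have "p' (vector [0, 0, 1]) = p' (vector [0, 0, 0])"
      unfolding q[symmetric] by (simp add: eval3_def)
    moreover have "vector [0, 0, 0] = (0 :: complex ^ 3)" by (simp add: vec_eq_iff forall_3)
    ultimately show False using form_at_0[OF fp1'] pu ax by simp
  qed
  have fin_z: "finite {z. p' (vector [x, y, z]) = 0}" for x y
  proof -
    have "specialize x y q \<noteq> 0"
    proof
      assume 0: "specialize x y q = 0"
      have "p' (axis 3 1 + c *s vector [x, y, 0]) = 0" if "c \<noteq> 0" for c
      proof -
        have "axis 3 1 + c *s vector [x, y, 0] = c *s (vector [x, y, 1 / c] :: complex ^ 3)"
          using that by (simp add: vec_eq_iff forall_3 axis_def)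
        then show ?thesis using formD(2)[OF fp1, of c] spec[of x y "1 / c"] 0 by simp
      qed
      moreover obtain r where r: "\<And>t. p' (axis 3 1 + t *s vector [x, y, 0]) = poly r t"
        using polyfun_line[OF formD(1)[OF fp1]] by blast
      ultimately have "poly r (of_nat (Suc n)) = 0" for n
        using of_nat_neq_0 by metis
      then have "r = 0"
        by (intro poly_eq_0_of_infinite_roots[where h = "\<lambda>n. of_nat (Suc n)"]) (auto simp: inj_def)
      then show False using r[of 0] pu by simp
    qed
    then show ?thesis using poly_roots_finite by (simp add: spec[symmetric])
  qed
  define S where "S = {z. z \<noteq> 0 \<and> p z = 0 \<and> (\<forall>v. grad p z v = 0)}"
  from degq show ?thesis
  proof (cases rule: elimination_or_square)
    case (eliminant A B R)
    (* singular points are normalized to x = l or to (x, y) = (0, 1), where R restricted to x = l is not zero *)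
    obtain j where j: "coeff R j \<noteq> 0" using eliminant(1) by (metis leading_coeff_0_iff)
    have "finite ({x. poly (coeff R j) x = 0} \<union> {0})" using poly_roots_finite[OF j] by simp
    then obtain l where "l \<notin> {x. poly (coeff R j) x = 0} \<union> {0}"
      using ex_new_if_finite[OF infinite_UNIV_char_0] by blast
    then have l: "l \<noteq> 0" "poly (coeff R j) l \<noteq> 0" by auto
    define Rl where "Rl = map_poly (\<lambda>c. poly c l) R"
    have "coeff Rl j \<noteq> 0" using l by (simp add: Rl_def coeff_map_poly)
    then have "Rl \<noteq> 0" by auto
    have Rl: "poly Rl y = poly (poly R [:y:]) l" for y
      unfolding Rl_def by (induction R) (simp_all add: map_poly_pCons)
    define F :: "(complex ^ 3) set" where "F = (\<Union>y\<in>{y. poly Rl y = 0}. (\<lambda>z. vector [l, y, z]) ` {z. p' (vector [l, y, z]) = 0})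
       \<union> (\<lambda>z. vector [0, 1, z]) ` {z. p' (vector [0, 1, z]) = 0}"
    have finF: "finite F" unfolding F_def using fin_z poly_roots_finite[OF \<open>Rl \<noteq> 0\<close>] by auto
    have "proj ` S \<subseteq> (\<lambda>z. proj (M *v z)) ` F"
    proof
      fix x assume "x \<in> proj ` S"
      then obtain w0 where w0: "w0 \<noteq> 0" "p w0 = 0" "\<And>v. grad p w0 v = 0" "x = proj w0"
        unfolding S_def by auto
      define w where "w = N *v w0"
      have Mw: "M *v w = w0" using M(1) by (simp add: w_def matrix_vector_mul_assoc)
      have p'c: "p' (c *s w) = 0" for c
        using formD(2)[OF fp1, of c w] Mw w0 by (simp add: p'_def)
      have fin: "c *s w \<in> F \<Longrightarrow> c \<noteq> 0 \<Longrightarrow> x \<in> (\<lambda>z. proj (M *v z)) ` F" for c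
        using w0 Mw by (intro image_eqI[of _ _ "c *s w"]) (simp_all add: vector_scalar_commute proj_scale)
      have gr: "grad p' (c *s w) v = 0" for c v
      proof -
        have "grad p' (c *s w) v = grad p (c *s w0) (M *v v)"
          unfolding p'_def grad_chain_matrix[OF formD(1)[OF fp]] vector_scalar_commute Mw ..
        also have "\<dots> = c ^ d' * grad p w0 (M *v v)"
          unfolding grad_def by (simp add: formD(2)[OF form_pd[OF fp']] sum_distrib_left mult_ac)
        finally show ?thesis using w0 by simp
      qed
      have Rc: "poly (poly R [:y:]) x = 0" if "vector [x, y, z] = c *s w" for x y z c
      proof -
        have d: "poly (pderiv (specialize x y q)) z = 0"
        proof -
          have "((\<lambda>t. p' (vector [x, y, z] + t *s axis 3 1)) has_field_derivative
              grad p' (vector [x, y, z] + 0 *s axis 3 1) (axis 3 1)) (at 0)"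
            by (rule polyfun_line_derivative[OF formD(1)[OF fp1]])
          moreover have "vector [x, y, z] + t *s axis 3 1 = (vector [x, y, z + t] :: complex ^ 3)" for t
            by (simp add: vec_eq_iff forall_3 axis_def)
          ultimately have "((\<lambda>t. poly (specialize x y q) (z + t)) has_field_derivative 0) (at 0)"
            using gr that by (simp add: spec)
          moreover have "((\<lambda>t. poly (specialize x y q) (z + t)) has_field_derivative
              poly (pderiv (specialize x y q)) (z + 0) * 1) (at 0)"
            by (rule DERIV_chain2[OF poly_DERIV]) (auto intro!: derivative_eq_intros)
          ultimately show ?thesis using DERIV_unique by fastforce
        qed
        have "eval3 (A * q + B * pderiv q) (vector [x, y, z]) = 0"
          using d p'c[of c] that
          by (simp add: eval3_add eval3_mult q pderiv_specialize poly_specialize)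
        then show ?thesis unfolding eliminant(2) by (simp add: eval3_def)
      qed
      have w3: "w = vector [w $ 1, w $ 2, w $ 3]" by (simp add: vec_eq_iff forall_3)
      consider "w $ 1 \<noteq> 0" | "w $ 1 = 0" "w $ 2 \<noteq> 0" | "w $ 1 = 0" "w $ 2 = 0" by blast
      then show "x \<in> (\<lambda>z. proj (M *v z)) ` F"
      proof cases
        case 1
        define c where "c = l / w $ 1"
        have c: "c \<noteq> 0" using 1 l by (simp add: c_def)
        have eq: "vector [l, c * w $ 2, c * w $ 3] = c *s w"
          using 1 by (simp add: vec_eq_iff forall_3 c_def)
        then have "poly Rl (c * w $ 2) = 0" using Rc Rl by simp
        moreover have "p' (vector [l, c * w $ 2, c * w $ 3]) = 0" using eq p'c by simp
        ultimately have "vector [l, c * w $ 2, c * w $ 3] \<in> F" unfolding F_def by auto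
        then show ?thesis using fin c eq by simp
      next
        case 2
        define c where "c = 1 / w $ 2"
        have c: "c \<noteq> 0" using 2 by (simp add: c_def)
        have eq: "vector [0, 1, c * w $ 3] = c *s w"
          using 2 by (simp add: vec_eq_iff forall_3 c_def)
        have "p' (vector [0, 1, c * w $ 3]) = 0" using eq p'c by simp
        then have "vector [0, 1, c * w $ 3] \<in> F" unfolding F_def by (intro UnI2 imageI) simp
        then have "c *s w \<in> F" using eq by simp
        then show ?thesis using fin c by simp
      next
        case 3
        have "w = w $ 3 *s axis 3 1" using 3 by (simp add: vec_eq_iff forall_3 axis_def)
        then have "p' w = (w $ 3) ^ d * p' (axis 3 1)" using formD(2)[OF fp1] by metis
        then have "w $ 3 = 0" using p'c[of 1] pu by simp
        with 3 have "w = 0" by (simp add: vec_eq_iff forall_3)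
        then show ?thesis using Mw w0 by simp
      qed
    qed
    then have "finite (proj ` S)" using finF finite_subset by blast
    then show ?thesis by (simp add: S_def p_def)
  next
    case (square s b)
    obtain A where A: "poly3_eval A = (\<lambda>z. eval3 s (N *v z))"
      using polyfun_imp_poly3_eval[OF polyfun_matrix[OF polyfun_eval3]] by blast
    obtain B where B: "poly3_eval B = (\<lambda>z. eval3 b (N *v z))"
      using polyfun_imp_poly3_eval[OF polyfun_matrix[OF polyfun_eval3]] by blast
    have "poly3_eval P z = poly3_eval (A\<^sup>2 * B) z" for z
    proof -
      have "poly3_eval P z = p' (N *v z)"
        using M(1) by (simp add: p'_def p_def matrix_vector_mul_assoc)
      also have "\<dots> = poly3_eval (A\<^sup>2 * B) z"
        unfolding q[symmetric] square(1) power2_eq_square by (simp add: poly3_eval_mult eval3_mult A B)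
      finally show ?thesis .
    qed
    then have "P = A\<^sup>2 * B" by (intro poly3_eval_inject ext)
    then have "A dvd 1" using sqf by (auto simp: squarefree_def)
    then obtain A' where "1 = A * A'" by (auto elim: dvdE)
    then have one: "poly3_eval A z * poly3_eval A' z = 1" for z
      using poly3_eval_mult[of A A' z] by simp
    obtain z where "eval3 s z = 0" using poly3_has_zero[OF square(2)] .
    then have "poly3_eval A (M *v z) = 0"
      using M(2) by (simp add: A matrix_vector_mul_assoc)
    with one[of "M *v z"] show ?thesis by simp
  qed
qed

section \<open>Complex differentiability in several variables\<close>

text \<open>
  This is complex differentiability, because \<open>grad f w\<close> is complex linear by its definition.
\<close>

definition cdiff :: "(complex ^ 'n::finite \<Rightarrow> complex) \<Rightarrow> complex ^ 'n \<Rightarrow> bool" where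
  "cdiff f w \<longleftrightarrow> (f has_derivative grad f w) (at w)"

lemma
  assumes D: "(f has_derivative D) (at w)" and lin: "\<And>c v. D (c *s v) = c * D v"
  shows cdiffI: "cdiff f w" and grad_eqI: "grad f w = D"
proof -
  interpret D: bounded_linear D using D by (rule has_derivative_bounded_linear)
  have D_eq: "D v = (\<Sum>k\<in>UNIV. D (axis k 1) * v $ k)" for v
  proof -
    have "v = (\<Sum>k\<in>UNIV. v $ k *s axis k 1)" by (simp add: basis_expansion)
    then have "D v = D (\<Sum>k\<in>UNIV. v $ k *s axis k 1)" by metis
    also have "\<dots> = (\<Sum>k\<in>UNIV. D (axis k 1) * v $ k)" by (simp add: D.sum lin mult.commute)
    finally show ?thesis .
  qed
  have "(f has_derivative (\<lambda>v. \<Sum>k\<in>UNIV. D (axis k 1) * v $ k)) (at w)"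
    using D unfolding D_eq[symmetric] .
  from pd_eqI[OF this] have eq: "pd f k w = D (axis k 1)" for k .
  show g: "grad f w = D" unfolding grad_def[abs_def] eq by (rule ext) (rule D_eq[symmetric])
  show "cdiff f w" unfolding cdiff_def g by (rule D)
qed

lemma cdiff_const: "cdiff (\<lambda>w. c) w" "grad (\<lambda>w. c) w = (\<lambda>v. 0)"
  by (rule cdiffI[where D = "\<lambda>v. 0"] grad_eqI; auto)+

lemma cdiff_coord: "cdiff (\<lambda>w. w $ k) w" "grad (\<lambda>w. w $ k) w = (\<lambda>v. v $ k)"
  by (rule cdiffI[where D = "\<lambda>v. v $ k"] grad_eqI; auto intro: has_derivative_vec_nth)+

lemma
  assumes "cdiff f w" "cdiff g w"
  shows cdiff_add: "cdiff (\<lambda>w. f w + g w) w"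
    and gr_add: "grad (\<lambda>w. f w + g w) w = (\<lambda>v. grad f w v + grad g w v)"
    and cdiff_mult: "cdiff (\<lambda>w. f w * g w) w"
    and gr_mult: "grad (\<lambda>w. f w * g w) w = (\<lambda>v. f w * grad g w v + grad f w v * g w)"
proof -
  note d = assms[unfolded cdiff_def]
  show "cdiff (\<lambda>w. f w + g w) w" "grad (\<lambda>w. f w + g w) w = (\<lambda>v. grad f w v + grad g w v)"
    by (rule cdiffI[OF has_derivative_add[OF d]] grad_eqI[OF has_derivative_add[OF d]];
        simp add: grad_scale algebra_simps)+
  show "cdiff (\<lambda>w. f w * g w) w" "grad (\<lambda>w. f w * g w) w = (\<lambda>v. f w * grad g w v + grad f w v * g w)"
    by (rule cdiffI[OF has_derivative_mult[OF d]] grad_eqI[OF has_derivative_mult[OF d]];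
        simp add: grad_scale algebra_simps)+
qed

lemma cdiff_compose:
  assumes "cdiff f w" "(\<phi> has_field_derivative c) (at (f w))"
  shows "cdiff (\<lambda>w. \<phi> (f w)) w"
proof -
  have "((\<lambda>w. \<phi> (f w)) has_derivative (\<lambda>v. c * grad f w v)) (at w)"
    using has_derivative_compose[OF assms(1)[unfolded cdiff_def] assms(2)[unfolded has_field_derivative_def]] .
  then show ?thesis by (rule cdiffI) (simp add: grad_scale mult_ac)
qed

lemma cdiff_cmult: "cdiff f w \<Longrightarrow> cdiff (\<lambda>w. c * f w) w"
  and gr_cmult: "cdiff f w \<Longrightarrow> grad (\<lambda>w. c * f w) w = (\<lambda>v. c * grad f w v)"
  using cdiff_mult[OF cdiff_const(1), of f w c] gr_mult[OF cdiff_const(1), of f w c]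
  by (simp_all add: cdiff_const(2))

lemma cdiff_minus: "cdiff f w \<Longrightarrow> cdiff (\<lambda>w. - f w) w"
  using cdiff_cmult[of f w "-1"] by simp

lemma cdiff_diff: "cdiff f w \<Longrightarrow> cdiff g w \<Longrightarrow> cdiff (\<lambda>w. f w - g w) w"
  using cdiff_add[OF _ cdiff_minus, of f w g] by simp

lemma cdiff_power: "cdiff f w \<Longrightarrow> cdiff (\<lambda>w. f w ^ n) w"
  by (induction n) (auto intro: cdiff_const cdiff_mult)

lemma cdiff_exp: "cdiff f w \<Longrightarrow> cdiff (\<lambda>w. exp (f w)) w"
  using cdiff_compose[OF _ DERIV_exp] .

lemma cdiff_inverse: "cdiff f w \<Longrightarrow> f w \<noteq> 0 \<Longrightarrow> cdiff (\<lambda>w. inverse (f w)) w"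
  using cdiff_compose[OF _ DERIV_inverse] .

lemma cdiff_divide: "cdiff f w \<Longrightarrow> cdiff g w \<Longrightarrow> g w \<noteq> 0 \<Longrightarrow> cdiff (\<lambda>w. f w / g w) w"
  unfolding divide_inverse by (intro cdiff_mult cdiff_inverse)

lemma cdiff_continuous: "cdiff f w \<Longrightarrow> isCont f w"
  unfolding cdiff_def by (rule has_derivative_continuous)

lemma
  assumes "\<forall>\<^sub>F x in nhds w. f x = g x"
  shows cdiff_cong: "cdiff f w \<longleftrightarrow> cdiff g w" and grad_cong: "cdiff f w \<Longrightarrow> grad f w = grad g w"
proof -
  have imp: "cdiff g w \<and> grad g w = grad f w" if f: "cdiff f w" and eq: "\<forall>\<^sub>F x in nhds w. f x = g x"
    for f g :: "complex ^ 'a \<Rightarrow> complex"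
  proof -
    have "(g has_derivative grad f w) (at w)"
      using has_derivative_transform_eventually[OF f[unfolded cdiff_def]] eq
        eventually_nhds_x_imp_x[OF eq] by (simp add: eventually_at_filter eventually_mono)
    then show ?thesis using cdiffI grad_eqI grad_scale by metis
  qed
  have sym: "\<forall>\<^sub>F x in nhds w. g x = f x" using assms by (rule eventually_mono) simp
  show "cdiff f w \<longleftrightarrow> cdiff g w" using imp[OF _ assms] imp[OF _ sym] by blast
  show "cdiff f w \<Longrightarrow> grad f w = grad g w" using imp[OF _ assms] by simp
qed

lemma has_derivative_vecI:
  fixes f :: "'a::real_normed_vector \<Rightarrow> complex ^ 'm::finite"
  assumes "\<And>k. ((\<lambda>w. f w $ k) has_derivative (\<lambda>v. D v $ k)) F"
  shows "(f has_derivative D) F"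
proof -
  have lin: "bounded_linear (\<lambda>c. c *s (axis k 1 :: complex ^ 'm))" for k
    unfolding linear_conv_bounded_linear[symmetric]
    by (rule linearI) (auto simp: vec_eq_iff algebra_simps)
  have "((\<lambda>w. \<Sum>k\<in>UNIV. f w $ k *s axis k 1) has_derivative (\<lambda>v. \<Sum>k\<in>UNIV. D v $ k *s axis k 1)) F"
    by (rule has_derivative_sum) (rule bounded_linear.has_derivative[OF lin assms])
  then show ?thesis by (simp add: basis_expansion)
qed

definition vcdiff :: "(complex ^ 'n::finite \<Rightarrow> complex ^ 'm::finite) \<Rightarrow> complex ^ 'n \<Rightarrow> bool" where
  "vcdiff f w \<longleftrightarrow> (\<forall>k. cdiff (\<lambda>w. f w $ k) w)"

definition vgrad :: "(complex ^ 'n::finite \<Rightarrow> complex ^ 'm::finite) \<Rightarrow> complex ^ 'n \<Rightarrow> complex ^ 'n \<Rightarrow> complex ^ 'm" where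
  "vgrad f w v = (\<chi> k. grad (\<lambda>w. f w $ k) w v)"

lemma vcdiff_has_derivative: "vcdiff f w \<Longrightarrow> (f has_derivative vgrad f w) (at w)"
  by (rule has_derivative_vecI) (auto simp: vcdiff_def vgrad_def cdiff_def)

lemma vcdiff_continuous: "vcdiff f w \<Longrightarrow> isCont f w"
  using vcdiff_has_derivative has_derivative_continuous by blast

lemma vgrad_scale: "vgrad f w (c *s v) = c *s vgrad f w v"
  and vgrad_add: "vgrad f w (u + v) = vgrad f w u + vgrad f w v"
  by (simp_all add: vgrad_def vec_eq_iff grad_scale grad_add)

lemma
  assumes "(f has_derivative D) (at w)" "\<And>c v. D (c *s v) = c *s D v"
  shows vcdiffI: "vcdiff f w" and vgrad_eqI: "vgrad f w = D"
proof -
  have d: "((\<lambda>w. f w $ k) has_derivative (\<lambda>v. D v $ k)) (at w)" for k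
    using bounded_linear.has_derivative[OF bounded_linear_vec_nth assms(1)] .
  show "vcdiff f w" unfolding vcdiff_def using cdiffI[OF d] assms(2) by simp
  show "vgrad f w = D" using grad_eqI[OF d] assms(2) by (simp add: vgrad_def fun_eq_iff vec_eq_iff)
qed

lemma has_jacobian_vgrad:
  assumes "has_jacobian f A w"
  shows "vcdiff f w" "vgrad f w = (\<lambda>v. A *v v)"
  using vcdiffI[OF assms[unfolded has_jacobian_def]] vgrad_eqI[OF assms[unfolded has_jacobian_def]]
    vector_scalar_commute by auto

lemma vcdiff_has_jacobian:
  assumes "vcdiff f w"
  shows "has_jacobian f (\<chi> i j. pd (\<lambda>w. f w $ i) j w) w"
proof -
  have "vgrad f w = (\<lambda>v. (\<chi> i j. pd (\<lambda>w. f w $ i) j w) *v v)"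
    by (simp add: vgrad_def matrix_vector_mult_def grad_def fun_eq_iff)
  then show ?thesis using vcdiff_has_derivative[OF assms] unfolding has_jacobian_def by simp
qed

lemma has_jacobian_entry:
  assumes "has_jacobian f A w"
  shows "A $ i $ j = vgrad f w (axis j 1) $ i"
  using has_jacobian_vgrad(2)[OF assms] by (simp add: matrix_vector_mult_def axis_def if_distrib cong: if_cong)

lemma
  assumes "polyfun p" "vcdiff f w"
  shows cdiff_polyfun: "cdiff (\<lambda>w. p (f w)) w"
    and gr_polyfun: "grad (\<lambda>w. p (f w)) w = (\<lambda>v. grad p (f w) (vgrad f w v))"
proof -
  have "((\<lambda>w. p (f w)) has_derivative (\<lambda>v. grad p (f w) (vgrad f w v))) (at w)"
    using has_derivative_compose[OF vcdiff_has_derivative[OF assms(2)] polyfun_has_derivative[OF assms(1)]] .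
  then show "cdiff (\<lambda>w. p (f w)) w" "grad (\<lambda>w. p (f w)) w = (\<lambda>v. grad p (f w) (vgrad f w v))"
    by (rule cdiffI grad_eqI; simp add: vgrad_scale grad_scale)+
qed

lemma
  assumes "cdiff \<phi> w" "vcdiff f w"
  shows vcdiff_smult: "vcdiff (\<lambda>w. \<phi> w *s f w) w"
    and vgrad_smult: "vgrad (\<lambda>w. \<phi> w *s f w) w v = \<phi> w *s vgrad f w v + grad \<phi> w v *s f w"
  using assms by (simp_all add: vcdiff_def vgrad_def vec_eq_iff cdiff_mult gr_mult)

lemma vgrad_cong:
  assumes "\<forall>\<^sub>F x in nhds w. f x = g x" "vcdiff f w"
  shows "vcdiff g w" "vgrad f w = vgrad g w"
proof -
  have e: "\<forall>\<^sub>F x in nhds w. f x $ k = g x $ k" for k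
    using assms(1) by (rule eventually_mono) simp
  show "vcdiff g w" using assms(2) cdiff_cong[OF e] by (simp add: vcdiff_def)
  show "vgrad f w = vgrad g w" using assms(2) grad_cong[OF e]
    by (simp add: vgrad_def vec_eq_iff fun_eq_iff vcdiff_def)
qed

lemma cdiff_slice:
  assumes "cdiff f (a + t *s b)"
  shows "((\<lambda>c. f (a + c *s b)) has_field_derivative grad f (a + t *s b) b) (at t)"
  using has_derivative_compose[OF has_derivative_line assms[unfolded cdiff_def]]
  by (simp add: has_field_derivative_def grad_scale mult_commute_abs)

section \<open>Lifts of maps into the projective plane\<close>

definition det3 :: "complex ^ 3 \<Rightarrow> complex ^ 3 \<Rightarrow> complex ^ 3 \<Rightarrow> complex" where
  "det3 a b c = a $ 1 * (b $ 2 * c $ 3 - b $ 3 * c $ 2) - a $ 2 * (b $ 1 * c $ 3 - b $ 3 * c $ 1)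
     + a $ 3 * (b $ 1 * c $ 2 - b $ 2 * c $ 1)"

text \<open>
  For a lift \<open>f\<close> of a map into the projective plane this is the Jacobian determinant of the cone over
  the map.
\<close>

definition wronski :: "(complex ^ 2 \<Rightarrow> complex ^ 3) \<Rightarrow> complex ^ 2 \<Rightarrow> complex" where
  "wronski f w = det3 (f w) (vgrad f w (axis 1 1)) (vgrad f w (axis 2 1))"

lemma wronski_smult:
  assumes "cdiff \<phi> w" "vcdiff f w"
  shows "wronski (\<lambda>w. \<phi> w *s f w) w = \<phi> w ^ 3 * wronski f w"
  unfolding wronski_def vgrad_smult[OF assms] det3_def
  by (simp add: algebra_simps power3_eq_cube)

lemma wronski_cong:
  assumes "\<forall>\<^sub>F x in nhds w. f x = g x" "vcdiff f w"
  shows "wronski f w = wronski g w"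
  using vgrad_cong[OF assms] eventually_nhds_x_imp_x[OF assms(1)] by (simp add: wronski_def)

definition homog :: "3 \<Rightarrow> complex ^ 2 \<Rightarrow> complex ^ 3" where
  "homog i u = (if i = 1 then vector [1, u $ 1, u $ 2]
           else if i = 2 then vector [u $ 1, 1, u $ 2]
           else vector [u $ 1, u $ 2, 1])"

definition dehomog :: "3 \<Rightarrow> complex ^ 3 \<Rightarrow> complex ^ 2" where
  "dehomog i z = (if i = 1 then vector [z $ 2 / z $ 1, z $ 3 / z $ 1]
         else if i = 2 then vector [z $ 1 / z $ 2, z $ 3 / z $ 2]
         else vector [z $ 1 / z $ 3, z $ 2 / z $ 3])"

lemma affine_param_homog: "affine_param i u = proj (homog i u)"
  by (simp add: affine_param_def homog_def)

lemma homog_nth_same [simp]: "homog i u $ i = 1"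
  using exhaust_3[of i] by (auto simp: homog_def)

lemma homog_nonzero [simp]: "homog i u \<noteq> 0"
  using homog_nth_same[of i u] by (metis zero_index zero_neq_one)

lemma dehomog_homog [simp]: "dehomog i (homog i u) = u"
  using exhaust_3[of i] by (auto simp: homog_def dehomog_def vec_eq_iff forall_2)

lemma homog_dehomog: "z $ i \<noteq> 0 \<Longrightarrow> homog i (dehomog i z) = inverse (z $ i) *s z"
  using exhaust_3[of i] by (auto simp: homog_def dehomog_def vec_eq_iff forall_3 field_simps)

lemma proportional_refl: "z \<noteq> 0 \<Longrightarrow> proportional z z"
  unfolding proportional_def by (auto intro: exI[of _ 1])

lemma in_affine_dom_proj: "z \<noteq> 0 \<Longrightarrow> proj z \<in> affine_dom i \<longleftrightarrow> z $ i \<noteq> 0"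
  unfolding affine_dom_def using in_affine.abs_eq[OF proportional_refl] by simp

lemma affine_chart_proj: "z \<noteq> 0 \<Longrightarrow> affine_chart i (proj z) = dehomog i z"
  unfolding dehomog_def using affine_chart.abs_eq[OF proportional_refl] by simp

lemma affine_param_chart: "p \<in> affine_dom i \<Longrightarrow> proj (homog i (affine_chart i p)) = p"
  by (rule proj_surj[of p])
     (simp add: in_affine_dom_proj affine_chart_proj homog_dehomog proj_scale)

lemma affine_chart_param: "affine_chart i (affine_param i u) = u" "affine_param i u \<in> affine_dom i"
  by (simp_all add: affine_param_homog affine_chart_proj in_affine_dom_proj)

lemma open_affine_dom: "open (affine_dom i)"
proof -
  have "{z. z \<noteq> 0 \<and> proj z \<in> affine_dom i} = {z. z $ i \<noteq> 0}"
    using in_affine_dom_proj by (metis (lifting) zero_index)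
  moreover have "open {z :: complex ^ 3. z $ i \<noteq> 0}"
    by (intro open_Collect_neq continuous_intros)
  ultimately show ?thesis unfolding open_P2_def by simp
qed

lemma ex_affine_dom: obtains i where "p \<in> affine_dom i"
proof (rule proj_surj[of p])
  fix z assume z: "z \<noteq> 0" "p = proj z"
  then obtain i where "z $ i \<noteq> 0" by (auto simp: vec_eq_iff)
  with z that show ?thesis using in_affine_dom_proj by blast
qed

definition lifts :: "(complex ^ 2 \<Rightarrow> complex ^ 3) \<Rightarrow> (complex ^ 2 \<Rightarrow> P2) \<Rightarrow> (complex ^ 2) set \<Rightarrow> bool" where
  "lifts f F N \<longleftrightarrow> open N \<and> (\<forall>w\<in>N. vcdiff f w \<and> f w \<noteq> 0 \<and> proj (f w) = F w)"

lemma homog_vcdiff: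
  assumes "vcdiff u w"
  shows "vcdiff (\<lambda>w. homog i (u w)) w"
proof -
  have u: "cdiff (\<lambda>w. u w $ k) w" for k using assms by (simp add: vcdiff_def)
  show ?thesis unfolding vcdiff_def forall_3 homog_def
    using exhaust_3[of i] by (auto intro: cdiff_const u)
qed

lemma wronski_homog:
  assumes "has_jacobian u A w"
  shows "wronski (\<lambda>w. homog i (u w)) w = det A \<or> wronski (\<lambda>w. homog i (u w)) w = - det A"
proof -
  have A: "A $ r $ j = grad (\<lambda>w. u w $ r) w (axis j 1)" for r j
    using has_jacobian_entry[OF assms] by (simp add: vgrad_def)
  show ?thesis
    using exhaust_3[of i]
    by (auto simp: wronski_def det3_def vgrad_def homog_def det_2 A cdiff_const(2))
qed

lemma chart_lift:
  assumes "holomorphic_into_P2 F V"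
  shows "lifts (\<lambda>w. homog i (affine_chart i (F w))) F {w \<in> V. F w \<in> affine_dom i}"
proof -
  have V: "open V" "continuous_on V F"
    and J: "\<And>w. w \<in> V \<Longrightarrow> F w \<in> affine_dom i \<Longrightarrow> \<exists>A. has_jacobian (affine_chart i \<circ> F) A w"
    using assms unfolding holomorphic_into_P2_def by auto
  have "open (F -` affine_dom i \<inter> V)"
    using continuous_open_preimage[OF V(2,1) open_affine_dom] by (simp add: Int_commute)
  moreover have "F -` affine_dom i \<inter> V = {w \<in> V. F w \<in> affine_dom i}" by auto
  moreover have "vcdiff (\<lambda>w. affine_chart i (F w)) w" if "w \<in> V" "F w \<in> affine_dom i" for w
    using J[OF that] has_jacobian_vgrad(1) by (auto simp: o_def)
  ultimately show ?thesis unfolding lifts_def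
    using affine_param_chart by (auto intro!: homog_vcdiff)
qed

lemma open_proj_preimage: "open U \<Longrightarrow> open {z. z \<noteq> 0 \<and> proj z \<in> U}"
  unfolding open_P2_def .

text \<open>
  A lift is its \<open>i\<close>-th coordinate times the homogenized chart expression, and \<open>wronski\<close> is multiplied
  by the cube of a scalar factor. The sign depends on the position of the coordinate \<open>i\<close>.
\<close>

lemma lift_chart_jacobian:
  assumes "vcdiff f w" "f w \<noteq> 0" "f w $ i \<noteq> 0" "\<forall>\<^sub>F x in nhds w. f x \<noteq> 0 \<and> F x = proj (f x)"
  obtains A where "has_jacobian (affine_chart i \<circ> F) A w"
    "wronski f w = (f w $ i) ^ 3 * det A \<or> wronski f w = - ((f w $ i) ^ 3 * det A)"
proof -
  let ?u = "\<lambda>w. dehomog i (f w)"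
  have fk: "cdiff (\<lambda>w. f w $ k) w" for k using assms(1) by (simp add: vcdiff_def)
  have u: "vcdiff ?u w"
    unfolding vcdiff_def forall_2 dehomog_def using exhaust_3[of i] assms(3)
    by (auto intro!: cdiff_divide fk)
  then obtain A where A: "has_jacobian ?u A w" using vcdiff_has_jacobian by blast
  have ev: "\<forall>\<^sub>F x in nhds w. ?u x = (affine_chart i \<circ> F) x"
    using assms(4) by (rule eventually_mono) (simp add: affine_chart_proj)
  have "has_jacobian (affine_chart i \<circ> F) A w"
    using A vgrad_cong[OF ev u] vcdiff_has_derivative has_jacobian_vgrad(2)[OF A]
    unfolding has_jacobian_def by metis
  moreover have "wronski f w = wronski (\<lambda>w. f w $ i *s homog i (?u w)) w"
  proof (rule wronski_cong[OF _ assms(1)])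
    have "isCont (\<lambda>w. f w $ i) w" using fk cdiff_continuous by blast
    then have "\<forall>\<^sub>F x in nhds w. f x $ i \<noteq> 0"
      using assms(3) tendsto_imp_eventually_ne[of "\<lambda>w. f w $ i" "f w $ i" "at w" 0]
      by (simp add: isCont_def eventually_nhds_conv_at)
    then show "\<forall>\<^sub>F x in nhds w. f x = f x $ i *s homog i (?u x)"
      by (rule eventually_mono) (simp add: homog_dehomog vector_smult_assoc)
  qed
  then have "wronski f w = (f w $ i) ^ 3 * wronski (\<lambda>w. homog i (?u w)) w"
    using wronski_smult[OF fk homog_vcdiff[OF u]] by simp
  then have "wronski f w = (f w $ i) ^ 3 * det A \<or> wronski f w = - ((f w $ i) ^ 3 * det A)"
    using wronski_homog[OF A, of i] by auto
  ultimately show ?thesis using that by blast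
qed

text \<open>
  All dominating maps constructed below come from entire maps into \<open>\<complex>\<^sup>3\<close> that avoid the cone over the
  curve.
\<close>

theorem dominable_by_lift:
  assumes form: "form d (poly3_eval P)"
    and f: "\<And>w. vcdiff f w" and P: "\<And>w. poly3_eval P (f w) \<noteq> 0" and nz: "\<And>w. f w \<noteq> 0"
    and W: "wronski f w0 \<noteq> 0"
  shows "dominable_by_C2 (- zero_locus P)"
proof -
  define F where "F = (\<lambda>w. proj (f w))"
  have cont: "continuous_on UNIV f" using vcdiff_continuous[OF f] continuous_at_imp_continuous_on by blast
  have hol: "holomorphic_into_P2 F UNIV"
    unfolding holomorphic_into_P2_def
  proof (intro conjI allI ballI impI)
    show "continuous_on UNIV F"
    proof (subst continuous_on_open_vimage, simp, intro allI impI)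
      fix U :: "P2 set" assume "open U"
      then have "open (f -` {z. z \<noteq> 0 \<and> proj z \<in> U})"
        using open_vimage[OF open_proj_preimage cont] by blast
      moreover have "f -` {z. z \<noteq> 0 \<and> proj z \<in> U} = F -` U \<inter> UNIV" using nz by (auto simp: F_def)
      ultimately show "open (F -` U \<inter> UNIV)" by simp
    qed
    fix i w assume "F w \<in> affine_dom i"
    then have "f w $ i \<noteq> 0" using in_affine_dom_proj[OF nz] by (simp add: F_def)
    then show "\<exists>A. has_jacobian (affine_chart i \<circ> F) A w"
      using lift_chart_jacobian[OF f nz, of w i F] nz by (auto simp: F_def)
  qed simp
  have "F w \<notin> zero_locus P" for w
  proof
    assume "F w \<in> zero_locus P"
    then obtain z where z: "z \<noteq> 0" "poly3_eval P z = 0" "proj (f w) = proj z"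
      by (auto simp: zero_locus_def F_def)
    then obtain c where "f w = c *s z" using proj_eq_iff[of z "f w"] nz by auto
    then show False using formD(2)[OF form] z P by (metis mult_zero_right)
  qed
  then have "range F \<subseteq> - zero_locus P" by auto
  moreover obtain i where i: "f w0 $ i \<noteq> 0" using nz[of w0] by (auto simp: vec_eq_iff)
  obtain A where "has_jacobian (affine_chart i \<circ> F) A w0"
    "wronski f w0 = (f w0 $ i) ^ 3 * det A \<or> wronski f w0 = - ((f w0 $ i) ^ 3 * det A)"
    using lift_chart_jacobian[OF f nz i, of F] nz by (auto simp: F_def)
  moreover have "F w0 \<in> affine_dom i" using in_affine_dom_proj[OF nz] i by (simp add: F_def)
  ultimately show ?thesis unfolding dominable_by_C2_def using hol W by fastforce
qed

section \<open>Second-order jets\<close>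

text \<open>
  The expansion \<open>f \<zeta> = a + b * \<zeta> + c * \<zeta>\<^sup>2 + o(\<zeta>\<^sup>2)\<close>. It requires no differentiability away from \<open>0\<close>,
  so it applies to an implicitly given branch of a curve before that branch is known to be
  holomorphic.
\<close>

definition jet :: "(complex \<Rightarrow> complex) \<Rightarrow> complex \<Rightarrow> complex \<Rightarrow> complex \<Rightarrow> bool" where
  "jet f a b c \<longleftrightarrow> f 0 = a \<and> ((\<lambda>\<zeta>. (f \<zeta> - a - b * \<zeta>) / \<zeta>\<^sup>2) \<longlongrightarrow> c) (at 0)"

lemma jet_const: "jet (\<lambda>\<zeta>. a) a 0 0"
  by (simp add: jet_def)

lemma jet_tendsto:
  assumes "jet f a b c"
  shows "(f \<longlongrightarrow> a) (at 0)"
proof -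
  have "((\<lambda>\<zeta>. a + b * \<zeta> + (f \<zeta> - a - b * \<zeta>) / \<zeta>\<^sup>2 * \<zeta>\<^sup>2) \<longlongrightarrow> a + b * 0 + c * 0\<^sup>2) (at 0)"
    using assms unfolding jet_def by (intro tendsto_intros) auto
  then have "(f \<longlongrightarrow> a + b * 0 + c * 0\<^sup>2) (at 0)"
    by (rule Lim_transform_eventually) (auto simp: eventually_at_filter)
  then show ?thesis by simp
qed

lemma jet_add:
  assumes "jet f a b c" "jet g a' b' c'"
  shows "jet (\<lambda>\<zeta>. f \<zeta> + g \<zeta>) (a + a') (b + b') (c + c')"
proof -
  have "((\<lambda>\<zeta>. (f \<zeta> - a - b * \<zeta>) / \<zeta>\<^sup>2 + (g \<zeta> - a' - b' * \<zeta>) / \<zeta>\<^sup>2) \<longlongrightarrow> c + c') (at 0)"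
    using assms unfolding jet_def by (intro tendsto_intros) auto
  then show ?thesis using assms unfolding jet_def
    by (simp add: add_divide_distrib[symmetric] algebra_simps)
qed

lemma jet_mult:
  assumes "jet f a b c" "jet g a' b' c'"
  shows "jet (\<lambda>\<zeta>. f \<zeta> * g \<zeta>) (a * a') (a * b' + b * a') (a * c' + b * b' + c * a')"
proof -
  have "((\<lambda>\<zeta>. (a + b * \<zeta>) * ((g \<zeta> - a' - b' * \<zeta>) / \<zeta>\<^sup>2) + b * b' + (f \<zeta> - a - b * \<zeta>) / \<zeta>\<^sup>2 * g \<zeta>)
     \<longlongrightarrow> (a + b * 0) * c' + b * b' + c * a') (at 0)"
    using assms jet_tendsto[OF assms(2)] unfolding jet_def by (intro tendsto_intros) auto
  then have "((\<lambda>\<zeta>. (f \<zeta> * g \<zeta> - a * a' - (a * b' + b * a') * \<zeta>) / \<zeta>\<^sup>2)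
     \<longlongrightarrow> (a + b * 0) * c' + b * b' + c * a') (at 0)"
    by (rule Lim_transform_eventually)
       (auto simp: eventually_at_filter field_simps power2_eq_square)
  then show ?thesis using assms by (simp add: jet_def)
qed

lemma jet_holomorphic:
  assumes "f holomorphic_on S" "open S" "0 \<in> S" "(f has_field_derivative b) (at 0)"
  obtains c where "jet f (f 0) b c"
proof -
  have b: "deriv f 0 = b" using assms(4) by (rule DERIV_imp_deriv)
  define h where "h = (\<lambda>z. if z = 0 then deriv f 0 else (f z - f 0) / (z - 0))"
  have "h holomorphic_on S" unfolding h_def by (rule pole_lemma_open[OF assms(1,2)])
  then have "(h has_field_derivative deriv h 0) (at 0)"
    using assms(2,3) holomorphic_derivI by blast
  then have "((\<lambda>z. (h z - h 0) / (z - 0)) \<longlongrightarrow> deriv h 0) (at 0)"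
    by (simp add: DERIV_def has_field_derivative_iff)
  then have "((\<lambda>z. (f z - f 0 - b * z) / z\<^sup>2) \<longlongrightarrow> deriv h 0) (at 0)"
    by (rule Lim_transform_eventually)
       (auto simp: eventually_at_filter h_def b field_simps power2_eq_square)
  then show ?thesis using that by (simp add: jet_def)
qed

lemma hess_add:
  assumes "polyfun f" "polyfun g"
  shows "hess (\<lambda>z. f z + g z) z u v = hess f z u v + hess g z u v"
  using assms by (simp add: hess_def pd_add polyfun_pd algebra_simps sum.distrib)

lemma hess_mult:
  assumes "polyfun f" "polyfun g"
  shows "hess (\<lambda>z. f z * g z) z u v =
    f z * hess g z u v + g z * hess f z u v + grad f z u * grad g z v + grad f z v * grad g z u"
proof -
  have eq: "pd (pd (\<lambda>z. f z * g z) k) l z = f z * pd (pd g k) l z + g z * pd (pd f k) l z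
     + pd f k z * pd g l z + pd f l z * pd g k z" for k l
    using assms by (simp add: pd_mult pd_add polyfun_pd polyfun.intros algebra_simps)
  have "hess (\<lambda>z. f z * g z) z u v = (\<Sum>k\<in>UNIV. \<Sum>l\<in>UNIV.
      f z * (pd (pd g k) l z * u $ k * v $ l) + g z * (pd (pd f k) l z * u $ k * v $ l)
     + (pd f k z * u $ k) * (pd g l z * v $ l) + (pd g k z * u $ k) * (pd f l z * v $ l))"
    unfolding hess_def eq by (simp add: algebra_simps)
  also have "\<dots> = f z * hess g z u v + g z * hess f z u v + grad f z u * grad g z v + grad f z v * grad g z u"
  proof -
    have "grad a z b * grad c z w = (\<Sum>k\<in>UNIV. \<Sum>l\<in>UNIV. (pd a k z * b $ k) * (pd c l z * w $ l))"
      for a c :: "complex ^ 3 \<Rightarrow> complex" and b w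
      by (simp add: grad_def sum_product)
    moreover have "c * hess a z u v = (\<Sum>k\<in>UNIV. \<Sum>l\<in>UNIV. c * (pd (pd a k) l z * u $ k * v $ l))"
      for a :: "complex ^ 3 \<Rightarrow> complex" and c
      by (simp add: hess_def sum_distrib_left)
    ultimately show ?thesis
      unfolding mult.commute[of "grad f z v" "grad g z u"] by (simp add: sum.distrib)
  qed
  finally show ?thesis .
qed

lemma jet_polyfun:
  fixes \<gamma> :: "complex \<Rightarrow> complex ^ 3"
  assumes "polyfun f" and j: "\<And>k. jet (\<lambda>\<zeta>. \<gamma> \<zeta> $ k) (a $ k) (b $ k) (c $ k)"
  shows "jet (\<lambda>\<zeta>. f (\<gamma> \<zeta>)) (f a) (grad f a b) (grad f a c + hess f a b b / 2)"
  using assms(1)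
proof induction
  case (polyfun_const c)
  then show ?case using jet_const by (simp add: grad_def hess_def pd_const)
next
  case (polyfun_coord k)
  have "grad (\<lambda>z. z $ k) a v = v $ k" for v :: "complex ^ 3"
    by (simp add: cdiff_coord(2))
  moreover have "hess (\<lambda>z. z $ k) a b b = 0" by (simp add: hess_def pd_coord pd_const)
  ultimately show ?case using j by simp
next
  case (polyfun_add f g)
  show ?case
    using jet_add[OF polyfun_add.IH] polyfun_add.hyps
    by (simp add: hess_add gr_add cdiff_def polyfun_has_derivative add_divide_distrib algebra_simps)
next
  case (polyfun_mult f g)
  have gr: "grad (\<lambda>z. f z * g z) a v = f a * grad g a v + grad f a v * g a" for v
    using polyfun_mult.hyps by (simp add: gr_mult cdiff_def polyfun_has_derivative)
  have "f a * (grad g a c + hess g a b b / 2) + grad f a b * grad g a b + (grad f a c + hess f a b b / 2) * g a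
      = grad (\<lambda>z. f z * g z) a c + hess (\<lambda>z. f z * g z) a b b / 2"
    unfolding gr hess_mult[OF polyfun_mult.hyps] by (simp add: distrib_left distrib_right add_divide_distrib)
  then show ?case
    using jet_mult[OF polyfun_mult.IH] unfolding gr by simp
qed

section \<open>The Cauchy formula for partial derivatives\<close>

lemma norm_smult: "norm (c *s (v :: complex ^ 'n::finite)) = cmod c * norm v"
  by (simp add: norm_vec_def norm_mult L2_set_right_distrib)

abbreviation circ :: "real \<Rightarrow> complex" where
  "circ t \<equiv> exp (2 * of_real pi * \<i> * of_real t)"

lemma Cauchy_grad:
  assumes "0 < r" and c: "\<And>\<zeta>. cmod \<zeta> \<le> r \<Longrightarrow> cdiff f (w + \<zeta> *s v)"
  shows "grad f w v = integral {0..1} (\<lambda>t. f (w + (r * circ t) *s v) / (r * circ t))"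
proof -
  define h where "h = (\<lambda>\<zeta>. f (w + \<zeta> *s v))"
  have h: "(h has_field_derivative grad f (w + \<zeta> *s v) v) (at \<zeta>)" if "cmod \<zeta> \<le> r" for \<zeta>
    unfolding h_def using cdiff_slice[OF c[OF that]] .
  have cont: "continuous_on (cball 0 r) h"
    by (rule DERIV_continuous_on) (use h in \<open>auto intro: DERIV_subset\<close>)
  have hol: "h holomorphic_on ball 0 r"
    unfolding holomorphic_on_def field_differentiable_def
    using h by (meson DERIV_subset less_imp_le mem_ball_0 top_greatest)
  have "deriv h 0 = grad f w v"
    using h[of 0] assms(1) by (simp add: DERIV_imp_deriv)
  then have "2 * pi * \<i> * grad f w v = contour_integral (circlepath 0 r) (\<lambda>u. h u / (u - 0)\<^sup>2)"
    using Cauchy_contour_integral_circlepath_2[OF cont hol, of 0] assms(1) by simp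
  also have "\<dots> = integral {0..1} (\<lambda>t. 2 * pi * \<i> * (h (r * circ t) / (r * circ t)))"
    unfolding contour_integral_integral
  proof (rule integral_cong)
    fix t
    show "h (circlepath 0 r t) / (circlepath 0 r t - 0)\<^sup>2 * vector_derivative (circlepath 0 r) (at t)
        = 2 * pi * \<i> * (h (r * circ t) / (r * circ t))"
      using assms(1) unfolding vector_derivative_circlepath
      by (simp add: circlepath power2_eq_square field_simps)
  qed
  also have "\<dots> = 2 * pi * \<i> * integral {0..1} (\<lambda>t. h (r * circ t) / (r * circ t))"
    by (rule integral_mult_right)
  finally show ?thesis by (simp add: h_def)
qed

lemma Cauchy_grad_local:
  fixes f :: "complex ^ 'n::finite \<Rightarrow> complex"
  assumes N: "open N" "\<And>w. w \<in> N \<Longrightarrow> cdiff f w" and "w0 \<in> N"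
  obtains e r where "0 < e" "0 < r" "ball w0 e \<subseteq> N"
    "\<And>w t. w \<in> ball w0 e \<Longrightarrow> w + (of_real r * circ t) *s v \<in> N"
    "\<And>w. w \<in> ball w0 e \<Longrightarrow> grad f w v = integral {0..1} (\<lambda>t. f (w + (of_real r * circ t) *s v) / (of_real r * circ t))"
proof -
  obtain e where e: "e > 0" "ball w0 e \<subseteq> N" using N(1) \<open>w0 \<in> N\<close> open_contains_ball by blast
  define r where "r = e / (2 * (norm v + 1))"
  have np: "norm v + 1 > 0" by (smt (verit) norm_ge_zero)
  have r: "r > 0" using e np by (simp add: r_def)
  have rv: "r * norm v < e / 2"
  proof -
    have "r * norm v < r * (norm v + 1)" using r by simp
    also have "\<dots> = e / 2" using np by (simp add: r_def field_simps)
    finally show ?thesis .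
  qed
  have inN: "w + \<zeta> *s v \<in> N" if "w \<in> ball w0 (e/2)" "cmod \<zeta> \<le> r" for w \<zeta>
  proof -
    have "norm (\<zeta> *s v) \<le> r * norm v" unfolding norm_smult using that by (simp add: mult_right_mono)
    then have "dist w0 (w + \<zeta> *s v) < e"
      using that(1) rv norm_triangle_ineq4[of "w0 - w" "\<zeta> *s v"] by (simp add: dist_norm algebra_simps)
    then show ?thesis using e by auto
  qed
  show ?thesis
  proof (rule that[of "e/2" r])
    show "ball w0 (e/2) \<subseteq> N" using e by auto
    show "w + (of_real r * circ t) *s v \<in> N" if "w \<in> ball w0 (e/2)" for w t
      using inN[OF that] r by (simp add: norm_mult)
    show "grad f w v = integral {0..1} (\<lambda>t. f (w + (of_real r * circ t) *s v) / (of_real r * circ t))"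
      if "w \<in> ball w0 (e/2)" for w
      by (rule Cauchy_grad[OF r]) (use inN[OF that] N(2) in auto)
  qed (use e r in auto)
qed

lemma cdiff_continuous_on: "(\<And>w. w \<in> N \<Longrightarrow> cdiff f w) \<Longrightarrow> continuous_on N f"
  using cdiff_continuous continuous_at_imp_continuous_on by blast

lemma continuous_on_smult [continuous_intros]:
  fixes f :: "'a::topological_space \<Rightarrow> complex" and v :: "'a \<Rightarrow> complex ^ 'n::finite"
  assumes "continuous_on S f" "continuous_on S v"
  shows "continuous_on S (\<lambda>x. f x *s v x)"
  unfolding vector_scalar_mult_def by (intro continuous_intros assms)

lemma grad_continuous_on:
  fixes f :: "complex ^ 'n::finite \<Rightarrow> complex"
  assumes N: "open N" "\<And>w. w \<in> N \<Longrightarrow> cdiff f w"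
  shows "continuous_on N (\<lambda>w. grad f w v)"
proof -
  have "isCont (\<lambda>w. grad f w v) w0" if w0: "w0 \<in> N" for w0
  proof -
    obtain e r where e: "0 < e" "0 < r" "ball w0 e \<subseteq> N"
      and inN: "\<And>w t. w \<in> ball w0 e \<Longrightarrow> w + (of_real r * circ t) *s v \<in> N"
      and eq: "\<And>w. w \<in> ball w0 e \<Longrightarrow> grad f w v = integral {0..1} (\<lambda>t. f (w + (of_real r * circ t) *s v) / (of_real r * circ t))"
      using Cauchy_grad_local[OF N w0, where v = v] by blast
    have "continuous_on (ball w0 e) (\<lambda>w. integral (cbox 0 1) (\<lambda>t. f (w + (of_real r * circ t) *s v) / (of_real r * circ t)))"
    proof (rule integral_continuous_on_param)
      have "continuous_on (ball w0 e \<times> cbox 0 1) (\<lambda>x. f (fst x + (of_real r * circ (snd x)) *s v) / (of_real r * circ (snd x)))"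
        by (intro continuous_intros continuous_on_compose2[OF cdiff_continuous_on[OF N(2)]])
           (use e inN in auto)
      then show "continuous_on (ball w0 e \<times> cbox 0 1) (\<lambda>(w, t). f (w + (of_real r * circ t) *s v) / (of_real r * circ t))"
        by (simp add: case_prod_unfold)
    qed
    then have "continuous_on (ball w0 e) (\<lambda>w. grad f w v)"
      by (rule continuous_on_eq) (simp only: eq cbox_interval)
    then show ?thesis using e by (simp add: continuous_on_eq_continuous_at)
  qed
  then show ?thesis using continuous_at_imp_continuous_on by blast
qed

lemma grad_slice_holomorphic:
  fixes f :: "complex ^ 'n::finite \<Rightarrow> complex"
  assumes N: "open N" "\<And>w. w \<in> N \<Longrightarrow> cdiff f w" and w0: "w0 \<in> N"
  obtains e where "e > 0" "(\<lambda>\<zeta>. grad f (w0 + \<zeta> *s u) v) holomorphic_on ball 0 e"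
proof -
  obtain e r where e: "0 < e" "0 < r" "ball w0 e \<subseteq> N"
    and inN: "\<And>w t. w \<in> ball w0 e \<Longrightarrow> w + (of_real r * circ t) *s v \<in> N"
    and eq: "\<And>w. w \<in> ball w0 e \<Longrightarrow> grad f w v = integral {0..1} (\<lambda>t. f (w + (of_real r * circ t) *s v) / (of_real r * circ t))"
    using Cauchy_grad_local[OF N w0, where v = v] by blast
  define s where "s = e / (norm u + 1)"
  have np: "norm u + 1 > 0" by (smt (verit) norm_ge_zero)
  have s: "s > 0" using e np by (simp add: s_def)
  have inb: "w0 + \<zeta> *s u \<in> ball w0 e" if "\<zeta> \<in> ball 0 s" for \<zeta>
  proof -
    have "norm (\<zeta> *s u) \<le> s * norm u" unfolding norm_smult using that by (simp add: mult_right_mono)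
    also have "\<dots> < s * (norm u + 1)" using s by simp
    also have "\<dots> = e" using np by (simp add: s_def)
    finally show ?thesis by (simp add: dist_norm)
  qed
  have "(\<lambda>\<zeta>. integral (cbox 0 1) (\<lambda>t. f (w0 + \<zeta> *s u + (of_real r * circ t) *s v) / (of_real r * circ t))) holomorphic_on ball 0 s"
  proof (rule leibniz_rule_holomorphic[where fx = "\<lambda>\<zeta> t. grad f (w0 + \<zeta> *s u + (of_real r * circ t) *s v) u / (of_real r * circ t)"])
    fix \<zeta> :: complex and t :: real assume z: "\<zeta> \<in> ball 0 s" "t \<in> cbox 0 1"
    have "cdiff f ((w0 + (of_real r * circ t) *s v) + \<zeta> *s u)"
      using N(2)[OF inN[OF inb[OF z(1)], of t]] by (simp add: algebra_simps)
    from DERIV_cdivide[OF cdiff_slice[OF this], of "of_real r * circ t"]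
    show "((\<lambda>\<zeta>. f (w0 + \<zeta> *s u + (of_real r * circ t) *s v) / (of_real r * circ t)) has_field_derivative
        grad f (w0 + \<zeta> *s u + (of_real r * circ t) *s v) u / (of_real r * circ t)) (at \<zeta> within ball 0 s)"
      by (simp add: add_ac has_field_derivative_at_within)
  next
    fix \<zeta> :: complex assume z: "\<zeta> \<in> ball 0 s"
    show "(\<lambda>t. f (w0 + \<zeta> *s u + (of_real r * circ t) *s v) / (of_real r * circ t)) integrable_on cbox 0 1"
      by (intro integrable_continuous continuous_intros continuous_on_compose2[OF cdiff_continuous_on[OF N(2)]])
         (use e inN[OF inb[OF z]] in auto)
  next
    have "continuous_on (ball 0 s \<times> cbox 0 1) (\<lambda>x. grad f (w0 + fst x *s u + (of_real r * circ (snd x)) *s v) u / (of_real r * circ (snd x)))"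
      by (intro continuous_intros continuous_on_compose2[OF grad_continuous_on[OF N]])
         (use e inN inb in auto)
    then show "continuous_on (ball 0 s \<times> cbox 0 1) (\<lambda>(\<zeta>, t). grad f (w0 + \<zeta> *s u + (of_real r * circ t) *s v) u / (of_real r * circ t))"
      by (simp add: case_prod_unfold)
  qed auto
  then have "(\<lambda>\<zeta>. grad f (w0 + \<zeta> *s u) v) holomorphic_on ball 0 s"
    by (rule holomorphic_transform) (simp only: eq inb cbox_interval)
  then show ?thesis by (rule that[OF s])
qed

section \<open>Singular points of a normal crossing curve are nodes\<close>

text \<open>
  Joint continuity, also across \<open>x = 0\<close>, holds because the quotient is the integral of \<open>R1 (t * x) y\<close>
  over \<open>t \<in> {0..1}\<close>.
\<close>

lemma slice_quotient_continuous:
  fixes R R1 :: "complex \<Rightarrow> complex \<Rightarrow> complex"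
  assumes D: "\<And>x y. x \<in> ball 0 \<rho> \<Longrightarrow> y \<in> ball 0 \<rho> \<Longrightarrow> ((\<lambda>x. R x y) has_field_derivative R1 x y) (at x)"
    and c: "continuous_on (ball 0 \<rho> \<times> ball 0 \<rho>) (\<lambda>(x, y). R1 x y)"
    and z: "\<And>y. y \<in> ball 0 \<rho> \<Longrightarrow> R 0 y = 0"
  shows "continuous_on (ball 0 \<rho> \<times> ball 0 \<rho>) (\<lambda>(x, y). if x = 0 then R1 0 y else R x y / x)"
proof -
  have inb: "of_real t * x \<in> ball 0 \<rho>" if "x \<in> ball 0 \<rho>" "t \<in> {0..1}" for x :: complex and t :: real
    using that mult_left_le_one_le[of "cmod x" t] by (auto simp: norm_mult)
  have eq: "(case p of (x, y) \<Rightarrow> if x = 0 then R1 0 y else R x y / x) =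
      integral (cbox 0 1) (\<lambda>t. R1 (of_real t * fst p) (snd p))" if "p \<in> ball 0 \<rho> \<times> ball 0 \<rho>" for p
  proof -
    obtain x y where p: "p = (x, y)" by (cases p)
    have xy: "x \<in> ball 0 \<rho>" "y \<in> ball 0 \<rho>" using that p by auto
    have "((\<lambda>t. R1 (of_real t * x) y * x) has_integral R (of_real 1 * x) y - R (of_real 0 * x) y) {0..1}"
    proof (rule fundamental_theorem_of_calculus)
      fix t :: real assume t: "t \<in> {0..1}"
      have "((\<lambda>s. of_real s * x) has_vector_derivative x) (at t within {0..1})"
        by (auto intro!: derivative_eq_intros)
      from field_vector_diff_chain_within[OF this has_field_derivative_at_within[OF D[OF inb[OF xy(1) t] xy(2)]]]
      show "((\<lambda>t. R (of_real t * x) y) has_vector_derivative R1 (of_real t * x) y * x) (at t within {0..1})"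
        by (simp add: o_def mult.commute)
    qed simp
    from integral_unique[OF this]
    have int: "integral {0..1} (\<lambda>t. R1 (of_real t * x) y * x) = R x y"
      using z[OF xy(2)] by (simp del: integral_mult_left)
    show ?thesis
    proof (cases "x = 0")
      case True then show ?thesis by (simp add: p)
    next
      case False
      have "R x y = integral {0..1} (\<lambda>t. R1 (of_real t * x) y) * x"
        unfolding int[symmetric] by (rule integral_mult_left)
      with False show ?thesis by (simp add: p)
    qed
  qed
  have "continuous_on (ball 0 \<rho> \<times> ball 0 \<rho>) (\<lambda>p. integral (cbox 0 1) (\<lambda>t. R1 (of_real t * fst p) (snd p)))"
  proof (rule integral_continuous_on_param)
    have "continuous_on ((ball 0 \<rho> \<times> ball 0 \<rho>) \<times> cbox 0 1)
        (\<lambda>q. (\<lambda>(x, y). R1 x y) (of_real (snd q) * fst (fst q), snd (fst q)))"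
      by (rule continuous_on_compose2[OF c]) (use inb in \<open>auto intro!: continuous_intros\<close>)
    then show "continuous_on ((ball 0 \<rho> \<times> ball 0 \<rho>) \<times> cbox 0 1) (\<lambda>(p, t). R1 (of_real t * fst p) (snd p))"
      by (simp add: case_prod_unfold)
  qed
  then show ?thesis by (rule continuous_on_eq) (simp only: eq)
qed

lemma minimum_modulus:
  assumes hol: "g holomorphic_on ball 0 \<rho>'" and \<rho>: "0 < \<rho>" "\<rho> < \<rho>'"
    and nz: "\<And>x. x \<in> cball 0 \<rho> \<Longrightarrow> g x \<noteq> 0"
    and m: "\<And>x. cmod x = \<rho> \<Longrightarrow> m \<le> cmod (g x)" and "m > 0" and x: "x \<in> cball 0 \<rho>"
  shows "m \<le> cmod (g x)"
proof -
  have sub: "cball 0 \<rho> \<subseteq> ball (0::complex) \<rho>'" using \<rho> by auto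
  have h: "(\<lambda>x. inverse (g x)) holomorphic_on cball 0 \<rho>"
    by (intro holomorphic_intros holomorphic_on_subset[OF hol sub]) (use nz in auto)
  have "cmod (inverse (g x)) \<le> inverse m"
  proof (rule maximum_modulus_frontier[where S = "cball 0 \<rho>" and f = "\<lambda>x. inverse (g x)"])
    show "(\<lambda>x. inverse (g x)) holomorphic_on interior (cball 0 \<rho>)"
      by (rule holomorphic_on_subset[OF h interior_subset])
    show "continuous_on (closure (cball 0 \<rho>)) (\<lambda>x. inverse (g x))"
      using holomorphic_on_imp_continuous_on[OF h] by simp
    show "cmod (inverse (g z)) \<le> inverse m" if "z \<in> frontier (cball 0 \<rho>)" for z
      using m[of z] that \<open>m > 0\<close> by (auto simp: norm_inverse intro: le_imp_inverse_le)
  qed (use x in auto)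
  then show ?thesis using nz[OF x] \<open>m > 0\<close> by (simp add: norm_inverse)
qed

lemma compact_lower_bound:
  fixes f :: "'a::topological_space \<Rightarrow> complex"
  assumes "compact K" "continuous_on K f" "\<forall>x\<in>K. f x \<noteq> 0"
  shows "\<exists>m>0. \<forall>x\<in>K. m \<le> cmod (f x)"
proof (cases "K = {}")
  case True then show ?thesis by (auto intro: exI[of _ 1])
next
  case False
  have "continuous_on K (\<lambda>x. cmod (f x))" using assms(2) by (rule continuous_on_norm)
  from continuous_attains_inf[OF assms(1) False this]
  obtain x where "x \<in> K" "\<forall>y\<in>K. cmod (f x) \<le> cmod (f y)" by blast
  then show ?thesis using assms(3) by (intro exI[of _ "cmod (f x)"]) simp
qed

text \<open>
  The quotient of \<open>R\<close> by \<open>x\<close> extends continuously and without zeros to the points with \<open>cmod y = r\<close>,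
  where it is bounded below by some \<open>m > 0\<close>. The minimum modulus principle in \<open>y\<close> carries this bound to
  \<open>y = 0\<close>. Hence a vanishing order of one along the line cannot jump at a single point.
\<close>

lemma smooth_branch:
  fixes R R1 R2 :: "complex \<Rightarrow> complex \<Rightarrow> complex"
  assumes \<rho>: "0 < \<rho>"
    and D1: "\<And>x y. x \<in> ball 0 \<rho> \<Longrightarrow> y \<in> ball 0 \<rho> \<Longrightarrow> ((\<lambda>x. R x y) has_field_derivative R1 x y) (at x)"
    and D2: "\<And>x y. x \<in> ball 0 \<rho> \<Longrightarrow> y \<in> ball 0 \<rho> \<Longrightarrow> (R x has_field_derivative R2 x y) (at y)"
    and c1: "continuous_on (ball 0 \<rho> \<times> ball 0 \<rho>) (\<lambda>(x, y). R1 x y)"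
    and z: "\<And>x y. x \<in> ball 0 \<rho> \<Longrightarrow> y \<in> ball 0 \<rho> \<Longrightarrow> R x y = 0 \<longleftrightarrow> x = 0"
    and s: "\<And>y. y \<in> ball 0 \<rho> \<Longrightarrow> y \<noteq> 0 \<Longrightarrow> R1 0 y \<noteq> 0"
  shows "R1 0 0 \<noteq> 0"
proof -
  define r where "r = \<rho> / 2"
  have r: "0 < r" "r < \<rho>" using \<rho> by (auto simp: r_def)
  let ?q = "\<lambda>(x, y). if x = 0 then R1 0 y else R x y / x"
  have q: "continuous_on (ball 0 \<rho> \<times> ball 0 \<rho>) ?q"
    by (rule slice_quotient_continuous[OF D1 c1]) (use z r in auto)
  have "compact (cball (0::complex) r \<times> sphere (0::complex) r)" by (intro compact_Times) auto
  moreover have "continuous_on (cball 0 r \<times> sphere 0 r) ?q"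
    by (rule continuous_on_subset[OF q]) (use r in auto)
  moreover have "\<forall>p\<in>cball 0 r \<times> sphere 0 r. ?q p \<noteq> 0"
    using z s r by (auto simp: case_prod_unfold)
  ultimately have "\<exists>m>0. \<forall>p\<in>cball 0 r \<times> sphere 0 r. m \<le> cmod (?q p)"
    by (rule compact_lower_bound)
  then obtain m where m: "m > 0" "\<And>p. p \<in> cball 0 r \<times> sphere 0 r \<Longrightarrow> m \<le> cmod (?q p)"
    by blast
  have lower: "m \<le> cmod (R x 0 / x)" if x: "x \<in> cball 0 r" "x \<noteq> 0" for x
  proof (rule minimum_modulus[where g = "\<lambda>y. R x y / x" and \<rho>' = \<rho> and \<rho> = r])
    show "(\<lambda>y. R x y / x) holomorphic_on ball 0 \<rho>"
    proof (rule holomorphic_on_divide)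
      show "R x holomorphic_on ball 0 \<rho>"
        unfolding holomorphic_on_def field_differentiable_def
        using D2 x r has_field_derivative_at_within by (metis mem_ball_0 mem_cball_0 le_less_trans)
    qed (use x in auto)
    show "R x y / x \<noteq> 0" if "y \<in> cball 0 r" for y
      using z[of x y] x r that by auto
    show "m \<le> cmod (R x y / x)" if "cmod y = r" for y
      using m(2)[of "(x, y)"] x that by simp
  qed (use r m in auto)
  have "((\<lambda>x. (R x 0 - R 0 0) / (x - 0)) \<longlongrightarrow> R1 0 0) (at 0)"
    using D1[of 0 0] r by (simp add: has_field_derivative_iff)
  then have "((\<lambda>x. cmod (R x 0 / x)) \<longlongrightarrow> cmod (R1 0 0)) (at 0)"
    using z[of 0 0] r by (intro tendsto_norm) simp
  moreover have "\<forall>\<^sub>F x in at 0. m \<le> cmod (R x 0 / x)"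
    unfolding eventually_at using lower r by (intro exI[of _ r]) auto
  ultimately have "m \<le> cmod (R1 0 0)"
    by (intro tendsto_lowerbound) auto
  with m show ?thesis by auto
qed

text \<open>
  The quotient of \<open>R\<close> by \<open>y\<close> is bounded below for \<open>cmod x = r\<close>, as in \<open>smooth_branch\<close>; the minimum modulus
  principle in \<open>x\<close>, applied to the quotient of \<open>R\<close> by \<open>x\<close>, extends the bound to the bidisc.
\<close>

lemma two_branches:
  fixes R R1 R2 :: "complex \<Rightarrow> complex \<Rightarrow> complex"
  assumes \<rho>: "0 < \<rho>"
    and D1: "\<And>x y. x \<in> ball 0 \<rho> \<Longrightarrow> y \<in> ball 0 \<rho> \<Longrightarrow> ((\<lambda>x. R x y) has_field_derivative R1 x y) (at x)"
    and D2: "\<And>x y. x \<in> ball 0 \<rho> \<Longrightarrow> y \<in> ball 0 \<rho> \<Longrightarrow> (R x has_field_derivative R2 x y) (at y)"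
    and c2: "continuous_on (ball 0 \<rho> \<times> ball 0 \<rho>) (\<lambda>(x, y). R2 x y)"
    and z: "\<And>x y. x \<in> ball 0 \<rho> \<Longrightarrow> y \<in> ball 0 \<rho> \<Longrightarrow> R x y = 0 \<longleftrightarrow> x * y = 0"
    and s1: "\<And>y. y \<in> ball 0 \<rho> \<Longrightarrow> y \<noteq> 0 \<Longrightarrow> R1 0 y \<noteq> 0"
    and s2: "\<And>x. x \<in> ball 0 \<rho> \<Longrightarrow> x \<noteq> 0 \<Longrightarrow> R2 x 0 \<noteq> 0"
  obtains c r where "c > 0" "r > 0"
    "\<And>x y. cmod x \<le> r \<Longrightarrow> cmod y \<le> r \<Longrightarrow> c * cmod x * cmod y \<le> cmod (R x y)"
proof -
  define r where "r = \<rho> / 2"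
  have r: "0 < r" "r < \<rho>" using \<rho> by (auto simp: r_def)
  let ?t = "\<lambda>(y, x). if y = 0 then R2 x 0 else R x y / y"
  have c2': "continuous_on (ball 0 \<rho> \<times> ball 0 \<rho>) (\<lambda>(y, x). R2 x y)"
  proof -
    have "continuous_on (ball 0 \<rho> \<times> ball 0 \<rho>) (\<lambda>p. (\<lambda>(x, y). R2 x y) (snd p, fst p))"
      by (rule continuous_on_compose2[OF c2]) (auto intro!: continuous_intros)
    then show ?thesis by (simp add: case_prod_unfold)
  qed
  have q: "continuous_on (ball 0 \<rho> \<times> ball 0 \<rho>) ?t"
    by (rule slice_quotient_continuous[where R = "\<lambda>y x. R x y" and ?R1.0 = "\<lambda>y x. R2 x y", OF D2 c2'])
       (use z r in auto)
  have "compact (cball (0::complex) r \<times> sphere (0::complex) r)" by (intro compact_Times) auto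
  moreover have "continuous_on (cball 0 r \<times> sphere 0 r) ?t"
    by (rule continuous_on_subset[OF q]) (use r in auto)
  moreover have "\<forall>p\<in>cball 0 r \<times> sphere 0 r. ?t p \<noteq> 0"
    using z s2 r by (auto simp: case_prod_unfold)
  ultimately have "\<exists>m>0. \<forall>p\<in>cball 0 r \<times> sphere 0 r. m \<le> cmod (?t p)"
    by (rule compact_lower_bound)
  then obtain m where m: "m > 0" "\<And>p. p \<in> cball 0 r \<times> sphere 0 r \<Longrightarrow> m \<le> cmod (?t p)"
    by blast
  have "m / r * cmod x * cmod y \<le> cmod (R x y)" if x: "cmod x \<le> r" and y: "cmod y \<le> r" for x y
  proof (cases "x = 0 \<or> y = 0")
    case True then show ?thesis by auto
  next
    case False
    have yb: "y \<in> ball 0 \<rho>" using y r by auto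
    define g where "g = (\<lambda>x. if x = 0 then deriv (\<lambda>x. R x y) 0 else (R x y - R 0 y) / (x - 0))"
    have d0: "deriv (\<lambda>x. R x y) 0 = R1 0 y" using D1[of 0 y] yb r by (intro DERIV_imp_deriv) auto
    have R0: "R 0 y = 0" using z[of 0 y] yb r by auto
    have "m * cmod y / r \<le> cmod (g x)"
    proof (rule minimum_modulus[where g = g and \<rho>' = \<rho> and \<rho> = r])
      have "(\<lambda>x. R x y) holomorphic_on ball 0 \<rho>"
        unfolding holomorphic_on_def field_differentiable_def
        using D1 yb has_field_derivative_at_within by metis
      then show "g holomorphic_on ball 0 \<rho>" unfolding g_def by (rule pole_lemma_open) simp
      show "g x \<noteq> 0" if "x \<in> cball 0 r" for x
        using that z[of x y] s1[OF yb] False r yb by (auto simp: g_def d0 R0)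
      show "m * cmod y / r \<le> cmod (g x)" if "cmod x = r" for x
        using m(2)[of "(y, x)"] y that False r by (auto simp: g_def R0 norm_divide field_simps)
    qed (use m r False x in auto)
    with False r show ?thesis by (auto simp: g_def R0 norm_divide field_simps)
  qed
  with m r that show ?thesis by (metis divide_pos_pos)
qed

lemma det3_functional_zero:
  assumes "det3 a b c \<noteq> 0" "grad f z a = 0" "grad f z b = 0" "grad f z c = 0"
  shows "grad f z v = 0"
proof -
  let ?l1 = "pd f 1 z" let ?l2 = "pd f 2 z" let ?l3 = "pd f 3 z"
  have e: "?l1 * a $ 1 + ?l2 * a $ 2 + ?l3 * a $ 3 = 0" "?l1 * b $ 1 + ?l2 * b $ 2 + ?l3 * b $ 3 = 0"
     "?l1 * c $ 1 + ?l2 * c $ 2 + ?l3 * c $ 3 = 0"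
    using assms by (simp_all add: grad_def sum_3)
  have "?l1 * det3 a b c = 0" "?l2 * det3 a b c = 0" "?l3 * det3 a b c = 0"
    unfolding det3_def using e by algebra+
  then have "?l1 = 0" "?l2 = 0" "?l3 = 0" using assms(1) by auto
  then show ?thesis by (simp add: grad_def sum_3)
qed

text \<open>
  The Jacobian matrices of a coordinate system and of its inverse, in affine charts, are inverse to
  each other.
\<close>

lemma coordinate_lift_wronski:
  assumes cs: "coordinate_system U \<phi>" and w: "w \<in> \<phi> ` U" "inv_into U \<phi> w \<in> affine_dom i"
  shows "wronski (\<lambda>w. homog i (affine_chart i (inv_into U \<phi> w))) w \<noteq> 0"
proof -
  let ?\<Psi> = "inv_into U \<phi>"
  have inj: "inj_on \<phi> U" and hf: "holomorphic_from_P2 \<phi> U" and hi: "holomorphic_into_P2 ?\<Psi> (\<phi> ` U)"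
    using cs by (auto simp: coordinate_system_def)
  obtain A where A: "has_jacobian (affine_chart i \<circ> ?\<Psi>) A w"
    using hi w unfolding holomorphic_into_P2_def by blast
  define u where "u = affine_chart i (?\<Psi> w)"
  have pu: "affine_param i u = ?\<Psi> w"
    unfolding u_def affine_param_homog by (rule affine_param_chart[OF w(2)])
  have uU: "affine_param i u \<in> U" unfolding pu using w(1) by (rule inv_into_into)
  obtain B where B: "has_jacobian (\<phi> \<circ> affine_param i) B u"
    using hf uU unfolding holomorphic_from_P2_def by blast
  have \<phi>u: "(\<phi> \<circ> affine_param i) u = w" using w(1) by (simp add: pu f_inv_into_f)
  have comp: "((\<lambda>x. (affine_chart i \<circ> ?\<Psi>) ((\<phi> \<circ> affine_param i) x)) has_derivative (\<lambda>v. A *v (B *v v))) (at u)"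
    using has_derivative_compose[of "\<phi> \<circ> affine_param i" "\<lambda>v. B *v v" u UNIV "affine_chart i \<circ> ?\<Psi>" "\<lambda>v. A *v v"]
      A B \<phi>u unfolding has_jacobian_def by simp
  have openU: "open U" using hf by (simp add: holomorphic_from_P2_def)
  have "continuous_on UNIV (homog i)"
    by (intro continuous_at_imp_continuous_on ballI vcdiff_continuous homog_vcdiff)
       (simp add: vcdiff_def cdiff_coord)
  then have "open (homog i -` {z. z \<noteq> 0 \<and> proj z \<in> U})"
    using open_vimage open_proj_preimage[OF openU] by blast
  then have "\<forall>\<^sub>F x in nhds u. x \<in> homog i -` {z. z \<noteq> 0 \<and> proj z \<in> U}"
    using uU by (intro eventually_nhds_in_open) (auto simp: affine_param_homog)
  then have "\<forall>\<^sub>F x in nhds u. (affine_chart i \<circ> ?\<Psi>) ((\<phi> \<circ> affine_param i) x) = x"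
    by (rule eventually_mono)
       (simp add: affine_param_homog[symmetric] inv_into_f_f[OF inj] affine_chart_param)
  then have "((\<lambda>x. x) has_derivative (\<lambda>v. A *v (B *v v))) (at u)"
    using has_derivative_transform_eventually[OF comp] eventually_nhds_x_imp_x
    by (smt (verit, best) UNIV_I eventually_at_filter eventually_mono)
  then have "(\<lambda>v. A *v (B *v v)) = (\<lambda>v. v)"
    using has_derivative_unique has_derivative_ident by blast
  then have "A ** B = mat 1"
    by (metis matrix_vector_mul_assoc matrix_vector_mul_lid matrix_eq)
  then have "det A * det B = 1" by (metis det_mul det_I)
  then have "det A \<noteq> 0" by auto
  then show ?thesis using wronski_homog[OF A, of i] by (auto simp: o_def)
qed

lemma vector2_add_axis:
  fixes x y :: complex
  shows "vector [x, y] + t *s axis 1 1 = (vector [x + t, y] :: complex ^ 2)"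
    "vector [x, y] + t *s axis 2 1 = (vector [x, y + t] :: complex ^ 2)"
  by (simp_all add: vec_eq_iff forall_2 axis_def)

text \<open>
  Pulled back to normal crossing coordinates along a lift \<open>g\<close> of the inverse coordinate map, the form
  becomes a function \<open>r\<close> of two variables that vanishes on one or both axes. Since the curve has
  finitely many singular points, \<open>r\<close> has a nonzero gradient at all of its zeros near the centre other
  than the centre itself.

  If \<open>r\<close> vanishes on one axis only, \<open>smooth_branch\<close> contradicts the singularity of the centre.
  Otherwise \<open>two_branches\<close> bounds \<open>r\<close> below by a multiple of the product of the coordinates. The
  second-order expansion of \<open>r\<close> along the axes and along the diagonal then gives the Hessian of the
  form on the images \<open>a\<close> and \<open>b\<close> of the coordinate vectors.
\<close>

theorem singular_point_is_node:
  assumes sqf: "squarefree P" and hom: "homogeneous (Suc d) P" and nc: "normal_crossing (zero_locus P)"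
    and z: "z \<noteq> 0" "\<And>v. grad (poly3_eval P) z v = 0"
  obtains a b where "det3 z a b \<noteq> 0" "hess (poly3_eval P) z a a = 0" "hess (poly3_eval P) z b b = 0"
    "hess (poly3_eval P) z a b \<noteq> 0"
proof -
  define p where "p = poly3_eval P"
  have fp: "form (Suc d) p" unfolding p_def by (rule form_poly3_eval[OF hom])
  note pf = formD(1)[OF fp]
  have Euler': "grad p x x = of_nat (Suc d) * p x" for x by (rule Euler[OF fp])
  have pz: "p z = 0" using Euler'[of z] z(2)[of z] by (simp add: p_def del: of_nat_Suc)
  have zl: "proj x \<in> zero_locus P \<longleftrightarrow> p x = 0" if x: "x \<noteq> 0" for x
  proof
    assume "proj x \<in> zero_locus P"
    then obtain y where y: "y \<noteq> 0" "p y = 0" "proj x = proj y" by (auto simp: zero_locus_def p_def)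
    then obtain c where "x = c *s y" using proj_eq_iff[of y x] x by auto
    then show "p x = 0" using formD(2)[OF fp] y by simp
  qed (use x in \<open>auto simp: zero_locus_def p_def\<close>)
  obtain U \<phi> where U: "proj z \<in> U" "coordinate_system U \<phi>" "\<phi> (proj z) = 0"
    and cases: "zero_locus P \<inter> U = {} \<or>
         zero_locus P \<inter> U = {q \<in> U. \<phi> q $ 1 = 0} \<or>
         zero_locus P \<inter> U = {q \<in> U. \<phi> q $ 1 * \<phi> q $ 2 = 0}"
    using nc unfolding normal_crossing_def by blast
  define \<Psi> where "\<Psi> = inv_into U \<phi>"
  have inj: "inj_on \<phi> U" and hi: "holomorphic_into_P2 \<Psi> (\<phi> ` U)"
    using U(2) by (auto simp: coordinate_system_def \<Psi>_def)
  have \<Psi>0: "\<Psi> 0 = proj z" unfolding \<Psi>_def U(3)[symmetric] using inj U(1) by (rule inv_into_f_f)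
  obtain i where i: "proj z \<in> affine_dom i" by (rule ex_affine_dom)
  define g where "g = (\<lambda>w. homog i (affine_chart i (\<Psi> w)))"
  define N where "N = {w \<in> \<phi> ` U. \<Psi> w \<in> affine_dom i}"
  have lift: "lifts g \<Psi> N" unfolding g_def N_def by (rule chart_lift[OF hi])
  have N: "open N" "\<And>w. w \<in> N \<Longrightarrow> vcdiff g w" "\<And>w. w \<in> N \<Longrightarrow> g w \<noteq> 0" "\<And>w. w \<in> N \<Longrightarrow> proj (g w) = \<Psi> w"
    using lift by (auto simp: lifts_def)
  have N0: "0 \<in> N" unfolding N_def using i U \<Psi>0 by (metis (mono_tags, lifting) imageI mem_Collect_eq)
  have wr: "wronski g w \<noteq> 0" if "w \<in> N" for w
    using coordinate_lift_wronski[OF U(2), of w i] that by (simp add: g_def N_def \<Psi>_def)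
  have \<Psi>U: "\<Psi> w \<in> U" "\<phi> (\<Psi> w) = w" if "w \<in> N" for w
    using that unfolding N_def \<Psi>_def by (auto simp: inv_into_into f_inv_into_f)
  define r where "r = (\<lambda>w. p (g w))"
  have rc: "cdiff r w" if "w \<in> N" for w unfolding r_def by (rule cdiff_polyfun[OF pf N(2)[OF that]])
  have rg: "grad r w v = grad p (g w) (vgrad g w v)" if "w \<in> N" for w v
    unfolding r_def gr_polyfun[OF pf N(2)[OF that]] ..
  have rz: "r w = 0 \<longleftrightarrow> \<Psi> w \<in> zero_locus P" if "w \<in> N" for w
    using zl[OF N(3)[OF that]] N(4)[OF that] by (simp add: r_def)
  obtain k where k: "z = k *s g 0" "k \<noteq> 0"
    using proj_eq_iff[OF N(3)[OF N0] z(1)] N(4)[OF N0] \<Psi>0 by auto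
  have gz: "grad p (g 0) v = 0" for v
  proof -
    have "k ^ d * grad p (g 0) v = grad p z v"
      unfolding k(1) grad_def by (simp add: formD(2)[OF form_pd[OF fp]] sum_distrib_left mult_ac)
    with z(2)[of v] k(2) show ?thesis by (simp add: p_def)
  qed
  (* only finitely many points of N lie over singular points of the curve *)
  define Sg where "Sg = {w \<in> N. r w = 0 \<and> (\<forall>v. grad p (g w) v = 0)}"
  have "\<Psi> ` Sg \<subseteq> proj ` {z. z \<noteq> 0 \<and> p z = 0 \<and> (\<forall>v. grad p z v = 0)}"
    unfolding Sg_def r_def using N(3,4) by (force simp: image_iff)
  then have "finite (\<Psi> ` Sg)"
    using finite_singular_set[OF sqf hom] finite_subset unfolding p_def by blast
  moreover have "inj_on \<Psi> Sg"
    by (rule inj_onI) (metis (no_types, lifting) Sg_def \<Psi>U(2) mem_Collect_eq)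
  ultimately have fin: "finite Sg" using finite_imageD by blast
  have smooth: "grad r w (axis 1 1) \<noteq> 0 \<or> grad r w (axis 2 1) \<noteq> 0" if "w \<in> N" "r w = 0" "w \<notin> Sg" for w
  proof (rule ccontr)
    assume *: "\<not> ?thesis"
    have "grad p (g w) (g w) = 0" using Euler'[of "g w"] that(2) by (simp add: r_def)
    then have "grad p (g w) v = 0" for v
      using det3_functional_zero[OF wr[OF that(1), unfolded wronski_def]] * rg[OF that(1)] by auto
    with that show False by (simp add: Sg_def)
  qed
  (* a polydisc without singular points other than the centre *)
  have "open (N - (Sg - {0}))" using N(1) fin by (intro open_Diff finite_imp_closed) auto
  then obtain e where e: "e > 0" "ball 0 e \<subseteq> N - (Sg - {0})"
    using N0 open_contains_ball by blast
  define \<rho> where "\<rho> = e / 2"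
  have \<rho>: "\<rho> > 0" using e by (simp add: \<rho>_def)
  have pt: "vector [x, y] \<in> N" "vector [x, y] \<in> Sg \<Longrightarrow> x = 0 \<and> y = 0"
    if "x \<in> ball 0 \<rho>" "y \<in> ball 0 \<rho>" for x y
  proof -
    have "vector [x, y] = x *s axis 1 1 + y *s (axis 2 1 :: complex ^ 2)"
      by (simp add: vec_eq_iff forall_2 axis_def)
    then have "norm (vector [x, y] :: complex ^ 2) \<le> cmod x + cmod y"
      using norm_triangle_ineq[of "x *s axis 1 1" "y *s (axis 2 1 :: complex ^ 2)"] by (simp add: norm_smult)
    then have "norm (vector [x, y] :: complex ^ 2) < e" using that by (simp add: \<rho>_def)
    then have *: "vector [x, y] \<in> N - (Sg - {0})" using e by auto
    then show "vector [x, y] \<in> N" by blast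
    assume "vector [x, y] \<in> Sg"
    with * have "vector [x, y] = (0 :: complex ^ 2)" by blast
    then show "x = 0 \<and> y = 0" by (simp add: vec_eq_iff forall_2)
  qed
  define R where "R = (\<lambda>x y. r (vector [x, y]))"
  define R1 where "R1 = (\<lambda>x y. grad r (vector [x, y]) (axis 1 1))"
  define R2 where "R2 = (\<lambda>x y. grad r (vector [x, y]) (axis 2 1))"
  have D1: "((\<lambda>x. R x y) has_field_derivative R1 x y) (at x)" if "x \<in> ball 0 \<rho>" "y \<in> ball 0 \<rho>" for x y
  proof -
    have "cdiff r (vector [0, y] + x *s axis 1 1)" using rc[OF pt(1)[OF that]] by (simp add: vector2_add_axis)
    from cdiff_slice[OF this] show ?thesis by (simp add: vector2_add_axis R_def R1_def)
  qed
  have D2: "(R x has_field_derivative R2 x y) (at y)" if "x \<in> ball 0 \<rho>" "y \<in> ball 0 \<rho>" for x y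
  proof -
    have "cdiff r (vector [x, 0] + y *s axis 2 1)" using rc[OF pt(1)[OF that]] by (simp add: vector2_add_axis)
    from cdiff_slice[OF this] show ?thesis by (simp add: vector2_add_axis R_def[abs_def] R2_def)
  qed
  have cvec: "continuous_on S (\<lambda>p. vector [fst p, snd p] :: complex ^ 2)" for S :: "(complex \<times> complex) set"
  proof -
    have "(\<lambda>p. vector [fst p, snd p] :: complex ^ 2) = (\<lambda>p. fst p *s axis 1 1 + snd p *s axis 2 1)"
      by (simp add: vec_eq_iff forall_2 axis_def fun_eq_iff)
    then show ?thesis by (simp only:) (intro continuous_intros)
  qed
  have cg: "continuous_on (ball 0 \<rho> \<times> ball 0 \<rho>) (\<lambda>p. grad r (vector [fst p, snd p]) v)" for v
    by (rule continuous_on_compose2[OF grad_continuous_on[OF N(1) rc]]) (use cvec pt(1) in auto)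
  have c1: "continuous_on (ball 0 \<rho> \<times> ball 0 \<rho>) (\<lambda>(x, y). R1 x y)"
    and c2: "continuous_on (ball 0 \<rho> \<times> ball 0 \<rho>) (\<lambda>(x, y). R2 x y)"
    using cg by (simp_all add: R1_def R2_def case_prod_unfold)
  have smooth': "R1 x y \<noteq> 0 \<or> R2 x y \<noteq> 0" if "x \<in> ball 0 \<rho>" "y \<in> ball 0 \<rho>" "R x y = 0" "x \<noteq> 0 \<or> y \<noteq> 0" for x y
    using smooth[of "vector [x, y]"] pt[OF that(1,2)] that(3,4) unfolding R_def R1_def R2_def by blast
  have const_deriv: "c = 0" if "(f has_field_derivative c) (at x)" "x \<in> ball 0 \<rho>" "\<And>x. x \<in> ball 0 \<rho> \<Longrightarrow> f x = 0"
    for f and c x :: complex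
  proof -
    have "((\<lambda>x. 0) has_field_derivative c) (at x)"
      by (rule has_field_derivative_transform_within_open[OF that(1), of "ball 0 \<rho>"]) (use that in auto)
    then show ?thesis using DERIV_unique DERIV_const by blast
  qed
  have v00: "vector [0, 0] = (0 :: complex ^ 2)" by (simp add: vec_eq_iff forall_2)
  have inD: "r w = 0 \<longleftrightarrow> \<Psi> w \<in> zero_locus P \<inter> U" if "w \<in> N" for w
    using rz[OF that] \<Psi>U[OF that] by blast
  have Dz: "proj z \<in> zero_locus P \<inter> U" using zl[OF z(1)] pz U(1) by blast
  from cases consider "zero_locus P \<inter> U = {q \<in> U. \<phi> q $ 1 = 0}"
    | "zero_locus P \<inter> U = {q \<in> U. \<phi> q $ 1 * \<phi> q $ 2 = 0}" using Dz by blast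
  then show ?thesis
  proof cases
    case 1
    have Rz: "R x y = 0 \<longleftrightarrow> x = 0" if "x \<in> ball 0 \<rho>" "y \<in> ball 0 \<rho>" for x y
      unfolding R_def inD[OF pt(1)[OF that]] 1 using \<Psi>U[OF pt(1)[OF that]] by simp
    have "R1 0 0 \<noteq> 0"
    proof (rule smooth_branch[OF \<rho> D1 D2 c1 Rz])
      fix y :: complex assume y: "y \<in> ball 0 \<rho>" "y \<noteq> 0"
      have "R2 0 y = 0" by (rule const_deriv[OF D2]) (use y \<rho> Rz in auto)
      then show "R1 0 y \<noteq> 0" using smooth'[of 0 y] y \<rho> Rz by auto
    qed auto
    moreover have "R1 0 0 = 0" unfolding R1_def v00 rg[OF N0] by (rule gz)
    ultimately show ?thesis by simp
  next
    case 2
    have Rz: "R x y = 0 \<longleftrightarrow> x * y = 0" if "x \<in> ball 0 \<rho>" "y \<in> ball 0 \<rho>" for x y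
      unfolding R_def inD[OF pt(1)[OF that]] 2 using \<Psi>U[OF pt(1)[OF that]] by simp
    obtain c s where c: "c > 0" "s > 0"
      "\<And>x y. cmod x \<le> s \<Longrightarrow> cmod y \<le> s \<Longrightarrow> c * cmod x * cmod y \<le> cmod (R x y)"
    proof (rule two_branches[OF \<rho> D1 D2 c2 Rz])
      fix y :: complex assume y: "y \<in> ball 0 \<rho>" "y \<noteq> 0"
      have "R2 0 y = 0" by (rule const_deriv[OF D2]) (use y \<rho> Rz in auto)
      then show "R1 0 y \<noteq> 0" using smooth'[of 0 y] y \<rho> Rz by auto
    next
      fix x :: complex assume x: "x \<in> ball 0 \<rho>" "x \<noteq> 0"
      have "R1 x 0 = 0" by (rule const_deriv[OF D1]) (use x \<rho> Rz in auto)
      then show "R2 x 0 \<noteq> 0" using smooth'[of x 0] x \<rho> Rz by auto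
    qed auto
    have lim: "((\<lambda>\<zeta>. r (\<zeta> *s v) / \<zeta>\<^sup>2) \<longlongrightarrow> hess p (g 0) (vgrad g 0 v) (vgrad g 0 v) / 2) (at 0)" for v
    proof -
      define S where "S = (\<lambda>\<zeta>. \<zeta> *s v) -` N"
      have S: "open S" unfolding S_def by (rule open_vimage[OF N(1)]) (intro continuous_intros)
      have S0: "0 \<in> S" using N0 by (simp add: S_def)
      have "\<exists>c. jet (\<lambda>\<zeta>. g (\<zeta> *s v) $ k) (g 0 $ k) (vgrad g 0 v $ k) c" for k
      proof -
        have d: "((\<lambda>\<zeta>. g (\<zeta> *s v) $ k) has_field_derivative vgrad g (\<zeta> *s v) v $ k) (at \<zeta>)" if "\<zeta> \<in> S" for \<zeta>
        proof -
          have "cdiff (\<lambda>w. g w $ k) (0 + \<zeta> *s v)" using N(2) that by (simp add: S_def vcdiff_def)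
          from cdiff_slice[OF this] show ?thesis by (simp add: vgrad_def)
        qed
        have "(\<lambda>\<zeta>. g (\<zeta> *s v) $ k) holomorphic_on S"
          unfolding holomorphic_on_def field_differentiable_def
          using d has_field_derivative_at_within by blast
        from jet_holomorphic[OF this S S0, of "vgrad g 0 v $ k"] d[OF S0] show ?thesis by auto
      qed
      then obtain c' where c': "\<And>k. jet (\<lambda>\<zeta>. g (\<zeta> *s v) $ k) (g 0 $ k) (vgrad g 0 v $ k) (c' k)" by metis
      define c where "c = (\<chi> k. c' k)"
      have "jet (\<lambda>\<zeta>. p (g (\<zeta> *s v))) (p (g 0)) (grad p (g 0) (vgrad g 0 v))
          (grad p (g 0) c + hess p (g 0) (vgrad g 0 v) (vgrad g 0 v) / 2)"
        by (rule jet_polyfun[OF pf]) (simp add: c' c_def)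
      moreover have "p (g 0) = 0" using Rz[of 0 0] \<rho> by (simp add: R_def r_def v00)
      ultimately show ?thesis by (simp add: jet_def gz r_def)
    qed
    define a b where "a = vgrad g 0 (axis 1 1)" and "b = vgrad g 0 (axis 2 1)"
    have e1: "\<zeta> *s axis 1 1 = (vector [\<zeta>, 0] :: complex ^ 2)" and e2: "\<zeta> *s axis 2 1 = (vector [0, \<zeta>] :: complex ^ 2)"
      and e12: "\<zeta> *s axis 1 1 + \<zeta> *s axis 2 1 = (vector [\<zeta>, \<zeta>] :: complex ^ 2)" for \<zeta> :: complex
      by (simp_all add: vec_eq_iff forall_2 axis_def)
    have zero: "l = 0" if "(f \<longlongrightarrow> l) (at 0)" "\<And>\<zeta>. \<zeta> \<in> ball 0 \<rho> \<Longrightarrow> f \<zeta> = 0" for f :: "complex \<Rightarrow> complex" and l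
    proof -
      have "\<forall>\<^sub>F \<zeta> in at 0. f \<zeta> = 0"
        unfolding eventually_at using that \<rho> by (intro exI[of _ \<rho>]) (auto simp: dist_commute)
      then have "(f \<longlongrightarrow> 0) (at 0)" by (rule tendsto_eventually)
      then show ?thesis using LIM_unique[OF that(1)] by blast
    qed
    have "hess p (g 0) a a / 2 = 0" unfolding a_def
      by (rule zero[OF lim]) (use Rz \<rho> in \<open>simp add: e1 R_def\<close>)
    then have haa: "hess p (g 0) a a = 0" by simp
    have "hess p (g 0) b b / 2 = 0" unfolding b_def
      by (rule zero[OF lim]) (use Rz \<rho> in \<open>simp add: e2 R_def\<close>)
    then have hbb: "hess p (g 0) b b = 0" by simp
    have hab: "hess p (g 0) a b \<noteq> 0"
    proof
      assume 0: "hess p (g 0) a b = 0"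
      then have "hess p (g 0) b a = 0" using hess_commute[OF pf] by metis
      with 0 haa hbb have "hess p (g 0) (a + b) (a + b) = 0" by (simp add: hess_add_left hess_add_right)
      then have "((\<lambda>\<zeta>. cmod (R \<zeta> \<zeta> / \<zeta>\<^sup>2)) \<longlongrightarrow> 0) (at 0)"
        using tendsto_norm[OF lim[of "axis 1 1 + axis 2 1"]] by (simp add: e12 R_def vgrad_add a_def b_def)
      moreover have "\<forall>\<^sub>F \<zeta> in at 0. c \<le> cmod (R \<zeta> \<zeta> / \<zeta>\<^sup>2)"
        unfolding eventually_at
      proof (intro exI[of _ s] conjI ballI impI)
        fix \<zeta> :: complex assume z: "\<zeta> \<noteq> 0 \<and> dist \<zeta> 0 < s"
        then have "c * cmod \<zeta> * cmod \<zeta> \<le> cmod (R \<zeta> \<zeta>)" by (intro c(3)) auto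
        then show "c \<le> cmod (R \<zeta> \<zeta> / \<zeta>\<^sup>2)" using z by (simp add: norm_divide norm_mult power2_eq_square field_simps)
      qed (use c in auto)
      ultimately have "c \<le> 0" by (intro tendsto_lowerbound) auto
      with c show False by simp
    qed
    (* z and g 0 are multiples of each other *)
    have pp: "hess p z u v = 0 \<longleftrightarrow> hess p (g 0) u v = 0" for u v
    proof (cases d)
      case 0
      then have "form 0 (pd p k)" for k using form_pd[of 0 p k] fp by simp
      then have "pd p k = (\<lambda>z. pd p k 0)" for k using form_0_const by blast
      then have "pd (pd p k) l = (\<lambda>z. 0)" for k l using pd_const by metis
      then show ?thesis by (simp add: hess_def)
    next
      case (Suc d')
      then have "form d' (pd (pd p m) l)" for m l using form_pd fp by blast
      note sc = formD(2)[OF this]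
      have "hess p z u v = k ^ d' * hess p (g 0) u v"
        unfolding k(1) hess_def by (simp add: sc sum_distrib_left mult_ac)
      with k(2) show ?thesis by simp
    qed
    have "det3 z a b = k * wronski g 0"
      unfolding k(1) wronski_def a_def b_def det3_def by (simp add: algebra_simps)
    then have "det3 z a b \<noteq> 0" using k(2) wr[OF N0] by simp
    then show ?thesis using that[of a b] haa hbb hab pp unfolding p_def by blast
  qed
qed

section \<open>Levi forms of functions of one complex variable\<close>

text \<open>
  The expansion \<open>\<psi> \<zeta> = a + 2 * Re (\<alpha> * \<zeta>) + Re (\<beta> * \<zeta>\<^sup>2) + c * (cmod \<zeta>)\<^sup>2 + o((cmod \<zeta>)\<^sup>2)\<close>. For a
  twice differentiable \<open>\<psi>\<close>, \<open>c\<close> is a quarter of the Laplacian at \<open>0\<close>. Stated as an expansion at one point,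
  it has rules for sums, logarithms, exponentials and maxima that need no second derivatives.
\<close>

definition levi :: "(complex \<Rightarrow> real) \<Rightarrow> real \<Rightarrow> complex \<Rightarrow> real \<Rightarrow> bool" where
  "levi \<psi> a \<alpha> c \<longleftrightarrow> \<psi> 0 = a \<and>
     (\<exists>\<beta>. ((\<lambda>\<zeta>. (\<psi> \<zeta> - a - 2 * Re (\<alpha> * \<zeta>) - Re (\<beta> * \<zeta>\<^sup>2)) / (cmod \<zeta>)\<^sup>2) \<longlongrightarrow> c) (at 0))"

lemma levi_0: "levi \<psi> a \<alpha> c \<Longrightarrow> \<psi> 0 = a"
  by (simp add: levi_def)

lemma eventually_at_punctured: "(\<And>x. x \<noteq> a \<Longrightarrow> P x) \<Longrightarrow> eventually P (at a)"
  by (simp add: eventually_at_filter)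

lemma leviI:
  assumes "((\<lambda>\<zeta>. (\<psi> \<zeta> - a - 2 * Re (\<alpha> * \<zeta>) - Re (\<beta> * \<zeta>\<^sup>2)) / (cmod \<zeta>)\<^sup>2) \<longlongrightarrow> c) (at 0)" "\<psi> 0 = a"
  shows "levi \<psi> a \<alpha> c"
  using assms unfolding levi_def by blast

lemma levi_add:
  assumes "levi \<psi> a \<alpha> c" "levi \<psi>' a' \<alpha>' c'"
  shows "levi (\<lambda>\<zeta>. \<psi> \<zeta> + \<psi>' \<zeta>) (a + a') (\<alpha> + \<alpha>') (c + c')"
proof -
  obtain \<beta> \<beta>' where
    l: "((\<lambda>\<zeta>. (\<psi> \<zeta> - a - 2 * Re (\<alpha> * \<zeta>) - Re (\<beta> * \<zeta>\<^sup>2)) / (cmod \<zeta>)\<^sup>2) \<longlongrightarrow> c) (at 0)"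
       "((\<lambda>\<zeta>. (\<psi>' \<zeta> - a' - 2 * Re (\<alpha>' * \<zeta>) - Re (\<beta>' * \<zeta>\<^sup>2)) / (cmod \<zeta>)\<^sup>2) \<longlongrightarrow> c') (at 0)"
    using assms unfolding levi_def by blast
  have "((\<lambda>\<zeta>. (\<psi> \<zeta> + \<psi>' \<zeta> - (a + a') - 2 * Re ((\<alpha> + \<alpha>') * \<zeta>) - Re ((\<beta> + \<beta>') * \<zeta>\<^sup>2)) / (cmod \<zeta>)\<^sup>2) \<longlongrightarrow> c + c') (at 0)"
    using tendsto_add[OF l] by (simp add: add_divide_distrib[symmetric] algebra_simps)
  then show ?thesis by (rule leviI) (use assms in \<open>simp add: levi_def\<close>)
qed

lemma levi_cmult:
  assumes "levi \<psi> a \<alpha> c"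
  shows "levi (\<lambda>\<zeta>. k * \<psi> \<zeta>) (k * a) (of_real k * \<alpha>) (k * c)"
proof -
  obtain \<beta> where
    l: "((\<lambda>\<zeta>. (\<psi> \<zeta> - a - 2 * Re (\<alpha> * \<zeta>) - Re (\<beta> * \<zeta>\<^sup>2)) / (cmod \<zeta>)\<^sup>2) \<longlongrightarrow> c) (at 0)"
    using assms unfolding levi_def by blast
  have "((\<lambda>\<zeta>. (k * \<psi> \<zeta> - k * a - 2 * Re (of_real k * \<alpha> * \<zeta>) - Re ((of_real k * \<beta>) * \<zeta>\<^sup>2)) / (cmod \<zeta>)\<^sup>2) \<longlongrightarrow> k * c) (at 0)"
    using tendsto_mult_left[OF l, of k] by (simp add: algebra_simps diff_divide_distrib)
  then show ?thesis by (rule leviI) (use assms in \<open>simp add: levi_def\<close>)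
qed

lemma levi_const: "levi (\<lambda>\<zeta>. a) a 0 0"
  by (rule leviI[where \<beta> = 0]) auto

lemma levi_sum:
  assumes "finite I" "\<And>i. i \<in> I \<Longrightarrow> levi (\<psi> i) (a i) (\<alpha> i) (c i)"
  shows "levi (\<lambda>\<zeta>. \<Sum>i\<in>I. \<psi> i \<zeta>) (\<Sum>i\<in>I. a i) (\<Sum>i\<in>I. \<alpha> i) (\<Sum>i\<in>I. c i)"
  using assms by (induction I rule: finite_induct) (auto intro: levi_add levi_const)

lemma levi_norm_square:
  assumes "jet f a b c"
  shows "levi (\<lambda>\<zeta>. (cmod (f \<zeta>))\<^sup>2) ((cmod a)\<^sup>2) (cnj a * b) ((cmod b)\<^sup>2)"
proof -
  define q where "q = (\<lambda>\<zeta>. (f \<zeta> - a - b * \<zeta>) / \<zeta>\<^sup>2)"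
  have q: "(q \<longlongrightarrow> c) (at 0)" using assms by (simp add: jet_def q_def)
  define X where "X = (\<lambda>\<zeta>. 2 * (cnj (a + b * \<zeta>) * q \<zeta> - cnj a * c))"
  have "(X \<longlongrightarrow> 2 * (cnj (a + b * 0) * c - cnj a * c)) (at 0)"
    unfolding X_def by (intro tendsto_intros q)
  then have X: "(X \<longlongrightarrow> 0) (at 0)" by simp
  have eq: "((cmod (f \<zeta>))\<^sup>2 - (cmod a)\<^sup>2 - 2 * Re (cnj a * b * \<zeta>) - Re (2 * cnj a * c * \<zeta>\<^sup>2)) / (cmod \<zeta>)\<^sup>2
     = (cmod b)\<^sup>2 + Re (X \<zeta> * \<zeta>\<^sup>2) / (cmod \<zeta>)\<^sup>2 + (cmod \<zeta>)\<^sup>2 * (cmod (q \<zeta>))\<^sup>2" if "\<zeta> \<noteq> 0" for \<zeta>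
  proof -
    have f: "f \<zeta> = a + b * \<zeta> + \<zeta>\<^sup>2 * q \<zeta>" using that by (simp add: q_def)
    have expand: "(cmod (x + y))\<^sup>2 = (cmod x)\<^sup>2 + 2 * Re (cnj x * y) + (cmod y)\<^sup>2" for x y
      unfolding cmod_power2 by (simp add: power2_eq_square algebra_simps)
    have "(cmod (f \<zeta>))\<^sup>2 = (cmod a)\<^sup>2 + 2 * Re (cnj a * (b * \<zeta>)) + (cmod (b * \<zeta>))\<^sup>2
        + 2 * Re (cnj (a + b * \<zeta>) * (\<zeta>\<^sup>2 * q \<zeta>)) + (cmod (\<zeta>\<^sup>2 * q \<zeta>))\<^sup>2"
      unfolding f expand ..
    also have "2 * Re (cnj (a + b * \<zeta>) * (\<zeta>\<^sup>2 * q \<zeta>)) = Re (X \<zeta> * \<zeta>\<^sup>2) + Re (2 * cnj a * c * \<zeta>\<^sup>2)"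
    proof -
      have "2 * Re z = Re (2 * z)" for z by simp
      then have "2 * Re (cnj (a + b * \<zeta>) * (\<zeta>\<^sup>2 * q \<zeta>)) = Re (2 * (cnj (a + b * \<zeta>) * (\<zeta>\<^sup>2 * q \<zeta>)))" .
      also have "2 * (cnj (a + b * \<zeta>) * (\<zeta>\<^sup>2 * q \<zeta>)) = X \<zeta> * \<zeta>\<^sup>2 + 2 * cnj a * c * \<zeta>\<^sup>2"
        by (simp add: X_def algebra_simps)
      finally show ?thesis by simp
    qed
    also have "(cmod (\<zeta>\<^sup>2 * q \<zeta>))\<^sup>2 = (cmod \<zeta>)\<^sup>2 * ((cmod \<zeta>)\<^sup>2 * (cmod (q \<zeta>))\<^sup>2)"
      by (simp add: norm_mult norm_power power2_eq_square)
    also have "(cmod (b * \<zeta>))\<^sup>2 = (cmod b)\<^sup>2 * (cmod \<zeta>)\<^sup>2" by (simp add: norm_mult power_mult_distrib)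
    finally have fin: "(cmod (f \<zeta>))\<^sup>2 - (cmod a)\<^sup>2 - 2 * Re (cnj a * b * \<zeta>) - Re (2 * cnj a * c * \<zeta>\<^sup>2)
      = (cmod b)\<^sup>2 * (cmod \<zeta>)\<^sup>2 + Re (X \<zeta> * \<zeta>\<^sup>2) + (cmod \<zeta>)\<^sup>2 * ((cmod \<zeta>)\<^sup>2 * (cmod (q \<zeta>))\<^sup>2)"
      by (simp add: mult.assoc)
    have gen: "(B * n + M + n * T) / n = B + M / n + T" if "n \<noteq> 0" for B n M T :: real
      using that by (simp add: add_divide_distrib)
    show ?thesis unfolding fin by (rule gen) (use that in simp)
  qed
  have "((\<lambda>\<zeta>. Re (X \<zeta> * \<zeta>\<^sup>2) / (cmod \<zeta>)\<^sup>2) \<longlongrightarrow> 0) (at 0)"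
  proof (rule tendsto_0_le[OF X, where K = 1], rule always_eventually, rule allI)
    fix \<zeta>
    have "\<bar>Re (X \<zeta> * \<zeta>\<^sup>2)\<bar> \<le> cmod (X \<zeta>) * (cmod \<zeta>)\<^sup>2"
      using abs_Re_le_cmod[of "X \<zeta> * \<zeta>\<^sup>2"] by (simp add: norm_mult norm_power)
    then show "norm (Re (X \<zeta> * \<zeta>\<^sup>2) / (cmod \<zeta>)\<^sup>2) \<le> norm (X \<zeta>) * 1"
      by (cases "\<zeta> = 0") (simp_all add: divide_le_eq)
  qed
  moreover have "((\<lambda>\<zeta>. (cmod \<zeta>)\<^sup>2 * (cmod (q \<zeta>))\<^sup>2) \<longlongrightarrow> (cmod 0)\<^sup>2 * (cmod c)\<^sup>2) (at 0)"
    by (intro tendsto_intros q)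
  ultimately have "((\<lambda>\<zeta>. (cmod b)\<^sup>2 + Re (X \<zeta> * \<zeta>\<^sup>2) / (cmod \<zeta>)\<^sup>2 + (cmod \<zeta>)\<^sup>2 * (cmod (q \<zeta>))\<^sup>2)
      \<longlongrightarrow> (cmod b)\<^sup>2 + 0 + (cmod 0)\<^sup>2 * (cmod c)\<^sup>2) (at 0)"
    by (intro tendsto_add tendsto_const)
  then have "((\<lambda>\<zeta>. ((cmod (f \<zeta>))\<^sup>2 - (cmod a)\<^sup>2 - 2 * Re (cnj a * b * \<zeta>) - Re (2 * cnj a * c * \<zeta>\<^sup>2)) / (cmod \<zeta>)\<^sup>2)
      \<longlongrightarrow> (cmod b)\<^sup>2 + 0 + (cmod 0)\<^sup>2 * (cmod c)\<^sup>2) (at 0)"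
    by (rule Lim_transform_eventually) (rule eventually_at_punctured, rule eq[symmetric])
  then have "((\<lambda>\<zeta>. ((cmod (f \<zeta>))\<^sup>2 - (cmod a)\<^sup>2 - 2 * Re (cnj a * b * \<zeta>) - Re (2 * cnj a * c * \<zeta>\<^sup>2)) / (cmod \<zeta>)\<^sup>2)
      \<longlongrightarrow> (cmod b)\<^sup>2) (at 0)" by simp
  then show ?thesis by (rule leviI) (use assms in \<open>simp add: jet_def\<close>)
qed

text \<open>
  The identity \<open>(2 * Re w)\<^sup>2 = 2 * (cmod w)\<^sup>2 + 2 * Re (w\<^sup>2)\<close> splits the square of the first-order
  part of \<open>\<psi>\<close> into the new contribution \<open>\<phi>2 * (cmod \<alpha>)\<^sup>2\<close> and a harmonic term.
\<close>

lemma levi_compose: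
  assumes lv: "levi \<psi> a \<alpha> c"
    and T: "((\<lambda>x. (\<phi> (a + x) - \<phi> a - \<phi>1 * x) / x\<^sup>2) \<longlongrightarrow> \<phi>2 / 2) (at 0)"
  shows "levi (\<lambda>\<zeta>. \<phi> (\<psi> \<zeta>)) (\<phi> a) (of_real \<phi>1 * \<alpha>) (\<phi>1 * c + \<phi>2 * (cmod \<alpha>)\<^sup>2)"
proof -
  obtain \<beta> where
    l: "((\<lambda>\<zeta>. (\<psi> \<zeta> - a - 2 * Re (\<alpha> * \<zeta>) - Re (\<beta> * \<zeta>\<^sup>2)) / (cmod \<zeta>)\<^sup>2) \<longlongrightarrow> c) (at 0)"
    using lv unfolding levi_def by blast
  define Q where "Q = (\<lambda>\<zeta>. (\<psi> \<zeta> - a - 2 * Re (\<alpha> * \<zeta>) - Re (\<beta> * \<zeta>\<^sup>2)) / (cmod \<zeta>)\<^sup>2)"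
  define t where "t = (\<lambda>x. if x = 0 then \<phi>2 / 2 else (\<phi> (a + x) - \<phi> a - \<phi>1 * x) / x\<^sup>2)"
  define x where "x = (\<lambda>\<zeta>. \<psi> \<zeta> - a)"
  define y y0 where "y = (\<lambda>\<zeta>. x \<zeta> / cmod \<zeta>)" and "y0 = (\<lambda>\<zeta>. 2 * Re (\<alpha> * \<zeta>) / cmod \<zeta>)"
  have xeq: "x \<zeta> = 2 * Re (\<alpha> * \<zeta>) + Re (\<beta> * \<zeta>\<^sup>2) + Q \<zeta> * (cmod \<zeta>)\<^sup>2" if "\<zeta> \<noteq> 0" for \<zeta>
    using that by (simp add: x_def Q_def)
  have "((\<lambda>\<zeta>. 2 * Re (\<alpha> * \<zeta>) + Re (\<beta> * \<zeta>\<^sup>2) + Q \<zeta> * (cmod \<zeta>)\<^sup>2) \<longlongrightarrow> 2 * Re (\<alpha> * 0) + Re (\<beta> * 0\<^sup>2) + c * (cmod 0)\<^sup>2) (at 0)"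
    by (intro tendsto_intros) (use l in \<open>simp add: Q_def\<close>)
  then have "(x \<longlongrightarrow> 2 * Re (\<alpha> * 0) + Re (\<beta> * 0\<^sup>2) + c * (cmod 0)\<^sup>2) (at 0)"
    by (rule Lim_transform_eventually) (rule eventually_at_punctured, rule xeq[symmetric])
  then have x0: "(x \<longlongrightarrow> 0) (at 0)" by simp
  have "(t \<longlongrightarrow> \<phi>2 / 2) (at 0)"
    using T by (rule Lim_transform_eventually) (auto simp: eventually_at_filter t_def)
  then have "isCont t 0" by (simp add: isCont_def t_def)
  then have tx: "((\<lambda>\<zeta>. t (x \<zeta>)) \<longlongrightarrow> \<phi>2 / 2) (at 0)"
    using isCont_tendsto_compose[OF _ x0, of t] by (simp add: t_def)
  have "((\<lambda>\<zeta>. cmod \<beta> * cmod \<zeta> + \<bar>Q \<zeta>\<bar> * cmod \<zeta>) \<longlongrightarrow> cmod \<beta> * cmod 0 + \<bar>c\<bar> * cmod 0) (at 0)"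
    by (intro tendsto_intros) (use l in \<open>simp add: Q_def\<close>)
  then have bnd: "((\<lambda>\<zeta>. cmod \<beta> * cmod \<zeta> + \<bar>Q \<zeta>\<bar> * cmod \<zeta>) \<longlongrightarrow> 0) (at 0)" by simp
  have yy: "((\<lambda>\<zeta>. y \<zeta> - y0 \<zeta>) \<longlongrightarrow> 0) (at 0)"
  proof (rule tendsto_0_le[OF bnd, where K = 1])
    have "\<bar>y \<zeta> - y0 \<zeta>\<bar> \<le> cmod \<beta> * cmod \<zeta> + \<bar>Q \<zeta>\<bar> * cmod \<zeta>" if z: "\<zeta> \<noteq> 0" for \<zeta>
    proof -
      have "y \<zeta> - y0 \<zeta> = Re (\<beta> * \<zeta>\<^sup>2) / cmod \<zeta> + Q \<zeta> * cmod \<zeta>"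
        using z by (simp add: y_def y0_def xeq add_divide_distrib power2_eq_square)
      moreover have "\<bar>Re (\<beta> * \<zeta>\<^sup>2)\<bar> \<le> cmod \<beta> * (cmod \<zeta>)\<^sup>2"
        using abs_Re_le_cmod[of "\<beta> * \<zeta>\<^sup>2"] by (simp add: norm_mult norm_power)
      then have "\<bar>Re (\<beta> * \<zeta>\<^sup>2) / cmod \<zeta>\<bar> \<le> cmod \<beta> * cmod \<zeta>"
        using z by (simp add: divide_le_eq power2_eq_square)
      ultimately show ?thesis
        using abs_triangle_ineq[of "Re (\<beta> * \<zeta>\<^sup>2) / cmod \<zeta>" "Q \<zeta> * cmod \<zeta>"] by (simp add: abs_mult)
    qed
    then show "\<forall>\<^sub>F \<zeta> in at 0. norm (y \<zeta> - y0 \<zeta>) \<le> norm (cmod \<beta> * cmod \<zeta> + \<bar>Q \<zeta>\<bar> * cmod \<zeta>) * 1"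
      by (auto simp: eventually_at_filter)
  qed
  have y0b: "\<bar>y0 \<zeta>\<bar> \<le> 2 * cmod \<alpha>" for \<zeta>
    using abs_Re_le_cmod[of "\<alpha> * \<zeta>"] by (cases "\<zeta> = 0") (simp_all add: y0_def divide_le_eq norm_mult abs_mult)
  have ev1: "\<forall>\<^sub>F \<zeta> in at 0. \<bar>y \<zeta> - y0 \<zeta>\<bar> < 1"
    using order_tendstoD(2)[OF tendsto_rabs[OF yy], of 1] by simp
  have t1: "((\<lambda>\<zeta>. (t (x \<zeta>) - \<phi>2 / 2) * (y \<zeta>)\<^sup>2) \<longlongrightarrow> 0) (at 0)"
  proof (rule tendsto_0_le[where K = "(2 * cmod \<alpha> + 1)\<^sup>2"])
    show "((\<lambda>\<zeta>. t (x \<zeta>) - \<phi>2 / 2) \<longlongrightarrow> 0) (at 0)" using tendsto_diff[OF tx tendsto_const[of "\<phi>2/2"]] by simp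
    show "\<forall>\<^sub>F \<zeta> in at 0. norm ((t (x \<zeta>) - \<phi>2 / 2) * (y \<zeta>)\<^sup>2) \<le> norm (t (x \<zeta>) - \<phi>2 / 2) * (2 * cmod \<alpha> + 1)\<^sup>2"
      using ev1
    proof (rule eventually_mono)
      fix \<zeta> assume "\<bar>y \<zeta> - y0 \<zeta>\<bar> < 1"
      then have "\<bar>y \<zeta>\<bar> \<le> 2 * cmod \<alpha> + 1" using y0b[of \<zeta>] by linarith
      then have "(y \<zeta>)\<^sup>2 \<le> (2 * cmod \<alpha> + 1)\<^sup>2" using abs_le_square_iff[of "y \<zeta>" "2 * cmod \<alpha> + 1"] by simp
      then show "norm ((t (x \<zeta>) - \<phi>2 / 2) * (y \<zeta>)\<^sup>2) \<le> norm (t (x \<zeta>) - \<phi>2 / 2) * (2 * cmod \<alpha> + 1)\<^sup>2"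
        by (simp add: abs_mult mult_left_mono)
    qed
  qed
  have t2: "((\<lambda>\<zeta>. (y \<zeta> - y0 \<zeta>) * (y \<zeta> + y0 \<zeta>)) \<longlongrightarrow> 0) (at 0)"
  proof (rule tendsto_0_le[OF yy, where K = "4 * cmod \<alpha> + 1"])
    show "\<forall>\<^sub>F \<zeta> in at 0. norm ((y \<zeta> - y0 \<zeta>) * (y \<zeta> + y0 \<zeta>)) \<le> norm (y \<zeta> - y0 \<zeta>) * (4 * cmod \<alpha> + 1)"
      using ev1
    proof (rule eventually_mono)
      fix \<zeta> assume "\<bar>y \<zeta> - y0 \<zeta>\<bar> < 1"
      then have "\<bar>y \<zeta> + y0 \<zeta>\<bar> \<le> 4 * cmod \<alpha> + 1" using y0b[of \<zeta>] by linarith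
      then show "norm ((y \<zeta> - y0 \<zeta>) * (y \<zeta> + y0 \<zeta>)) \<le> norm (y \<zeta> - y0 \<zeta>) * (4 * cmod \<alpha> + 1)"
        by (simp add: abs_mult mult_left_mono)
    qed
  qed
  define \<beta>' where "\<beta>' = of_real \<phi>1 * \<beta> + of_real \<phi>2 * \<alpha>\<^sup>2"
  (* the remainder is written as a combination of limits that are already known *)
  have eq: "\<phi>1 * Q \<zeta> + (t (x \<zeta>) - \<phi>2 / 2) * (y \<zeta>)\<^sup>2 + \<phi>2 / 2 * ((y \<zeta> - y0 \<zeta>) * (y \<zeta> + y0 \<zeta>)) + \<phi>2 * (cmod \<alpha>)\<^sup>2
      = (\<phi> (\<psi> \<zeta>) - \<phi> a - 2 * Re (of_real \<phi>1 * \<alpha> * \<zeta>) - Re (\<beta>' * \<zeta>\<^sup>2)) / (cmod \<zeta>)\<^sup>2" if z: "\<zeta> \<noteq> 0" for \<zeta>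
  proof -
    define n where "n = (cmod \<zeta>)\<^sup>2"
    have n: "n \<noteq> 0" using z by (simp add: n_def)
    have tt: "\<phi> (\<psi> \<zeta>) - \<phi> a = \<phi>1 * x \<zeta> + t (x \<zeta>) * (x \<zeta>)\<^sup>2"
      by (simp add: t_def x_def)
    have yx: "(y \<zeta>)\<^sup>2 = (x \<zeta>)\<^sup>2 / n" "(y0 \<zeta>)\<^sup>2 = (2 * Re (\<alpha> * \<zeta>))\<^sup>2 / n"
      by (simp_all add: y_def y0_def n_def power_divide)
    have re: "(2 * Re (\<alpha> * \<zeta>))\<^sup>2 = 2 * ((cmod \<alpha>)\<^sup>2 * n) + 2 * Re (\<alpha>\<^sup>2 * \<zeta>\<^sup>2)"
    proof -
      have "(2 * Re w)\<^sup>2 = 2 * (cmod w)\<^sup>2 + 2 * Re (w\<^sup>2)" for w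
        unfolding cmod_power2 by (simp add: power2_eq_square algebra_simps)
      from this[of "\<alpha> * \<zeta>"] show ?thesis by (simp add: n_def norm_mult power_mult_distrib)
    qed
    have qn: "Q \<zeta> * n = x \<zeta> - 2 * Re (\<alpha> * \<zeta>) - Re (\<beta> * \<zeta>\<^sup>2)"
      using n by (simp add: Q_def n_def x_def)
    have "(\<phi>1 * Q \<zeta> + (t (x \<zeta>) - \<phi>2 / 2) * (y \<zeta>)\<^sup>2 + \<phi>2 / 2 * ((y \<zeta> - y0 \<zeta>) * (y \<zeta> + y0 \<zeta>)) + \<phi>2 * (cmod \<alpha>)\<^sup>2) * n
       = \<phi>1 * (Q \<zeta> * n) + t (x \<zeta>) * ((y \<zeta>)\<^sup>2 * n) - \<phi>2 / 2 * ((y0 \<zeta>)\<^sup>2 * n) + \<phi>2 * ((cmod \<alpha>)\<^sup>2 * n)"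
      by (simp add: power2_eq_square algebra_simps)
    also have "\<dots> = \<phi>1 * (x \<zeta> - 2 * Re (\<alpha> * \<zeta>) - Re (\<beta> * \<zeta>\<^sup>2)) + t (x \<zeta>) * (x \<zeta>)\<^sup>2 - \<phi>2 * Re (\<alpha>\<^sup>2 * \<zeta>\<^sup>2)"
    proof -
      have "(y \<zeta>)\<^sup>2 * n = (x \<zeta>)\<^sup>2" "(y0 \<zeta>)\<^sup>2 * n = 2 * ((cmod \<alpha>)\<^sup>2 * n) + 2 * Re (\<alpha>\<^sup>2 * \<zeta>\<^sup>2)"
        unfolding yx re times_divide_eq_left by (rule nonzero_mult_div_cancel_right[OF n])+
      moreover have "u - k / 2 * (2 * m + 2 * w) + k * m = u - k * w" for u k m w :: real
        by (simp add: field_simps)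
      ultimately show ?thesis unfolding qn by (simp only:)
    qed
    also have "\<dots> = \<phi> (\<psi> \<zeta>) - \<phi> a - 2 * Re (of_real \<phi>1 * \<alpha> * \<zeta>) - Re (\<beta>' * \<zeta>\<^sup>2)"
    proof -
      have r: "Re (of_real \<phi>1 * \<alpha> * \<zeta>) = \<phi>1 * Re (\<alpha> * \<zeta>)" by (simp add: mult.assoc)
      have s: "Re (\<beta>' * \<zeta>\<^sup>2) = \<phi>1 * Re (\<beta> * \<zeta>\<^sup>2) + \<phi>2 * Re (\<alpha>\<^sup>2 * \<zeta>\<^sup>2)"
        by (simp add: \<beta>'_def distrib_right mult.assoc)
      show ?thesis unfolding r s tt by (simp add: algebra_simps)
    qed
    finally show ?thesis using n by (simp add: n_def eq_divide_eq)
  qed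
  have "((\<lambda>\<zeta>. \<phi>1 * Q \<zeta> + (t (x \<zeta>) - \<phi>2 / 2) * (y \<zeta>)\<^sup>2 + \<phi>2 / 2 * ((y \<zeta> - y0 \<zeta>) * (y \<zeta> + y0 \<zeta>)) + \<phi>2 * (cmod \<alpha>)\<^sup>2)
     \<longlongrightarrow> \<phi>1 * c + 0 + \<phi>2 / 2 * 0 + \<phi>2 * (cmod \<alpha>)\<^sup>2) (at 0)"
    by (intro tendsto_add tendsto_mult tendsto_const t1 t2) (use l in \<open>simp add: Q_def\<close>)
  then have "((\<lambda>\<zeta>. (\<phi> (\<psi> \<zeta>) - \<phi> a - 2 * Re (of_real \<phi>1 * \<alpha> * \<zeta>) - Re (\<beta>' * \<zeta>\<^sup>2)) / (cmod \<zeta>)\<^sup>2)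
     \<longlongrightarrow> \<phi>1 * c + 0 + \<phi>2 / 2 * 0 + \<phi>2 * (cmod \<alpha>)\<^sup>2) (at 0)"
    by (rule Lim_transform_eventually) (rule eventually_at_punctured, rule eq)
  then have "((\<lambda>\<zeta>. (\<phi> (\<psi> \<zeta>) - \<phi> a - 2 * Re (of_real \<phi>1 * \<alpha> * \<zeta>) - Re (\<beta>' * \<zeta>\<^sup>2)) / (cmod \<zeta>)\<^sup>2)
     \<longlongrightarrow> \<phi>1 * c + \<phi>2 * (cmod \<alpha>)\<^sup>2) (at 0)" by simp
  then show ?thesis by (rule leviI) (use levi_0[OF lv] in simp)
qed

lemma levi_ln:
  assumes "levi \<psi> a \<alpha> c" "a > 0"
  shows "levi (\<lambda>\<zeta>. ln (\<psi> \<zeta>)) (ln a) (\<alpha> / of_real a) (c / a - (cmod \<alpha> / a)\<^sup>2)"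
proof -
  have "((\<lambda>y::real. (ln (1 + y) - y) / y\<^sup>2) \<longlongrightarrow> -1/2) (at 0)" by real_asymp
  moreover have "filterlim (\<lambda>x. x / a) (at 0) (at 0)"
    unfolding filterlim_at using assms(2) by (auto simp: eventually_at_filter intro!: tendsto_eq_intros)
  ultimately have "((\<lambda>x. (ln (1 + x / a) - x / a) / (x / a)\<^sup>2) \<longlongrightarrow> -1/2) (at 0)"
    by (rule filterlim_compose)
  from tendsto_mult_left[OF this, of "1 / a\<^sup>2"]
  have lim: "((\<lambda>x. 1 / a\<^sup>2 * ((ln (1 + x / a) - x / a) / (x / a)\<^sup>2)) \<longlongrightarrow> (- 1 / a\<^sup>2) / 2) (at 0)" by simp
  have "\<forall>\<^sub>F x in at 0. \<bar>x\<bar> < a" using assms(2)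
    by (auto simp: eventually_at intro!: exI[of _ a])
  then have "((\<lambda>x. (ln (a + x) - ln a - 1 / a * x) / x\<^sup>2) \<longlongrightarrow> (- 1 / a\<^sup>2) / 2) (at 0)"
  proof (intro Lim_transform_eventually[OF lim], elim eventually_mono)
    fix x assume x: "\<bar>x\<bar> < a"
    have "ln (a + x) = ln (a * (1 + x / a))" using assms(2) by (simp add: field_simps)
    also have "\<dots> = ln a + ln (1 + x / a)" using x assms(2) by (intro ln_mult_pos) (auto simp: field_simps)
    finally show "1 / a\<^sup>2 * ((ln (1 + x / a) - x / a) / (x / a)\<^sup>2) = (ln (a + x) - ln a - 1 / a * x) / x\<^sup>2"
      using assms(2) by (cases "x = 0") (simp_all add: field_simps power2_eq_square)
  qed
  from levi_compose[OF assms(1) this]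
  show ?thesis by (simp add: power_divide)
qed

lemma levi_exp:
  assumes "levi \<psi> a \<alpha> c"
  shows "levi (\<lambda>\<zeta>. exp (\<psi> \<zeta>)) (exp a) (of_real (exp a) * \<alpha>) (exp a * (c + (cmod \<alpha>)\<^sup>2))"
proof -
  have "((\<lambda>x::real. (exp x - 1 - x) / x\<^sup>2) \<longlongrightarrow> 1/2) (at 0)" by real_asymp
  from tendsto_mult_left[OF this, of "exp a"]
  have "((\<lambda>x. (exp (a + x) - exp a - exp a * x) / x\<^sup>2) \<longlongrightarrow> exp a / 2) (at 0)"
    by (simp add: exp_add algebra_simps)
  from levi_compose[OF assms this] show ?thesis by (simp add: algebra_simps)
qed

text \<open>
  The logarithm of the modulus of a holomorphic function is harmonic away from the zeros.
\<close>

lemma levi_log_holomorphic: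
  assumes "jet f a b c" "a \<noteq> 0"
  obtains \<alpha> where "levi (\<lambda>\<zeta>. ln ((cmod (f \<zeta>))\<^sup>2)) (ln ((cmod a)\<^sup>2)) \<alpha> 0"
proof -
  have eq: "(cmod b)\<^sup>2 / (cmod a)\<^sup>2 - (cmod (cnj a * b) / (cmod a)\<^sup>2)\<^sup>2 = 0"
    using assms(2) by (simp add: norm_mult power2_eq_square field_simps)
  have "(cmod a)\<^sup>2 > 0" using assms(2) by simp
  from levi_ln[OF levi_norm_square[OF assms(1)] this] show ?thesis unfolding eq by (rule that)
qed

text \<open>
  The sum over the four directions \<open>1, -1, \<i>, -\<i>\<close> cancels the first-order and the harmonic
  second-order terms.
\<close>

lemma levi_local_max:
  assumes lv: "levi \<psi> a \<alpha> c" and max: "\<forall>\<^sub>F \<zeta> in at 0. \<psi> \<zeta> \<le> \<psi> 0"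
  shows "c \<le> 0"
proof -
  obtain \<beta> where
    l: "((\<lambda>\<zeta>. (\<psi> \<zeta> - a - 2 * Re (\<alpha> * \<zeta>) - Re (\<beta> * \<zeta>\<^sup>2)) / (cmod \<zeta>)\<^sup>2) \<longlongrightarrow> c) (at 0)"
    using lv unfolding levi_def by blast
  have fl: "filterlim (\<lambda>t::real. u * of_real t) (at 0) (at_right 0)" if "u \<noteq> 0" for u :: complex
    unfolding filterlim_at using that
    by (auto simp: eventually_at_filter intro!: tendsto_eq_intros)
  define Q where "Q = (\<lambda>\<zeta>. (\<psi> \<zeta> - a - 2 * Re (\<alpha> * \<zeta>) - Re (\<beta> * \<zeta>\<^sup>2)) / (cmod \<zeta>)\<^sup>2)"
  have Q: "((\<lambda>t. Q (u * of_real t)) \<longlongrightarrow> c) (at_right 0)" if "u \<noteq> 0" for u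
    using filterlim_compose[OF l fl[OF that]] by (simp add: Q_def)
  have "((\<lambda>t. Q (1 * of_real t) + Q (-1 * of_real t) + Q (\<i> * of_real t) + Q (-\<i> * of_real t)) \<longlongrightarrow> c + c + c + c) (at_right 0)"
    by (intro tendsto_add Q) auto
  moreover have "\<forall>\<^sub>F t in at_right 0. Q (1 * of_real t) + Q (-1 * of_real t) + Q (\<i> * of_real t) + Q (-\<i> * of_real t) \<le> 0"
  proof -
    have ev: "\<forall>\<^sub>F t in at_right 0. \<psi> (u * of_real t) \<le> a" if "u \<noteq> 0" for u
      using filterlim_iff[THEN iffD1, OF fl[OF that], rule_format, OF max] levi_0[OF lv] by simp
    have pos: "\<forall>\<^sub>F t :: real in at_right 0. t > 0" by (simp add: eventually_at_filter)
    have "\<forall>\<^sub>F t in at_right 0. \<psi> (1 * of_real t) \<le> a" "\<forall>\<^sub>F t in at_right 0. \<psi> (-1 * of_real t) \<le> a"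
      "\<forall>\<^sub>F t in at_right 0. \<psi> (\<i> * of_real t) \<le> a" "\<forall>\<^sub>F t in at_right 0. \<psi> (-\<i> * of_real t) \<le> a"
      by (rule ev; simp)+
    from this pos show ?thesis
    proof eventually_elim
      case (elim t)
      have "Q (1 * of_real t) + Q (-1 * of_real t) + Q (\<i> * of_real t) + Q (-\<i> * of_real t) =
         (\<psi> (1 * of_real t) + \<psi> (-1 * of_real t) + \<psi> (\<i> * of_real t) + \<psi> (-\<i> * of_real t) - 4 * a) / t\<^sup>2"
        by (simp add: Q_def norm_mult power_mult_distrib add_divide_distrib[symmetric])
      also have "\<dots> \<le> 0" using elim by (intro divide_nonpos_nonneg) auto
      finally show ?case .
    qed
  qed
  ultimately have "c + c + c + c \<le> 0" by (intro tendsto_upperbound) auto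
  then show ?thesis by simp
qed

section \<open>Hermitian linear algebra\<close>

definition herm :: "complex ^ 'n::finite \<Rightarrow> complex ^ 'n \<Rightarrow> complex" where
  "herm u v = (\<Sum>k\<in>UNIV. u $ k * cnj (v $ k))"

lemma norm_square_vec: "(norm (u :: complex ^ 'n::finite))\<^sup>2 = (\<Sum>k\<in>UNIV. (cmod (u $ k))\<^sup>2)"
  by (simp add: norm_vec_def L2_set_def sum_nonneg)

lemma herm_self: "herm u u = of_real ((norm u)\<^sup>2)"
  unfolding norm_square_vec herm_def of_real_sum complex_norm_square ..

lemma herm_add: "herm (u + v) w = herm u w + herm v w"
  and herm_diff: "herm (u - v) w = herm u w - herm v w"
  and herm_smult: "herm (c *s u) w = c * herm u w"
  by (simp_all add: herm_def algebra_simps sum.distrib sum_subtractf sum_distrib_left)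

lemma norm_add_square:
  "(norm (u + c *s v))\<^sup>2 = (norm u)\<^sup>2 + 2 * Re (cnj c * herm u v) + (cmod c)\<^sup>2 * (norm v)\<^sup>2"
proof -
  have e: "(cmod (x + c * y))\<^sup>2 = (cmod x)\<^sup>2 + 2 * Re (cnj c * (x * cnj y)) + (cmod c)\<^sup>2 * (cmod y)\<^sup>2" for x y
    unfolding cmod_power2 by (simp add: power2_eq_square algebra_simps)
  show ?thesis unfolding norm_square_vec herm_def
    by (simp add: e sum.distrib sum_distrib_left Re_sum del: times_complex.sel complex_cnj_mult)
qed

lemma Cauchy_Schwarz_bilinear: "cmod (\<Sum>k\<in>UNIV. u $ k * v $ k) \<le> norm u * norm (v :: complex ^ 'n::finite)"
proof -
  have "cmod (\<Sum>k\<in>UNIV. u $ k * v $ k) \<le> (\<Sum>k\<in>UNIV. \<bar>cmod (u $ k)\<bar> * \<bar>cmod (v $ k)\<bar>)"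
    using norm_sum[of "\<lambda>k. u $ k * v $ k" UNIV] by (simp add: norm_mult)
  also have "\<dots> \<le> norm u * norm v" unfolding norm_vec_def by (rule L2_set_mult_ineq)
  finally show ?thesis .
qed

lemma Cauchy_Schwarz_herm: "cmod (herm u v) \<le> norm u * norm v"
proof -
  have "norm (\<chi> k. cnj (v $ k)) = norm v" by (simp add: norm_vec_def)
  then show ?thesis using Cauchy_Schwarz_bilinear[of u "\<chi> k. cnj (v $ k)"] by (simp add: herm_def)
qed

text \<open>
  The squared length of the component of \<open>u\<close> orthogonal to \<open>g\<close>, divided by that of \<open>g\<close>. By
  \<open>levi_ln_norm_square\<close> it is the Levi form of \<open>ln ((norm f)\<^sup>2)\<close> at a point with value \<open>g\<close> and velocity \<open>u\<close>,
  that is, the Fubini-Study metric.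
\<close>

definition residual :: "complex ^ 'n::finite \<Rightarrow> complex ^ 'n \<Rightarrow> real" where
  "residual u g = (norm u)\<^sup>2 / (norm g)\<^sup>2 - (cmod (herm u g / of_real ((norm g)\<^sup>2)))\<^sup>2"

lemma residual_nonneg: "g \<noteq> 0 \<Longrightarrow> residual u g \<ge> 0"
proof -
  assume g: "g \<noteq> 0"
  have "(cmod (herm u g))\<^sup>2 \<le> (norm u)\<^sup>2 * (norm g)\<^sup>2"
    using power_mono[OF Cauchy_Schwarz_herm[of u g], of 2] by (simp add: power_mult_distrib)
  moreover define n where "n = (norm g)\<^sup>2"
  moreover have "n > 0" using g by (simp add: n_def)
  ultimately have "(cmod (herm u g))\<^sup>2 / n\<^sup>2 \<le> (norm u)\<^sup>2 * n / n\<^sup>2"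
    by (intro divide_right_mono) auto
  also have "(norm u)\<^sup>2 * n / n\<^sup>2 = (norm u)\<^sup>2 / n" using \<open>n > 0\<close> by (simp add: power2_eq_square)
  finally show ?thesis using \<open>n > 0\<close>
    by (simp add: residual_def n_def[symmetric] norm_divide power_divide)
qed

lemma residual_add_multiple:
  assumes "g \<noteq> 0"
  shows "residual (u + c *s g) g = residual u g"
proof -
  define n where "n = (norm g)\<^sup>2"
  have n: "n > 0" using assms by (simp add: n_def)
  have 1: "(norm (u + c *s g))\<^sup>2 = (norm u)\<^sup>2 + 2 * Re (cnj c * herm u g) + (cmod c)\<^sup>2 * n"
    by (simp add: norm_add_square n_def)
  have 2: "herm (u + c *s g) g / of_real n = herm u g / of_real n + c"
    using n by (simp add: herm_add herm_smult herm_self n_def add_divide_distrib)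
  have 3: "(cmod (x / of_real n + c))\<^sup>2 = (cmod (x / of_real n))\<^sup>2 + 2 * Re (cnj c * x) / n + (cmod c)\<^sup>2" for x
    unfolding cmod_power2 by (simp add: Re_divide_of_real Im_divide_of_real power2_eq_square algebra_simps add_divide_distrib)
  show ?thesis
    unfolding residual_def n_def[symmetric] 1 2 3 using n by (simp add: add_divide_distrib)
qed

lemma orthogonal_decomposition:
  fixes f u :: "complex ^ 'n::finite"
  assumes "f \<noteq> 0"
  defines "\<alpha> \<equiv> herm u f / of_real ((norm f)\<^sup>2)"
  shows "herm (u - \<alpha> *s f) f = 0" "residual u f = (norm (u - \<alpha> *s f))\<^sup>2 / (norm f)\<^sup>2"
proof -
  show z: "herm (u - \<alpha> *s f) f = 0"
    using assms by (simp add: herm_diff herm_smult herm_self)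
  have "residual u f = residual (u - \<alpha> *s f) f"
    using residual_add_multiple[OF assms(1), of "u - \<alpha> *s f" \<alpha>] by simp
  then show "residual u f = (norm (u - \<alpha> *s f))\<^sup>2 / (norm f)\<^sup>2"
    using z by (simp add: residual_def)
qed

section \<open>The curvature of the weight function\<close>

definition gradv :: "(complex ^ 3 \<Rightarrow> complex) \<Rightarrow> complex ^ 3 \<Rightarrow> complex ^ 3" where
  "gradv p z = (\<chi> k. pd p k z)"

definition hessv :: "(complex ^ 3 \<Rightarrow> complex) \<Rightarrow> complex ^ 3 \<Rightarrow> complex ^ 3 \<Rightarrow> complex ^ 3" where
  "hessv p z t = (\<chi> k. grad (pd p k) z t)"

lemma grad_gradv: "grad p z v = (\<Sum>k\<in>UNIV. gradv p z $ k * v $ k)"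
  by (simp add: grad_def gradv_def)

lemma hess_hessv: "polyfun p \<Longrightarrow> hess p z t v = (\<Sum>k\<in>UNIV. hessv p z t $ k * v $ k)"
proof -
  assume "polyfun p"
  then have "hess p z t v = hess p z v t" by (rule hess_commute)
  also have "\<dots> = (\<Sum>k\<in>UNIV. hessv p z t $ k * v $ k)"
    by (simp add: hess_def hessv_def grad_def sum_distrib_left sum_distrib_right mult_ac)
  finally show ?thesis .
qed

lemma hessv_add: "hessv p z (u + v) = hessv p z u + hessv p z v"
  and hessv_smult: "hessv p z (c *s v) = c *s hessv p z v"
  by (simp_all add: hessv_def vec_eq_iff grad_add grad_scale)

lemma hessv_self: "form (Suc d) p \<Longrightarrow> hessv p z z = of_nat d *s gradv p z"
  by (simp add: hessv_def gradv_def vec_eq_iff Euler[OF form_pd])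

lemma gradv_scale: "form (Suc d) p \<Longrightarrow> gradv p (c *s z) = c ^ d *s gradv p z"
  by (simp add: gradv_def vec_eq_iff formD(2)[OF form_pd])

lemma hessv_scale: "form (Suc (Suc d)) p \<Longrightarrow> hessv p (c *s z) t = c ^ d *s hessv p z t"
  by (simp add: hessv_def grad_def vec_eq_iff formD(2)[OF form_pd[OF form_pd]] sum_distrib_left mult_ac)

text \<open>
  With \<open>h = (norm z)\<^sup>2\<close> and \<open>G = (norm (gradv p z))\<^sup>2\<close> this is \<open>\<kappa> ln h + A h powr (- q) + A (G / h ^ (d
  - 1)) powr \<delta>\<close>. For a form \<open>p\<close> of degree \<open>d\<close> the quotient \<open>G / h ^ (d - 1)\<close> is a function on the
  projective plane that vanishes exactly at the common zeros of the partial derivatives of \<open>p\<close>.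
\<close>

definition weight :: "(complex ^ 3 \<Rightarrow> complex) \<Rightarrow> real \<Rightarrow> real \<Rightarrow> real \<Rightarrow> real \<Rightarrow> real \<Rightarrow> complex ^ 3 \<Rightarrow> real" where
  "weight p d \<kappa> q \<delta> A z = \<kappa> * ln ((norm z)\<^sup>2) + A * exp (- q * ln ((norm z)\<^sup>2))
     + A * exp (\<delta> * (ln ((norm (gradv p z))\<^sup>2) + (1 - d) * ln ((norm z)\<^sup>2)))"

text \<open>
  The outcome of the rules for sums, logarithms and exponentials for the Levi form of the weight
  along a curve through \<open>z\<close> with velocity \<open>t\<close>, see \<open>levi_weight\<close>.
\<close>

definition curvature :: "(complex ^ 3 \<Rightarrow> complex) \<Rightarrow> real \<Rightarrow> real \<Rightarrow> real \<Rightarrow> real \<Rightarrow> real \<Rightarrow> complex ^ 3 \<Rightarrow> complex ^ 3 \<Rightarrow> real" where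
  "curvature p d \<kappa> q \<delta> A z t =
     (let \<omega> = residual t z; \<alpha> = herm t z / of_real ((norm z)\<^sup>2);
          \<Omega> = residual (hessv p z t) (gradv p z); \<beta> = herm (hessv p z t) (gradv p z) / of_real ((norm (gradv p z))\<^sup>2)
      in \<kappa> * \<omega> + A * (exp (- q * ln ((norm z)\<^sup>2)) * (- q * \<omega> + q\<^sup>2 * (cmod \<alpha>)\<^sup>2))
         + A * (exp (\<delta> * (ln ((norm (gradv p z))\<^sup>2) + (1 - d) * ln ((norm z)\<^sup>2))) *
             (\<delta> * (\<Omega> + (1 - d) * \<omega>) + \<delta>\<^sup>2 * (cmod (\<beta> + of_real (1 - d) * \<alpha>))\<^sup>2)))"

lemma levi_ln_norm_square:
  fixes f :: "complex \<Rightarrow> complex ^ 3"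
  assumes j: "\<And>k. jet (\<lambda>\<zeta>. f \<zeta> $ k) (a $ k) (b $ k) (c $ k)" and a: "a \<noteq> 0"
  shows "levi (\<lambda>\<zeta>. ln ((norm (f \<zeta>))\<^sup>2)) (ln ((norm a)\<^sup>2)) (herm b a / of_real ((norm a)\<^sup>2)) (residual b a)"
proof -
  have "levi (\<lambda>\<zeta>. \<Sum>k\<in>UNIV. (cmod (f \<zeta> $ k))\<^sup>2) (\<Sum>k\<in>UNIV. (cmod (a $ k))\<^sup>2)
      (\<Sum>k\<in>UNIV. cnj (a $ k) * b $ k) (\<Sum>k\<in>UNIV. (cmod (b $ k))\<^sup>2)"
    by (rule levi_sum) (auto intro: levi_norm_square j)
  then have "levi (\<lambda>\<zeta>. (norm (f \<zeta>))\<^sup>2) ((norm a)\<^sup>2) (herm b a) ((norm b)\<^sup>2)"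
    by (simp add: norm_square_vec herm_def mult.commute)
  from levi_ln[OF this] a show ?thesis
    by (simp add: residual_def norm_divide norm_power)
qed

lemma levi_weight:
  fixes f :: "complex \<Rightarrow> complex ^ 3"
  assumes p: "polyfun p" and j: "\<And>k. jet (\<lambda>\<zeta>. f \<zeta> $ k) (a $ k) (b $ k) (c $ k)"
    and a: "a \<noteq> 0" "gradv p a \<noteq> 0"
  obtains \<alpha> where "levi (\<lambda>\<zeta>. weight p d \<kappa> q \<delta> A (f \<zeta>)) (weight p d \<kappa> q \<delta> A a) \<alpha> (curvature p d \<kappa> q \<delta> A a b)"
proof -
  define c' where "c' = (\<chi> k. grad (pd p k) a c + hess (pd p k) a b b / 2)"
  have "jet (\<lambda>\<zeta>. gradv p (f \<zeta>) $ k) (gradv p a $ k) (hessv p a b $ k) (c' $ k)" for k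
    using jet_polyfun[OF polyfun_pd[OF p] j, of k] by (simp add: gradv_def hessv_def c'_def)
  note G = levi_ln_norm_square[OF this a(2)] and h = levi_ln_norm_square[OF j a(1)]
  have e1: "levi (\<lambda>\<zeta>. exp (- q * ln ((norm (f \<zeta>))\<^sup>2))) (exp (- q * ln ((norm a)\<^sup>2)))
     (of_real (exp (- q * ln ((norm a)\<^sup>2))) * (of_real (- q) * (herm b a / of_real ((norm a)\<^sup>2))))
     (exp (- q * ln ((norm a)\<^sup>2)) * (- q * residual b a + (cmod (of_real (- q) * (herm b a / of_real ((norm a)\<^sup>2))))\<^sup>2))"
    by (rule levi_exp[OF levi_cmult[OF h]])
  note e2 = levi_exp[OF levi_cmult[OF levi_add[OF G levi_cmult[OF h, of "1 - d"]], of \<delta>]]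
  have sq: "(cmod (of_real r * x))\<^sup>2 = r\<^sup>2 * (cmod x)\<^sup>2" for r x
    by (simp add: norm_mult power_mult_distrib)
  show ?thesis
    by (rule that, rule back_subst[where P = "levi _ _ _"])
       (unfold weight_def, rule levi_add[OF levi_add[OF levi_cmult[OF h] levi_cmult[OF e1]] levi_cmult[OF e2]],
        simp only: curvature_def Let_def sq power2_minus)
qed

definition cross :: "complex ^ 3 \<Rightarrow> complex ^ 3 \<Rightarrow> complex ^ 3" where
  "cross u v = vector [u $ 2 * v $ 3 - u $ 3 * v $ 2, u $ 3 * v $ 1 - u $ 1 * v $ 3, u $ 1 * v $ 2 - u $ 2 * v $ 1]"

lemma norm_cross_le: "norm (cross u v) \<le> 6 * (norm u * norm v)"
proof -
  have c: "cmod (u $ i * v $ j) \<le> norm u * norm v" for i j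
    unfolding norm_mult norm_vec_def by (intro mult_mono member_le_L2_set) (auto simp: L2_set_nonneg)
  have "cmod (u $ i * v $ j - u $ k * v $ l) \<le> 2 * (norm u * norm v)" for i j k l
    using norm_triangle_ineq4[of "u $ i * v $ j" "u $ k * v $ l"] c[of i j] c[of k l] by linarith
  then have "cmod (cross u v $ k) \<le> 2 * (norm u * norm v)" for k
    using exhaust_3[of k] by (auto simp: cross_def)
  then have "(\<Sum>k\<in>UNIV. cmod (cross u v $ k)) \<le> 6 * (norm u * norm v)"
    unfolding sum_3 by (smt (verit))
  moreover have "norm (cross u v) \<le> (\<Sum>k\<in>UNIV. cmod (cross u v $ k))"
    unfolding norm_vec_def by (rule L2_set_le_sum) auto
  ultimately show ?thesis by linarith
qed

text \<open>
  A covector \<open>g\<close> that annihilates \<open>a\<close> and \<open>b\<close> is a multiple of their cross product; pairing with \<open>f\<close> gives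
  the factor.
\<close>

lemma cross_gradient:
  fixes g f a b :: "complex ^ 3"
  assumes "(\<Sum>k\<in>UNIV. g $ k * f $ k) = e" "(\<Sum>k\<in>UNIV. g $ k * a $ k) = 0" "(\<Sum>k\<in>UNIV. g $ k * b $ k) = 0"
  shows "e *s cross a b = det3 f a b *s g"
proof -
  let ?gf = "\<Sum>k\<in>UNIV. g $ k * f $ k" and ?ga = "\<Sum>k\<in>UNIV. g $ k * a $ k" and ?gb = "\<Sum>k\<in>UNIV. g $ k * b $ k"
  have "det3 f a b * g $ 1 = ?gf * (a $ 2 * b $ 3 - a $ 3 * b $ 2) + ?ga * (b $ 2 * f $ 3 - b $ 3 * f $ 2) + ?gb * (f $ 2 * a $ 3 - f $ 3 * a $ 2)"
    "det3 f a b * g $ 2 = ?gf * (a $ 3 * b $ 1 - a $ 1 * b $ 3) + ?ga * (b $ 3 * f $ 1 - b $ 1 * f $ 3) + ?gb * (f $ 3 * a $ 1 - f $ 1 * a $ 3)"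
    "det3 f a b * g $ 3 = ?gf * (a $ 1 * b $ 2 - a $ 2 * b $ 1) + ?ga * (b $ 1 * f $ 2 - b $ 2 * f $ 1) + ?gb * (f $ 1 * a $ 2 - f $ 2 * a $ 1)"
    unfolding sum_3 det3_def by (simp_all add: algebra_simps)
  then have "e * (a $ 2 * b $ 3 - a $ 3 * b $ 2) = det3 f a b * g $ 1"
    "e * (a $ 3 * b $ 1 - a $ 1 * b $ 3) = det3 f a b * g $ 2"
    "e * (a $ 1 * b $ 2 - a $ 2 * b $ 1) = det3 f a b * g $ 3"
    using assms by simp_all
  then show ?thesis by (simp add: vec_eq_iff forall_3 cross_def)
qed

lemma cross_decompose: "cross (a *s f + s) (b *s f + t) = a *s cross f t - b *s cross f s + cross s t"
  by (simp add: vec_eq_iff forall_3 cross_def algebra_simps)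

text \<open>
  By \<open>cross_gradient\<close> the determinant is measured by the cross product of \<open>f1\<close> and \<open>f2\<close>. Each of these is
  a multiple of \<open>f\<close> plus a vector orthogonal to \<open>f\<close>, and the product of the two multiples of \<open>f\<close> is zero:
  there is no term of order \<open>a\<^sup>2\<close>.
\<close>

lemma jacobian_estimate:
  fixes g f f1 f2 :: "complex ^ 3" and d :: nat
  assumes f: "f \<noteq> 0" and g: "(\<Sum>k\<in>UNIV. g $ k * f $ k) = of_nat d" "(\<Sum>k\<in>UNIV. g $ k * f1 $ k) = 0" "(\<Sum>k\<in>UNIV. g $ k * f2 $ k) = 0"
  defines "\<alpha>1 \<equiv> herm f1 f / of_real ((norm f)\<^sup>2)" and "\<alpha>2 \<equiv> herm f2 f / of_real ((norm f)\<^sup>2)"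
  defines "a \<equiv> sqrt ((cmod \<alpha>1)\<^sup>2 + (cmod \<alpha>2)\<^sup>2)" and "s \<equiv> sqrt (residual f1 f + residual f2 f)"
  shows "cmod (det3 f f1 f2) * norm g \<le> 6 * d * (norm f)\<^sup>2 * (2 * a * s + s\<^sup>2)"
proof -
  define t1 where "t1 = f1 - \<alpha>1 *s f" define t2 where "t2 = f2 - \<alpha>2 *s f"
  define r1 where "r1 = sqrt (residual f1 f)" define r2 where "r2 = sqrt (residual f2 f)"
  have res: "residual f1 f = (norm t1)\<^sup>2 / (norm f)\<^sup>2" "residual f2 f = (norm t2)\<^sup>2 / (norm f)\<^sup>2"
    using orthogonal_decomposition(2)[OF f] by (simp_all add: t1_def t2_def \<alpha>1_def \<alpha>2_def)
  have nt: "norm t1 = norm f * r1" "norm t2 = norm f * r2"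
    using f by (simp_all add: r1_def r2_def res real_sqrt_divide)
  have r0: "r1 \<ge> 0" "r2 \<ge> 0" using residual_nonneg[OF f] by (simp_all add: r1_def r2_def)
  have rs: "r1 \<le> s" "r2 \<le> s" using residual_nonneg[OF f] by (simp_all add: r1_def r2_def s_def)
  have as: "cmod \<alpha>1 \<le> a" "cmod \<alpha>2 \<le> a" by (simp_all add: a_def real_le_rsqrt)
  have a0: "a \<ge> 0" by (simp add: a_def)
  have "cross f1 f2 = \<alpha>1 *s cross f t2 - \<alpha>2 *s cross f t1 + cross t1 t2"
    using cross_decompose[of \<alpha>1 f t1 \<alpha>2 t2] by (simp add: t1_def t2_def)
  then have "norm (cross f1 f2) \<le> cmod \<alpha>1 * norm (cross f t2) + cmod \<alpha>2 * norm (cross f t1) + norm (cross t1 t2)"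
    using norm_triangle_ineq[of "\<alpha>1 *s cross f t2 - \<alpha>2 *s cross f t1" "cross t1 t2"]
      norm_triangle_ineq4[of "\<alpha>1 *s cross f t2" "\<alpha>2 *s cross f t1"] by (simp add: norm_smult)
  also have "\<dots> \<le> a * (6 * (norm f * (norm f * s))) + a * (6 * (norm f * (norm f * s))) + 6 * ((norm f * s) * (norm f * s))"
  proof (intro add_mono mult_mono as a0)
    show "norm (cross f t2) \<le> 6 * (norm f * (norm f * s))"
      using norm_cross_le[of f t2] rs(2) by (smt (verit) nt(2) mult_left_mono norm_ge_zero)
    show "norm (cross f t1) \<le> 6 * (norm f * (norm f * s))"
      using norm_cross_le[of f t1] rs(1) by (smt (verit) nt(1) mult_left_mono norm_ge_zero)
    have "norm t1 * norm t2 \<le> (norm f * s) * (norm f * s)"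
      unfolding nt using rs r0 by (intro mult_mono mult_left_mono) auto
    then show "norm (cross t1 t2) \<le> 6 * ((norm f * s) * (norm f * s))"
      using norm_cross_le[of t1 t2] by linarith
  qed auto
  also have "\<dots> = 6 * (norm f)\<^sup>2 * (2 * a * s + s\<^sup>2)" by (simp add: power2_eq_square algebra_simps)
  finally have "of_nat d * norm (cross f1 f2) \<le> of_nat d * (6 * (norm f)\<^sup>2 * (2 * a * s + s\<^sup>2))"
    by (intro mult_left_mono) auto
  moreover have "of_nat d * norm (cross f1 f2) = cmod (det3 f f1 f2) * norm g"
    using arg_cong[OF cross_gradient[OF g], of norm] by (simp add: norm_smult)
  ultimately show ?thesis by (simp add: mult_ac)
qed

text \<open>
  Write \<open>t = \<alpha> *s z + \<tau>\<close> with \<open>\<tau>\<close> orthogonal to \<open>z\<close>. Since \<open>hessv p z z\<close> is a multiple of the gradient by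
  Euler's relation, \<open>\<alpha>\<close> drops out of the Levi form of the third summand of the weight, which then
  dominates a positive multiple of \<open>(norm (hessv p z \<tau>))\<^sup>2 / G\<close>. The hypothesis \<open>c1\<close> bounds this below
  where \<open>G\<close> is small. All negative multiples of \<open>residual t z\<close> are absorbed by the first summand of the
  weight, which dictates the relation between \<open>\<kappa>\<close> and \<open>A\<close>.
\<close>

lemma curvature_lower_bound:
  assumes fp: "form (Suc (Suc m)) p" and z: "z \<noteq> 0" "gradv p z \<noteq> 0"
    and c1: "\<And>\<tau>. herm \<tau> z = 0 \<Longrightarrow> c1 * ((norm z)\<^sup>2) ^ Suc m * (norm \<tau>)\<^sup>2
        \<le> (norm z)\<^sup>2 * (norm (hessv p z \<tau>))\<^sup>2 + (norm (gradv p z))\<^sup>2 * (norm \<tau>)\<^sup>2"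
    and q: "0 \<le> q" and \<delta>: "0 < \<delta>" "\<delta> \<le> 1" and A: "A > 0"
  defines "h \<equiv> (norm z)\<^sup>2" and "G \<equiv> (norm (gradv p z))\<^sup>2"
  defines "e1 \<equiv> exp (- q * ln h)" and "e2 \<equiv> exp (\<delta> * (ln G + (1 - real (Suc (Suc m))) * ln h))"
  assumes H: "e1 \<le> H" and M: "e2 \<le> M"
    and \<kappa>: "\<kappa> = A * (q * H + \<delta> * (real (Suc (Suc m)) - 1) * M + \<delta>\<^sup>2 * M)"
  shows "A * q\<^sup>2 * e1 * (cmod (herm t z / of_real h))\<^sup>2 + A * \<delta>\<^sup>2 * c1 * (e2 * (h ^ Suc m / G)) * residual t z
     \<le> curvature p (Suc (Suc m)) \<kappa> q \<delta> A z t"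
proof -
  define n where "n = real (Suc m)"
  have n: "real (Suc (Suc m)) = n + 1" by (simp add: n_def)
  have n0: "n \<ge> 0" by (simp add: n_def)
  have h: "h > 0" and G: "G > 0" using z by (simp_all add: h_def G_def)
  define \<alpha> where "\<alpha> = herm t z / of_real h"
  define \<tau> where "\<tau> = t - \<alpha> *s z"
  define \<omega> where "\<omega> = residual t z"
  define g where "g = gradv p z"
  define k where "k = hessv p z \<tau>"
  have orth: "herm \<tau> z = 0" "\<omega> = (norm \<tau>)\<^sup>2 / h"
    using orthogonal_decomposition[OF z(1), of t] by (simp_all add: \<tau>_def \<alpha>_def h_def \<omega>_def)
  have \<omega>0: "\<omega> \<ge> 0" unfolding \<omega>_def by (rule residual_nonneg[OF z(1)])
  have ht: "hessv p z t = k + (\<alpha> * of_nat (Suc m)) *s g"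
  proof -
    have "t = \<tau> + \<alpha> *s z" by (simp add: \<tau>_def)
    then have "hessv p z t = k + \<alpha> *s hessv p z z" by (simp add: hessv_add hessv_smult k_def)
    then show ?thesis using hessv_self[OF fp, of z] by (simp add: g_def vector_smult_assoc del: of_nat_Suc)
  qed
  define \<Omega> where "\<Omega> = residual k g"
  define \<eta> where "\<eta> = herm k g / of_real G"
  have \<Omega>: "residual (hessv p z t) (gradv p z) = \<Omega>"
    unfolding ht \<Omega>_def g_def[symmetric] using residual_add_multiple z(2) by (simp add: g_def)
  have \<Omega>0: "\<Omega> \<ge> 0" unfolding \<Omega>_def by (rule residual_nonneg) (simp add: g_def z(2))
  have \<eta>: "herm (hessv p z t) (gradv p z) / of_real G + of_real (1 - real (Suc (Suc m))) * \<alpha> = \<eta>"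
    unfolding ht herm_add herm_smult g_def[symmetric] herm_self
    using G by (simp add: \<eta>_def G_def g_def add_divide_distrib algebra_simps)
  have sum: "\<Omega> + (cmod \<eta>)\<^sup>2 = (norm k)\<^sup>2 / G"
    by (simp add: \<Omega>_def \<eta>_def residual_def G_def g_def)
  have "c1 * h ^ Suc m * (norm \<tau>)\<^sup>2 \<le> h * (norm k)\<^sup>2 + G * (norm \<tau>)\<^sup>2"
    using c1[OF orth(1)] by (simp only: h_def G_def k_def)
  then have "c1 * h ^ Suc m * (\<omega> * h) \<le> h * (norm k)\<^sup>2 + G * (\<omega> * h)"
    using h by (simp add: orth(2))
  then have "h * (c1 * h ^ Suc m * \<omega>) \<le> h * ((norm k)\<^sup>2 + G * \<omega>)" by (simp add: algebra_simps)
  then have "c1 * h ^ Suc m * \<omega> \<le> (norm k)\<^sup>2 + G * \<omega>" using h by simp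
  then have "c1 * h ^ Suc m * \<omega> / G \<le> ((norm k)\<^sup>2 + G * \<omega>) / G" using G by (intro divide_right_mono) auto
  then have k: "c1 * (h ^ Suc m / G) * \<omega> - \<omega> \<le> \<Omega> + (cmod \<eta>)\<^sup>2"
    unfolding sum using G by (simp add: add_divide_distrib mult_ac)
  have e2: "e2 > 0" by (simp add: e2_def)
  have s1: "e2 * (\<delta> * \<Omega> + \<delta>\<^sup>2 * (cmod \<eta>)\<^sup>2) \<ge> e2 * (\<delta>\<^sup>2 * (c1 * (h ^ Suc m / G) * \<omega> - \<omega>))"
  proof (rule mult_left_mono)
    have "\<delta>\<^sup>2 * (c1 * (h ^ Suc m / G) * \<omega> - \<omega>) \<le> \<delta>\<^sup>2 * (\<Omega> + (cmod \<eta>)\<^sup>2)"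
      using k by (rule mult_left_mono) simp
    also have "\<dots> \<le> \<delta> * \<Omega> + \<delta>\<^sup>2 * (cmod \<eta>)\<^sup>2"
      using mult_right_mono[of "\<delta>\<^sup>2" \<delta> \<Omega>] \<delta> \<Omega>0 by (simp add: distrib_left power2_eq_square mult_left_le)
    finally show "\<delta>\<^sup>2 * (c1 * (h ^ Suc m / G) * \<omega> - \<omega>) \<le> \<delta> * \<Omega> + \<delta>\<^sup>2 * (cmod \<eta>)\<^sup>2" .
  qed (use e2 in simp)
  have s2: "e2 * \<omega> \<le> M * \<omega>" "e1 * \<omega> \<le> H * \<omega>" using H M \<omega>0 by (auto intro: mult_right_mono)
  have c: "curvature p (Suc (Suc m)) \<kappa> q \<delta> A z t = \<kappa> * \<omega> + A * (e1 * (- q * \<omega> + q\<^sup>2 * (cmod \<alpha>)\<^sup>2))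
      + A * (e2 * (\<delta> * (\<Omega> + (1 - (n + 1)) * \<omega>) + \<delta>\<^sup>2 * (cmod \<eta>)\<^sup>2))"
    unfolding curvature_def Let_def \<Omega> h_def[symmetric] G_def[symmetric]
    unfolding \<alpha>_def[symmetric] \<omega>_def[symmetric] e1_def[symmetric] e2_def[symmetric] \<eta>
    unfolding n ..
  have \<kappa>': "\<kappa> * \<omega> = A * (q * (H * \<omega>) + \<delta> * n * (M * \<omega>) + \<delta>\<^sup>2 * (M * \<omega>))"
    unfolding \<kappa> n by (simp add: algebra_simps)
  have t1: "q * (e1 * \<omega>) \<le> q * (H * \<omega>)" using s2 q by (intro mult_left_mono)
  have t2: "\<delta> * n * (e2 * \<omega>) \<le> \<delta> * n * (M * \<omega>)" using s2 \<delta> n0 by (intro mult_left_mono) auto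
  have t3: "\<delta>\<^sup>2 * (e2 * \<omega>) \<le> \<delta>\<^sup>2 * (M * \<omega>)" using s2 by (intro mult_left_mono) auto
  have "q\<^sup>2 * e1 * (cmod \<alpha>)\<^sup>2 + \<delta>\<^sup>2 * c1 * (e2 * (h ^ Suc m / G)) * \<omega>
     \<le> q * (H * \<omega>) + \<delta> * n * (M * \<omega>) + \<delta>\<^sup>2 * (M * \<omega>) - q * (e1 * \<omega>) + q\<^sup>2 * e1 * (cmod \<alpha>)\<^sup>2
       - \<delta> * n * (e2 * \<omega>) + e2 * (\<delta> * \<Omega> + \<delta>\<^sup>2 * (cmod \<eta>)\<^sup>2)"
    using t1 t2 t3 s1 by (simp add: algebra_simps)
  from mult_left_mono[OF this, of A] A
  show ?thesis unfolding c \<kappa>' \<alpha>_def[symmetric] \<omega>_def[symmetric] by (simp add: algebra_simps)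
qed

text \<open>
  Let \<open>X = Y powr (\<delta> - 1) * s\<^sup>2 + h powr (- q) * a\<^sup>2\<close>. The inequality of the arithmetic and geometric
  means bounds \<open>a * s\<close> and \<open>s\<^sup>2\<close> by multiples of \<open>X\<close>. The remaining negative power of \<open>Y\<close> is at most a power
  of \<open>h\<close>, because \<open>h powr (- d) \<le> Y\<close>, and the remaining positive one is bounded.
\<close>

lemma powr_estimate:
  fixes h0 h Y Ym J s a q \<delta> d :: real
  assumes h: "0 < h0" "h0 \<le> h" and Y: "0 < Y" "Y \<le> Ym" "h powr (-d) \<le> Y" and d: "d \<ge> 1"
    and pos: "J \<ge> 0" "s \<ge> 0" "a \<ge> 0" "q \<ge> 0" and \<delta>: "0 < \<delta>" "\<delta> \<le> 1/2"
    and J: "J * (sqrt Y * h powr ((d - 1) / 2)) \<le> 6 * d * h * (2 * a * s + s\<^sup>2)"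
  shows "J \<le> 6 * d * (1 + Ym powr (1/2 - \<delta>) * h0 powr (- (d * \<delta> + q) / 2))
     * (Y powr (\<delta> - 1) * s\<^sup>2 + h powr (- q) * a\<^sup>2) * h powr ((3 - d + d * \<delta> + q) / 2)"
proof -
  have h': "h > 0" using h by simp
  define P where "P = Y powr ((\<delta> - 1) / 2)"
  define R where "R = h powr (- q / 2)"
  have PR: "P > 0" "R > 0" using Y h' by (simp_all add: P_def R_def)
  have P2: "P\<^sup>2 = Y powr (\<delta> - 1)" and R2: "R\<^sup>2 = h powr (- q)"
    using Y h' by (simp_all add: P_def R_def power2_eq_square powr_add[symmetric])
  define X where "X = Y powr (\<delta> - 1) * s\<^sup>2 + h powr (- q) * a\<^sup>2"
  have X: "X = (P * s)\<^sup>2 + (R * a)\<^sup>2" by (simp add: X_def P2 R2 power_mult_distrib)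
  have X0: "X \<ge> 0" by (simp add: X)
  have "2 * (P * s) * (R * a) \<le> X" unfolding X using sum_squares_bound[of "P * s" "R * a"] by simp
  then have as: "2 * a * s \<le> X / (P * R)" using PR by (simp add: pos_le_divide_eq mult_ac)
  have "P\<^sup>2 * s\<^sup>2 \<le> X" unfolding X by (simp add: power_mult_distrib)
  then have ss: "s\<^sup>2 \<le> X / P\<^sup>2" using PR by (simp add: pos_le_divide_eq mult_ac)
  define K where "K = sqrt Y * h powr ((d - 1) / 2)"
  have K: "K > 0" using Y h' by (simp add: K_def)
  have sY: "sqrt Y = Y powr (1/2)" using Y by (simp add: powr_half_sqrt)
  have "J * K \<le> 6 * d * h * (X / (P * R) + X / P\<^sup>2)"
    using J as ss d h' unfolding K_def[symmetric] by (smt (verit) mult_left_mono mult_nonneg_nonneg)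
  then have "J \<le> 6 * d * h * (X / (P * R) + X / P\<^sup>2) / K" using K by (simp add: pos_le_divide_eq)
  also have "\<dots> = 6 * d * X * (h / h powr ((d - 1) / 2)) * (1 / (P * R * sqrt Y) + 1 / (P\<^sup>2 * sqrt Y))"
  proof -
    have "c * h * (X / u + X / v) / (S * T) = c * X * (h / T) * (1 / (u * S) + 1 / (v * S))" for c u v S T :: real
      by (simp only: divide_inverse inverse_mult_distrib distrib_left distrib_right mult_1_left mult_ac)
    then show ?thesis unfolding K_def .
  qed
  also have "h / h powr ((d - 1) / 2) = h powr ((3 - d) / 2)"
  proof -
    have "h / h powr ((d - 1) / 2) = h powr 1 / h powr ((d - 1) / 2)" using h' by simp
    also have "\<dots> = h powr (1 - (d - 1) / 2)" by (rule powr_diff[symmetric])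
    also have "1 - (d - 1) / 2 = (3 - d) / 2" by (simp add: field_simps)
    finally show ?thesis .
  qed
  also have "1 / (P * R * sqrt Y) + 1 / (P\<^sup>2 * sqrt Y) = Y powr (- \<delta> / 2) * h powr (q / 2) + Y powr (1/2 - \<delta>)"
  proof -
    have "1 / (P * R * sqrt Y) = 1 / (P * sqrt Y) * (1 / R)" by simp
    also have "1 / (P * sqrt Y) = Y powr (- \<delta> / 2)"
    proof -
      have "P * sqrt Y = Y powr (\<delta> / 2)" unfolding P_def sY powr_add[symmetric] by (rule arg_cong[where f = "(powr) Y"]) (simp add: field_simps)
      then show ?thesis by (simp add: powr_minus_divide)
    qed
    also have "1 / R = h powr (q / 2)" by (simp add: R_def powr_minus_divide)
    finally have 1: "1 / (P * R * sqrt Y) = Y powr (- \<delta> / 2) * h powr (q / 2)" .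
    have "P\<^sup>2 * sqrt Y = Y powr (\<delta> - 1/2)" unfolding P2 sY powr_add[symmetric] by (rule arg_cong[where f = "(powr) Y"]) simp
    then have "1 / (P\<^sup>2 * sqrt Y) = Y powr (- (\<delta> - 1/2))" by (simp only: powr_minus_divide)
    with 1 show ?thesis by simp
  qed
  also have "6 * d * X * h powr ((3 - d) / 2) * (Y powr (- \<delta> / 2) * h powr (q / 2) + Y powr (1/2 - \<delta>))
     \<le> 6 * d * X * h powr ((3 - d) / 2) * ((1 + Ym powr (1/2 - \<delta>) * h0 powr (- (d * \<delta> + q) / 2)) * h powr ((d * \<delta> + q) / 2))"
  proof (rule mult_left_mono)
    have "Y powr (- \<delta> / 2) \<le> (h powr (- d)) powr (- \<delta> / 2)"
      using Y h' \<delta> by (intro powr_mono2') auto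
    also have "\<dots> = h powr (d * \<delta> / 2)" by (simp add: powr_powr)
    finally have "Y powr (- \<delta> / 2) * h powr (q / 2) \<le> h powr (d * \<delta> / 2) * h powr (q / 2)"
      by (rule mult_right_mono) simp
    also have "\<dots> = h powr ((d * \<delta> + q) / 2)" by (simp add: powr_add[symmetric] add_divide_distrib)
    finally have 1: "Y powr (- \<delta> / 2) * h powr (q / 2) \<le> h powr ((d * \<delta> + q) / 2)" .
    have nn: "(d * \<delta> + q) / 2 \<ge> 0" using d \<delta> pos by simp
    have "Y powr (1/2 - \<delta>) \<le> Ym powr (1/2 - \<delta>)" using Y \<delta> by (intro powr_mono2) auto
    also have "\<dots> = Ym powr (1/2 - \<delta>) * (h0 powr (- (d * \<delta> + q) / 2) * h0 powr ((d * \<delta> + q) / 2))"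
      using h by (simp add: powr_add[symmetric] add_divide_distrib[symmetric])
    also have "\<dots> \<le> Ym powr (1/2 - \<delta>) * (h0 powr (- (d * \<delta> + q) / 2) * h powr ((d * \<delta> + q) / 2))"
      using h nn by (intro mult_left_mono powr_mono2) auto
    finally show "Y powr (- \<delta> / 2) * h powr (q / 2) + Y powr (1/2 - \<delta>)
        \<le> (1 + Ym powr (1/2 - \<delta>) * h0 powr (- (d * \<delta> + q) / 2)) * h powr ((d * \<delta> + q) / 2)"
      using 1 by (simp add: distrib_right)
  qed (use d X0 in simp)
  also have "\<dots> = 6 * d * (1 + Ym powr (1/2 - \<delta>) * h0 powr (- (d * \<delta> + q) / 2)) * X * (h powr ((3 - d) / 2) * h powr ((d * \<delta> + q) / 2))"
    by (simp only: mult_ac)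
  also have "h powr ((3 - d) / 2) * h powr ((d * \<delta> + q) / 2) = h powr ((3 - d + d * \<delta> + q) / 2)"
    by (simp add: powr_add[symmetric] add_divide_distrib[symmetric] add.assoc)
  finally show ?thesis unfolding X_def .
qed

text \<open>
  By homogeneity the second and third bounds need only be shown for unit vectors. The third then is
  the positivity of a continuous function on the compact set of pairs of orthogonal unit vectors.
\<close>

lemma form_bounds:
  assumes fp: "form (Suc (Suc m)) p"
    and nodal: "\<forall>z t. z \<noteq> 0 \<longrightarrow> gradv p z = 0 \<longrightarrow> hessv p z t = 0 \<longrightarrow> herm t z = 0 \<longrightarrow> t = 0"
  obtains h0 Ym c1 where "h0 > 0" "Ym > 0" "c1 > 0"
    "\<And>z. p z = 1 \<Longrightarrow> h0 \<le> (norm z)\<^sup>2"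
    "\<And>z. (norm (gradv p z))\<^sup>2 \<le> Ym * ((norm z)\<^sup>2) ^ Suc m"
    "\<And>z t. z \<noteq> 0 \<Longrightarrow> herm t z = 0 \<Longrightarrow> c1 * ((norm z)\<^sup>2) ^ Suc m * (norm t)\<^sup>2
        \<le> (norm z)\<^sup>2 * (norm (hessv p z t))\<^sup>2 + (norm (gradv p z))\<^sup>2 * (norm t)\<^sup>2"
proof -
  note pf = formD(1)[OF fp]
  have gcont: "continuous_on S (gradv p)" for S
    unfolding gradv_def by (intro continuous_on_vec_lambda polyfun_continuous polyfun_pd pf)
  have "continuous_on UNIV p" by (rule polyfun_continuous[OF pf])
  then have "isCont p 0" by (simp add: continuous_on_eq_continuous_at)
  then obtain e where e: "e > 0" "\<And>z. dist z 0 < e \<Longrightarrow> dist (p z) (p 0) < 1"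
    unfolding continuous_at_eps_delta by (metis zero_less_one)
  have h0: "e\<^sup>2 \<le> (norm z)\<^sup>2" if "p z = 1" for z
  proof (rule ccontr)
    assume "\<not> e\<^sup>2 \<le> (norm z)\<^sup>2"
    then have "norm z < e" using e(1) by (metis norm_ge_zero not_le power_mono less_imp_le)
    then show False using e(2)[of z] that form_at_0[OF fp] by simp
  qed
  have sc: "\<exists>u. norm u = 1 \<and> z = of_real (norm z) *s u" if "z \<noteq> 0" for z :: "complex ^ 3"
  proof (intro exI[of _ "of_real (inverse (norm z)) *s z"] conjI)
    show "norm (of_real (inverse (norm z)) *s z) = 1" using that unfolding norm_smult norm_of_real by simp
    have "of_real (norm z) * of_real (inverse (norm z)) = (1 :: complex)"
      using that by (simp flip: of_real_mult)
    then show "z = of_real (norm z) *s (of_real (inverse (norm z)) *s z)" by (simp add: vector_smult_assoc)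
  qed
  have "bounded (gradv p ` sphere 0 1)"
    by (intro compact_imp_bounded compact_continuous_image gcont compact_sphere)
  then obtain B where B: "B > 0" "\<And>u. norm u = 1 \<Longrightarrow> norm (gradv p u) \<le> B"
    unfolding bounded_pos by auto
  have Ym: "(norm (gradv p z))\<^sup>2 \<le> B\<^sup>2 * ((norm z)\<^sup>2) ^ Suc m" for z
  proof (cases "z = 0")
    case True
    have "gradv p (0 *s z) = 0" unfolding gradv_scale[OF fp] by (simp add: vec_eq_iff)
    with True show ?thesis by simp
  next
    case False
    then obtain u where u: "norm u = 1" "z = of_real (norm z) *s u" using sc by blast
    have "norm (gradv p z) = norm z ^ Suc m * norm (gradv p u)"
      by (subst u(2)) (simp only: gradv_scale[OF fp] norm_smult norm_power norm_of_real abs_norm_cancel)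
    also have "\<dots> \<le> norm z ^ Suc m * B" using B(2)[OF u(1)] by (intro mult_left_mono) auto
    finally have "(norm (gradv p z))\<^sup>2 \<le> (norm z ^ Suc m * B)\<^sup>2" by (rule power_mono) simp
    also have "\<dots> = B\<^sup>2 * ((norm z)\<^sup>2) ^ Suc m"
      by (simp add: power_mult_distrib power_mult[symmetric] mult.commute)
    finally show ?thesis .
  qed
  define S where "S = (sphere (0 :: complex ^ 3) 1 \<times> sphere (0 :: complex ^ 3) 1) \<inter> {x. herm (snd x) (fst x) = 0}"
  define \<Phi> where "\<Phi> = (\<lambda>x. (norm (hessv p (fst x) (snd x)))\<^sup>2 + (norm (gradv p (fst x)))\<^sup>2)"
  have "compact S" unfolding S_def
    by (intro compact_Int_closed compact_Times compact_sphere closed_Collect_eq)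
       (auto simp: herm_def intro!: continuous_intros)
  moreover have "continuous_on S \<Phi>"
  proof -
    have "continuous_on S (\<lambda>x. hessv p (fst x) (snd x))"
      unfolding hessv_def grad_def
      by (intro continuous_intros continuous_on_vec_lambda continuous_on_compose2[OF polyfun_continuous[of _ UNIV]] polyfun_pd pf) auto
    moreover have "continuous_on S (\<lambda>x. gradv p (fst x))"
      by (rule continuous_on_compose2[OF gcont[of UNIV]]) (auto intro!: continuous_intros)
    ultimately show ?thesis unfolding \<Phi>_def by (intro continuous_intros)
  qed
  ultimately have cs: "continuous_on S (\<lambda>x. complex_of_real (\<Phi> x))" "compact S" by (auto intro!: continuous_intros)
  have nz: "\<forall>x\<in>S. complex_of_real (\<Phi> x) \<noteq> 0"
  proof
    fix x assume x: "x \<in> S"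
    show "complex_of_real (\<Phi> x) \<noteq> 0"
    proof
      assume "complex_of_real (\<Phi> x) = 0"
      then have "\<Phi> x = 0" by (simp only: of_real_eq_0_iff)
      then have "hessv p (fst x) (snd x) = 0" "gradv p (fst x) = 0"
        by (simp_all add: \<Phi>_def add_nonneg_eq_0_iff)
      moreover have "fst x \<noteq> 0" "herm (snd x) (fst x) = 0" using x by (auto simp: S_def)
      ultimately have "snd x = 0" using nodal by blast
      then show False using x by (auto simp: S_def)
    qed
  qed
  obtain c1 where c1: "c1 > 0" "\<And>x. x \<in> S \<Longrightarrow> c1 \<le> cmod (complex_of_real (\<Phi> x))"
    using compact_lower_bound[OF cs(2,1) nz] by blast
  have est: "c1 * ((norm z)\<^sup>2) ^ Suc m * (norm t)\<^sup>2
        \<le> (norm z)\<^sup>2 * (norm (hessv p z t))\<^sup>2 + (norm (gradv p z))\<^sup>2 * (norm t)\<^sup>2"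
    if z: "z \<noteq> 0" and tz: "herm t z = 0" for z t
  proof (cases "t = 0")
    case True then show ?thesis by simp
  next
    case False
    obtain u where u: "norm u = 1" "z = of_real (norm z) *s u" using sc[OF z] by blast
    obtain w where w: "norm w = 1" "t = of_real (norm t) *s w" using sc[OF False] by blast
    have "herm t z = of_real (norm t) * of_real (norm z) * herm w u"
      by (subst u(2), subst w(2)) (simp add: herm_def sum_distrib_left mult_ac)
    then have "(u, w) \<in> S" using tz z False u w by (auto simp: S_def)
    from c1(2)[OF this] have c: "c1 \<le> (norm (hessv p u w))\<^sup>2 + (norm (gradv p u))\<^sup>2"
      unfolding \<Phi>_def fst_conv snd_conv norm_of_real by simp
    have g: "norm (gradv p z) = norm z ^ Suc m * norm (gradv p u)"
      by (subst u(2)) (simp only: gradv_scale[OF fp] norm_smult norm_power norm_of_real abs_norm_cancel)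
    have hh: "norm (hessv p z t) = norm z ^ m * norm t * norm (hessv p u w)"
      by (subst u(2), subst w(2)) (simp only: hessv_scale[OF fp] hessv_smult norm_smult norm_power norm_of_real abs_norm_cancel mult_ac)
    have "c1 * (((norm z)\<^sup>2) ^ Suc m * (norm t)\<^sup>2)
      \<le> ((norm (hessv p u w))\<^sup>2 + (norm (gradv p u))\<^sup>2) * (((norm z)\<^sup>2) ^ Suc m * (norm t)\<^sup>2)"
      by (rule mult_right_mono[OF c]) simp
    also have "\<dots> = (norm z)\<^sup>2 * (norm (hessv p z t))\<^sup>2 + (norm (gradv p z))\<^sup>2 * (norm t)\<^sup>2"
      unfolding g hh by (simp add: power_mult_distrib power2_eq_square algebra_simps)
    finally show ?thesis by (simp add: mult_ac)
  qed
  have "B\<^sup>2 > 0" "e\<^sup>2 > 0" using B e by simp_all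
  then show ?thesis using that[of "e\<^sup>2" "B\<^sup>2" c1] c1(1) h0 Ym est by blast
qed

text \<open>
  The contributions of the two directions to \<open>curvature_lower_bound\<close> add up to the quantity \<open>X\<close> of
  \<open>powr_estimate\<close>, which controls the determinant by \<open>jacobian_estimate\<close>.
\<close>

theorem curvature_estimate:
  fixes d :: nat
  assumes fp: "form d p" and d: "d \<ge> 4"
    and nodal: "\<forall>z t. z \<noteq> 0 \<longrightarrow> gradv p z = 0 \<longrightarrow> hessv p z t = 0 \<longrightarrow> herm t z = 0 \<longrightarrow> t = 0"
  obtains \<kappa> q \<delta> A c where "c > 0"
    "\<forall>f f1 f2. p f = 1 \<longrightarrow> grad p f f1 = 0 \<longrightarrow> grad p f f2 = 0 \<longrightarrow>
       c * (cmod (det3 f f1 f2) * exp (weight p d \<kappa> q \<delta> A f / 2))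
         \<le> curvature p d \<kappa> q \<delta> A f f1 + curvature p d \<kappa> q \<delta> A f f2"
proof -
  define m where "m = d - 2"
  have m: "d = Suc (Suc m)" using d by (simp add: m_def)
  note fp' = fp[unfolded m]
  obtain h0 Ym c1 where pos: "h0 > 0" "Ym > 0" "c1 > 0"
    and h0: "\<And>z. p z = 1 \<Longrightarrow> h0 \<le> (norm z)\<^sup>2"
    and Ym: "\<And>z. (norm (gradv p z))\<^sup>2 \<le> Ym * ((norm z)\<^sup>2) ^ Suc m"
    and c1: "\<And>z t. z \<noteq> 0 \<Longrightarrow> herm t z = 0 \<Longrightarrow> c1 * ((norm z)\<^sup>2) ^ Suc m * (norm t)\<^sup>2
        \<le> (norm z)\<^sup>2 * (norm (hessv p z t))\<^sup>2 + (norm (gradv p z))\<^sup>2 * (norm t)\<^sup>2"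
    using form_bounds[OF fp' nodal] by blast
  define n where "n = real d"
  have n: "n \<ge> 4" using d by (simp add: n_def)
  (* these values turn the exponent 3 - n + n \<delta> + q of powr_estimate into - \<kappa>; and \<kappa> > 0 because n \<ge> 4 *)
  define \<delta> where "\<delta> = 1 / (4 * n)"
  define q :: real where "q = 1 / 4"
  define \<kappa> where "\<kappa> = n - 7 / 2"
  have \<delta>: "0 < \<delta>" "\<delta> \<le> 1 / 2" "n * \<delta> = 1 / 4" using n by (auto simp: \<delta>_def field_simps)
  define H where "H = h0 powr (- q)"
  define M where "M = Ym powr \<delta>"
  define A where "A = \<kappa> / (q * H + \<delta> * (n - 1) * M + \<delta>\<^sup>2 * M)"
  have HM: "H > 0" "M > 0" using pos by (simp_all add: H_def M_def)
  have den: "q * H + \<delta> * (n - 1) * M + \<delta>\<^sup>2 * M > 0"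
    using HM \<delta> n by (intro add_pos_pos mult_pos_pos) (auto simp: q_def)
  have A: "A > 0" using den n by (simp add: A_def \<kappa>_def)
  have \<kappa>A: "\<kappa> = A * (q * H + \<delta> * (n - 1) * M + \<delta>\<^sup>2 * M)" using den by (simp add: A_def)
  define C where "C = 6 * n * (1 + Ym powr (1/2 - \<delta>) * h0 powr (- (n * \<delta> + q) / 2))"
  have C: "C > 0" unfolding C_def using n pos by (intro mult_pos_pos add_pos_nonneg) auto
  define c2 where "c2 = min (A * q\<^sup>2) (A * \<delta>\<^sup>2 * c1)"
  have c2: "c2 > 0" using A \<delta> pos by (simp add: c2_def q_def)
  define E where "E = exp (A * (H + M) / 2)"
  have E: "E > 0" by (simp add: E_def)
  show ?thesis
  proof (rule that[of "c2 / (C * E)" \<kappa> q \<delta> A], use c2 C E in simp, intro allI impI)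
    fix f f1 f2 assume f: "p f = 1" and f1: "grad p f f1 = 0" and f2: "grad p f f2 = 0"
    have f0: "f \<noteq> 0" using form_at_0[OF fp'] f by auto
    have gf: "(\<Sum>k\<in>UNIV. gradv p f $ k * f $ k) = of_nat d"
      using Euler[OF fp, of f] f by (simp add: grad_gradv)
    have g0: "gradv p f \<noteq> 0" using gf d by auto
    define h where "h = (norm f)\<^sup>2"
    define G where "G = (norm (gradv p f))\<^sup>2"
    have h: "h > 0" and G: "G > 0" using f0 g0 by (simp_all add: h_def G_def)
    have hh0: "h0 \<le> h" using h0[OF f] by (simp add: h_def)
    define Y where "Y = G / h ^ Suc m"
    have Y: "Y > 0" using h G by (simp add: Y_def)
    have YYm: "Y \<le> Ym" using Ym[of f] h by (simp add: Y_def h_def[symmetric] G_def[symmetric] pos_divide_le_eq)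
    have hpow: "h ^ Suc m = h powr (n - 1)" 
    proof -
      have "n - 1 = real (Suc m)" by (simp add: n_def m)
      then show ?thesis by (simp only: powr_realpow[OF h])
    qed
    define e1 where "e1 = exp (- q * ln h)"
    define e2 where "e2 = exp (\<delta> * (ln G + (1 - n) * ln h))"
    have e1: "e1 = h powr (- q)" using h by (simp add: e1_def powr_def)
    have e2: "e2 = Y powr \<delta>"
    proof -
      have "ln Y = ln G + (1 - n) * ln h"
        unfolding Y_def hpow using h G by (simp add: ln_div ln_powr algebra_simps)
      then show ?thesis using Y by (simp add: e2_def powr_def)
    qed
    have e1H: "e1 \<le> H" unfolding e1 H_def using hh0 pos by (intro powr_mono2') (auto simp: q_def)
    have e2M: "e2 \<le> M" unfolding e2 M_def using Y YYm \<delta> by (intro powr_mono2) auto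
    define a1 where "a1 = herm f1 f / of_real h" define a2 where "a2 = herm f2 f / of_real h"
    define a where "a = sqrt ((cmod a1)\<^sup>2 + (cmod a2)\<^sup>2)"
    define s where "s = sqrt (residual f1 f + residual f2 f)"
    have lower: "A * q\<^sup>2 * e1 * (cmod (herm t f / of_real h))\<^sup>2 + A * \<delta>\<^sup>2 * c1 * (e2 * (h ^ Suc m / G)) * residual t f
        \<le> curvature p d \<kappa> q \<delta> A f t" for t
      unfolding h_def G_def e1_def e2_def n_def m
      by (rule curvature_lower_bound[OF fp' f0 g0 c1[OF f0], where H = H and M = M])
         (use \<delta> A e1H e2M \<kappa>A in \<open>auto simp: q_def e1_def e2_def h_def G_def n_def m\<close>)
    define X where "X = Y powr (\<delta> - 1) * s\<^sup>2 + h powr (- q) * a\<^sup>2"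
    have YG: "e2 * (h ^ Suc m / G) = Y powr (\<delta> - 1)"
      unfolding e2 using Y h G by (simp add: powr_diff) (simp add: Y_def)
    have s2: "s\<^sup>2 = residual f1 f + residual f2 f" and a2': "a\<^sup>2 = (cmod a1)\<^sup>2 + (cmod a2)\<^sup>2"
      using residual_nonneg[OF f0] by (simp_all add: s_def a_def)
    have "c2 * X \<le> A * q\<^sup>2 * (h powr (- q) * a\<^sup>2) + A * \<delta>\<^sup>2 * c1 * (Y powr (\<delta> - 1) * s\<^sup>2)"
      unfolding X_def distrib_left c2_def
      by (subst add.commute, intro add_mono mult_right_mono) auto
    also have "\<dots> \<le> curvature p d \<kappa> q \<delta> A f f1 + curvature p d \<kappa> q \<delta> A f f2"
      using add_mono[OF lower[of f1] lower[of f2]]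
      unfolding YG e1 s2 a2' a1_def a2_def by (simp add: algebra_simps)
    finally have SX: "c2 * X \<le> curvature p d \<kappa> q \<delta> A f f1 + curvature p d \<kappa> q \<delta> A f f2" .
    define J where "J = cmod (det3 f f1 f2)"
    have "J * norm (gradv p f) \<le> 6 * d * (norm f)\<^sup>2 * (2 * a * s + s\<^sup>2)"
      using jacobian_estimate[OF f0 gf, of f1 f2] f1 f2
      by (simp add: grad_gradv J_def a_def s_def a1_def a2_def h_def)
    moreover have "norm (gradv p f) = sqrt Y * h powr ((n - 1) / 2)"
    proof -
      have "G = Y * h powr (n - 1)" unfolding hpow[symmetric] using h by (simp add: Y_def)
      then have "sqrt G = sqrt Y * sqrt (h powr (n - 1))" by (simp add: real_sqrt_mult)
      also have "sqrt (h powr (n - 1)) = h powr ((n - 1) / 2)"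
        using h by (simp add: powr_half_sqrt[symmetric] powr_powr)
      finally show ?thesis by (simp add: G_def)
    qed
    ultimately have J: "J * (sqrt Y * h powr ((n - 1) / 2)) \<le> 6 * n * h * (2 * a * s + s\<^sup>2)"
      by (simp add: n_def h_def)
    have hY: "h powr (- n) \<le> Y"
    proof -
      have "real d \<le> norm (gradv p f) * norm f"
        using Cauchy_Schwarz_bilinear[of "gradv p f" f] gf by simp
      then have "1 \<le> norm (gradv p f) * norm f" using d by linarith
      then have "1\<^sup>2 \<le> (norm (gradv p f) * norm f)\<^sup>2" by (rule power_mono) simp
      then have "1 \<le> G * h" by (simp add: G_def h_def power_mult_distrib)
      then have "1 / (h * h powr (n - 1)) \<le> G * h / (h * h powr (n - 1))"
        using h by (intro divide_right_mono) auto
      also have "\<dots> = Y" unfolding Y_def hpow using h by simp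
      also have "h * h powr (n - 1) = h powr n" using h by (simp add: powr_mult_base)
      finally show ?thesis by (simp add: powr_minus_divide)
    qed
    have JX: "J \<le> C * X * h powr (- \<kappa> / 2)"
    proof -
      have "J \<le> 6 * n * (1 + Ym powr (1/2 - \<delta>) * h0 powr (- (n * \<delta> + q) / 2))
         * (Y powr (\<delta> - 1) * s\<^sup>2 + h powr (- q) * a\<^sup>2) * h powr ((3 - n + n * \<delta> + q) / 2)"
        by (rule powr_estimate[OF pos(1) hh0 Y YYm hY _ _ _ _ _ \<delta>(1,2) J])
           (use n residual_nonneg[OF f0] in \<open>auto simp: J_def s_def a_def q_def\<close>)
      also have "3 - n + n * \<delta> + q = - \<kappa>" using \<delta>(3) by (simp add: \<kappa>_def q_def)
      finally show ?thesis by (simp add: C_def X_def)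
    qed
    have "exp (weight p d \<kappa> q \<delta> A f / 2) = h powr (\<kappa> / 2) * exp (A * (e1 + e2) / 2)"
      using h by (simp add: weight_def h_def[symmetric] G_def[symmetric] e1_def e2_def n_def[symmetric]
        powr_def exp_add[symmetric] add_divide_distrib algebra_simps)
    also have "\<dots> \<le> h powr (\<kappa> / 2) * E"
      unfolding E_def using e1H e2M A by (intro mult_left_mono) auto
    finally have "J * exp (weight p d \<kappa> q \<delta> A f / 2) \<le> (C * X * h powr (- \<kappa> / 2)) * (h powr (\<kappa> / 2) * E)"
      using JX C by (intro mult_mono) (auto simp: J_def X_def)
    also have "\<dots> = C * E * X" using h by (simp add: powr_minus_divide)
    finally have "c2 / (C * E) * (J * exp (weight p d \<kappa> q \<delta> A f / 2)) \<le> c2 / (C * E) * (C * E * X)"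
      using c2 C E by (intro mult_left_mono) auto
    also have "\<dots> = c2 * X" using C E by simp
    also note SX
    finally show "c2 / (C * E) * (cmod (det3 f f1 f2) * exp (weight p d \<kappa> q \<delta> A f / 2))
         \<le> curvature p d \<kappa> q \<delta> A f f1 + curvature p d \<kappa> q \<delta> A f f2" by (simp add: J_def)
  qed
qed

section \<open>Non-dominability in degree at least four\<close>

lemma det3_basis:
  assumes "det3 z a b \<noteq> 0"
  shows "t = (det3 t a b / det3 z a b) *s z + (det3 z t b / det3 z a b) *s a + (det3 z a t / det3 z a b) *s b"
proof -
  have "det3 z a b * t $ k = det3 t a b * z $ k + det3 z t b * a $ k + det3 z a t * b $ k" for k
    using exhaust_3[of k] by (auto simp: det3_def algebra_simps)
  then have "t $ k = (det3 t a b * z $ k + det3 z t b * a $ k + det3 z a t * b $ k) / det3 z a b" for k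
    using assms by (simp add: field_simps)
  then show ?thesis by (simp add: vec_eq_iff add_divide_distrib)
qed

text \<open>
  In the basis \<open>z, a, b\<close> of \<open>singular_point_is_node\<close>, the Hessian at \<open>z\<close> is that of the product of the
  last two coordinates, so its kernel is spanned by \<open>z\<close>.
\<close>

lemma hessian_nondegenerate:
  assumes sqf: "squarefree P" and hom: "homogeneous (Suc d) P" and nc: "normal_crossing (zero_locus P)"
    and z: "z \<noteq> 0" "gradv (poly3_eval P) z = 0" "hessv (poly3_eval P) z t = 0" "herm t z = 0"
  shows "t = 0"
proof -
  let ?p = "poly3_eval P"
  have fp: "form (Suc d) ?p" by (rule form_poly3_eval[OF hom])
  have g: "grad ?p z v = 0" for v by (simp add: grad_gradv z(2))
  obtain a b where ab: "det3 z a b \<noteq> 0" "hess ?p z a a = 0" "hess ?p z b b = 0" "hess ?p z a b \<noteq> 0"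
    using singular_point_is_node[OF sqf hom nc z(1) g] by blast
  obtain x y w where t: "t = x *s z + y *s a + w *s b" using det3_basis[OF ab(1)] by blast
  have h0: "hess ?p z t v = 0" for v
    by (simp add: hess_hessv[OF formD(1)[OF fp]] z(3))
  have hz: "hess ?p z z v = 0" for v by (simp add: Euler_hess[OF fp] g)
  have ba: "hess ?p z b a = hess ?p z a b" by (rule hess_commute[OF formD(1)[OF fp]])
  have "w * hess ?p z a b = 0" using h0[of a] by (simp add: t hess_add_left hess_scale_left hz ab ba)
  moreover have "y * hess ?p z a b = 0" using h0[of b] by (simp add: t hess_add_left hess_scale_left hz ab)
  ultimately have txz: "t = x *s z" using ab(4) t by simp
  then have "x * of_real ((norm z)\<^sup>2) = 0" using z(4) by (simp only: herm_smult herm_self)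
  then have "x = 0" using z(1) by simp
  with txz show ?thesis by simp
qed

text \<open>
  The normalization leaves a root of unity as the only freedom, see \<open>unit_lift_unique\<close>. Quantities
  that are invariant under unit scalars thereby become functions on \<open>\<complex>\<^sup>2\<close>.
\<close>

definition unit_lift :: "(complex ^ 3 \<Rightarrow> complex) \<Rightarrow> (complex ^ 2 \<Rightarrow> complex ^ 3) \<Rightarrow> (complex ^ 2 \<Rightarrow> P2) \<Rightarrow> (complex ^ 2) set \<Rightarrow> bool" where
  "unit_lift p f F N \<longleftrightarrow> lifts f F N \<and> (\<forall>x\<in>N. p (f x) = 1)"

text \<open>
  A lift given by an affine chart is divided by a \<open>d\<close>-th root of the value of the form. The root has
  a holomorphic branch where that value, divided by the value at \<open>w\<close>, has positive real part.
\<close>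

lemma ex_unit_lift:
  assumes hol: "holomorphic_into_P2 F UNIV" and omit: "range F \<subseteq> - zero_locus P"
    and fp: "form d (poly3_eval P)" and d: "d > 0"
  obtains f N where "unit_lift (poly3_eval P) f F N" "w \<in> N"
proof -
  let ?p = "poly3_eval P"
  obtain i where i: "F w \<in> affine_dom i" by (rule ex_affine_dom)
  define g where "g = (\<lambda>w. homog i (affine_chart i (F w)))"
  define N0 where "N0 = {w \<in> UNIV. F w \<in> affine_dom i}"
  have lg: "lifts g F N0" unfolding g_def N0_def by (rule chart_lift[OF hol])
  have w0: "w \<in> N0" using i by (simp add: N0_def)
  have N0: "open N0" "\<And>x. x \<in> N0 \<Longrightarrow> vcdiff g x" "\<And>x. x \<in> N0 \<Longrightarrow> g x \<noteq> 0" "\<And>x. x \<in> N0 \<Longrightarrow> proj (g x) = F x"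
    using lg by (auto simp: lifts_def)
  have nz: "?p (g x) \<noteq> 0" if "x \<in> N0" for x
  proof
    assume "?p (g x) = 0"
    then have "F x \<in> zero_locus P" unfolding zero_locus_def using N0(3,4)[OF that] by force
    with omit show False by blast
  qed
  define c where "c = ?p (g w)"
  have c: "c \<noteq> 0" using nz[OF w0] by (simp add: c_def)
  define u where "u = (\<lambda>x. ?p (g x) / c)"
  have ud: "cdiff u x" if "x \<in> N0" for x
    unfolding u_def using c by (intro cdiff_divide cdiff_const cdiff_polyfun formD(1)[OF fp] N0(2)[OF that])
  define N where "N = {x \<in> N0. Re (u x) > 0}"
  have "continuous_on N0 u" using ud cdiff_continuous_on by blast
  then have "open (N0 \<inter> (u -` {z. Re z > 0}))"
    using N0(1) by (intro continuous_open_preimage open_halfspace_Re_gt)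
  moreover have "N0 \<inter> (u -` {z. Re z > 0}) = N" by (auto simp: N_def)
  ultimately have oN: "open N" by simp
  define k where "k = exp (Ln (inverse c) / of_nat d)"
  have k: "k ^ d = inverse c" "k \<noteq> 0"
    using d c by (simp_all add: k_def exp_of_nat_mult[symmetric])
  define \<phi> where "\<phi> = (\<lambda>x. k * exp ((- 1 / of_nat d) * Ln (u x)))"
  have \<phi>d: "cdiff \<phi> x" if "x \<in> N" for x
  proof -
    have "u x \<notin> \<real>\<^sub>\<le>\<^sub>0" using that by (auto simp: N_def complex_nonpos_Reals_iff)
    then have "cdiff (\<lambda>x. Ln (u x)) x"
      using that by (intro cdiff_compose[OF ud has_field_derivative_Ln]) (auto simp: N_def)
    then show ?thesis unfolding \<phi>_def by (intro cdiff_cmult cdiff_exp)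
  qed
  have \<phi>0: "\<phi> x \<noteq> 0" for x using k by (simp add: \<phi>_def)
  have \<phi>pow: "\<phi> x ^ d * ?p (g x) = 1" if "x \<in> N" for x
  proof -
    have u0: "u x \<noteq> 0" using that by (auto simp: N_def)
    have "exp ((- 1 / of_nat d) * Ln (u x)) ^ d = exp (- Ln (u x))"
      using d by (simp add: exp_of_nat_mult[symmetric])
    then have "\<phi> x ^ d = inverse c * inverse (u x)"
      using u0 k by (simp add: \<phi>_def power_mult_distrib exp_minus)
    then show ?thesis using u0 c nz[of x] that by (simp add: u_def N_def)
  qed
  show ?thesis
  proof (rule that)
    show "unit_lift ?p (\<lambda>x. \<phi> x *s g x) F N"
      unfolding unit_lift_def lifts_def
      using oN \<phi>d \<phi>0 \<phi>pow N0 formD(2)[OF fp]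
      by (auto simp: proj_scale N_def intro!: vcdiff_smult)
    show "w \<in> N" using w0 c by (simp add: N_def u_def c_def)
  qed
qed

lemma weight_unit_scalar:
  assumes fp: "form (Suc m) p" and "cmod c = 1"
  shows "weight p d \<kappa> q \<delta> A (c *s z) = weight p d \<kappa> q \<delta> A z"
  using assms(2) by (simp add: weight_def norm_smult gradv_scale[OF fp] norm_power)

text \<open>
  The quotient of two such lifts is a holomorphic function whose values are roots of unity, and
  both quantities depend on the absolute value of a scalar factor only.
\<close>

lemma unit_lift_unique:
  assumes fp: "form (Suc m) p" and f: "unit_lift p f F N" "x \<in> N" and g: "unit_lift p g F M" "x \<in> M"
  shows "cmod (wronski f x) = cmod (wronski g x)" "weight p d \<kappa> q \<delta> A (f x) = weight p d \<kappa> q \<delta> A (g x)"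
proof -
  have fN: "open N" "\<And>y. y \<in> N \<Longrightarrow> vcdiff f y" "\<And>y. y \<in> N \<Longrightarrow> f y \<noteq> 0" "\<And>y. y \<in> N \<Longrightarrow> proj (f y) = F y" "\<And>y. y \<in> N \<Longrightarrow> p (f y) = 1"
    and gM: "open M" "\<And>y. y \<in> M \<Longrightarrow> vcdiff g y" "\<And>y. y \<in> M \<Longrightarrow> g y \<noteq> 0" "\<And>y. y \<in> M \<Longrightarrow> proj (g y) = F y" "\<And>y. y \<in> M \<Longrightarrow> p (g y) = 1"
    using f g by (auto simp: unit_lift_def lifts_def)
  have rel: "\<exists>c. c \<noteq> 0 \<and> g y = c *s f y" if "y \<in> N" "y \<in> M" for y
    using proj_eq_iff[OF fN(3)[OF that(1)] gM(3)[OF that(2)]] fN(4)[OF that(1)] gM(4)[OF that(2)] by auto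
  obtain k where k: "f x $ k \<noteq> 0" using fN(3)[OF f(2)] by (auto simp: vec_eq_iff)
  define \<phi> where "\<phi> = (\<lambda>y. g y $ k / f y $ k)"
  have fk: "cdiff (\<lambda>y. f y $ k) y" if "y \<in> N" for y using fN(2)[OF that] by (simp add: vcdiff_def)
  have gk: "cdiff (\<lambda>y. g y $ k) y" if "y \<in> M" for y using gM(2)[OF that] by (simp add: vcdiff_def)
  have \<phi>d: "cdiff \<phi> x" unfolding \<phi>_def by (intro cdiff_divide gk fk f(2) g(2) k)
  have geq: "g y = \<phi> y *s f y" if "y \<in> N" "y \<in> M" "f y $ k \<noteq> 0" for y
    using rel[OF that(1,2)] that(3) by (auto simp: \<phi>_def)
  have "((\<lambda>y. f y $ k) \<longlongrightarrow> f x $ k) (at x)" using cdiff_continuous[OF fk[OF f(2)]] by (simp add: isCont_def)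
  then have "\<forall>\<^sub>F y in nhds x. f y $ k \<noteq> 0"
    using tendsto_imp_eventually_ne[of "\<lambda>y. f y $ k" "f x $ k" "at x" 0] k by (simp add: eventually_nhds_conv_at)
  moreover have "\<forall>\<^sub>F y in nhds x. y \<in> N" "\<forall>\<^sub>F y in nhds x. y \<in> M"
    using eventually_nhds_in_open fN(1) gM(1) f(2) g(2) by blast+
  ultimately have ev: "\<forall>\<^sub>F y in nhds x. g y = \<phi> y *s f y" by eventually_elim (rule geq)
  have "\<phi> x ^ Suc m = 1"
    using formD(2)[OF fp, of "\<phi> x" "f x"] geq[OF f(2) g(2) k] fN(5)[OF f(2)] gM(5)[OF g(2)] by simp
  then have "cmod (\<phi> x) ^ Suc m = 1" by (metis norm_power norm_one)
  then have n1: "cmod (\<phi> x) = 1"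
    using power_eq_iff_eq_base[of "Suc m" "cmod (\<phi> x)" 1] by simp
  have "wronski g x = \<phi> x ^ 3 * wronski f x"
    using wronski_cong[OF ev gM(2)[OF g(2)]] wronski_smult[OF \<phi>d fN(2)[OF f(2)]] by simp
  then show "cmod (wronski f x) = cmod (wronski g x)" by (simp add: norm_mult norm_power n1)
  show "weight p d \<kappa> q \<delta> A (f x) = weight p d \<kappa> q \<delta> A (g x)"
    unfolding geq[OF f(2) g(2) k] using weight_unit_scalar[OF fp n1] by simp
qed

lemma jet_analytic:
  assumes "f analytic_on {0}" "(f has_field_derivative b) (at 0)"
  obtains c where "jet f (f 0) b c"
proof -
  obtain S where "open S" "0 \<in> S" "f holomorphic_on S" using assms(1) analytic_at by blast
  then show ?thesis using jet_holomorphic[OF _ _ _ assms(2)] that by blast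
qed

lemma cdiff_slice_analytic:
  assumes "open N" "\<And>w. w \<in> N \<Longrightarrow> cdiff f w" "x \<in> N"
  shows "(\<lambda>\<zeta>. f (x + \<zeta> *s u)) analytic_on {0}"
proof -
  define S where "S = (\<lambda>\<zeta>. x + \<zeta> *s u) -` N"
  have "open S" unfolding S_def by (rule open_vimage[OF assms(1)]) (intro continuous_intros)
  moreover have "(\<lambda>\<zeta>. f (x + \<zeta> *s u)) holomorphic_on S"
    unfolding holomorphic_on_def field_differentiable_def
  proof
    fix \<zeta> assume "\<zeta> \<in> S"
    then have "((\<lambda>\<zeta>. f (x + \<zeta> *s u)) has_field_derivative grad f (x + \<zeta> *s u) u) (at \<zeta>)"
      by (intro cdiff_slice assms(2)) (simp add: S_def)
    then show "\<exists>D. ((\<lambda>\<zeta>. f (x + \<zeta> *s u)) has_field_derivative D) (at \<zeta> within S)"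
      using has_field_derivative_at_within by blast
  qed
  moreover have "0 \<in> S" using assms(3) by (simp add: S_def)
  ultimately show ?thesis using analytic_at by blast
qed

lemma wronski_slice_analytic:
  assumes N: "open N" "\<And>w. w \<in> N \<Longrightarrow> vcdiff f w" and x: "x \<in> N"
  shows "(\<lambda>\<zeta>. wronski f (x + \<zeta> *s u)) analytic_on {0}"
proof -
  have fk: "\<And>w. w \<in> N \<Longrightarrow> cdiff (\<lambda>w. f w $ k) w" for k using N(2) by (simp add: vcdiff_def)
  have a: "(\<lambda>\<zeta>. f (x + \<zeta> *s u) $ k) analytic_on {0}" for k
    by (rule cdiff_slice_analytic[OF N(1) fk x])
  have b: "(\<lambda>\<zeta>. grad (\<lambda>w. f w $ k) (x + \<zeta> *s u) v) analytic_on {0}" for k v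
  proof -
    obtain e where "e > 0" "(\<lambda>\<zeta>. grad (\<lambda>w. f w $ k) (x + \<zeta> *s u) v) holomorphic_on ball 0 e"
      using grad_slice_holomorphic[OF N(1) fk x] by blast
    then show ?thesis unfolding analytic_at by (intro exI[of _ "ball 0 e"]) auto
  qed
  show ?thesis unfolding wronski_def det3_def vgrad_def vec_lambda_beta
    by (intro analytic_intros a b)
qed

lemma vcdiff_slice_jet:
  assumes N: "open N" "\<And>w. w \<in> N \<Longrightarrow> vcdiff f w" and x: "x \<in> N"
  obtains c where "\<forall>k. jet (\<lambda>\<zeta>. f (x + \<zeta> *s u) $ k) (f x $ k) (vgrad f x u $ k) (c $ k)"
proof -
  have fk: "\<And>w. w \<in> N \<Longrightarrow> cdiff (\<lambda>w. f w $ k) w" for k using N(2) by (simp add: vcdiff_def)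
  have "\<exists>c. jet (\<lambda>\<zeta>. f (x + \<zeta> *s u) $ k) (f x $ k) (vgrad f x u $ k) c" for k
  proof -
    have "((\<lambda>\<zeta>. f (x + \<zeta> *s u) $ k) has_field_derivative grad (\<lambda>w. f w $ k) (x + 0 *s u) u) (at 0)"
      by (rule cdiff_slice) (use fk x in simp)
    then have "((\<lambda>\<zeta>. f (x + \<zeta> *s u) $ k) has_field_derivative vgrad f x u $ k) (at 0)"
      by (simp add: vgrad_def)
    from jet_analytic[OF cdiff_slice_analytic[OF N(1) fk x] this] show ?thesis by auto
  qed
  then obtain c' where c': "\<And>k. jet (\<lambda>\<zeta>. f (x + \<zeta> *s u) $ k) (f x $ k) (vgrad f x u $ k) (c' k)" by metis
  show ?thesis by (rule that[of "\<chi> k. c' k"]) (simp add: c')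
qed

lemma levi_ball_potential:
  fixes x w :: "complex ^ 2"
  assumes "norm (x - w) < R"
  defines "T \<equiv> R\<^sup>2 - (norm (x - w))\<^sup>2"
  obtains \<alpha> where "levi (\<lambda>\<zeta>. ln (R\<^sup>2 - (norm (x + \<zeta> *s axis i 1 - w))\<^sup>2)) (ln T) \<alpha> (- 1 / T - (cmod ((x - w) $ i))\<^sup>2 / T\<^sup>2)"
proof -
  have R: "R > 0" using assms(1) norm_ge_zero[of "x - w"] by linarith
  have T: "T > 0" unfolding T_def using assms(1) R by (simp add: power_strict_mono)
  have j: "jet (\<lambda>\<zeta>. (x + \<zeta> *s axis i 1 - w) $ k) ((x - w) $ k) (axis i 1 $ k) 0" for k
  proof -
    have "(((x + \<zeta> *s axis i 1 - w) $ k - (x - w) $ k - axis i 1 $ k * \<zeta>) / \<zeta>\<^sup>2) = 0" for \<zeta>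
      by (simp add: algebra_simps)
    then show ?thesis unfolding jet_def by (simp only:) simp
  qed
  have "levi (\<lambda>\<zeta>. \<Sum>k\<in>UNIV. (cmod ((x + \<zeta> *s axis i 1 - w) $ k))\<^sup>2) (\<Sum>k\<in>UNIV. (cmod ((x - w) $ k))\<^sup>2)
      (\<Sum>k\<in>UNIV. cnj ((x - w) $ k) * axis i 1 $ k) (\<Sum>k\<in>UNIV. (cmod (axis i 1 $ k))\<^sup>2)"
    by (rule levi_sum) (rule finite, rule levi_norm_square[OF j])
  moreover have "(\<Sum>k\<in>UNIV. cnj ((x - w) $ k) * axis i 1 $ k) = cnj ((x - w) $ i)"
    by (simp add: axis_def if_distrib cong: if_cong)
  moreover have "(\<Sum>k\<in>UNIV. (cmod ((axis i 1 :: complex ^ 2) $ k))\<^sup>2) = 1"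
    unfolding norm_square_vec[symmetric] by simp
  ultimately have "levi (\<lambda>\<zeta>. (norm (x + \<zeta> *s axis i 1 - w))\<^sup>2) ((norm (x - w))\<^sup>2) (cnj ((x - w) $ i)) 1"
    by (simp only: norm_square_vec)
  from levi_add[OF levi_const levi_cmult[OF this, of "-1"], of "R\<^sup>2"]
  have "levi (\<lambda>\<zeta>. R\<^sup>2 - (norm (x + \<zeta> *s axis i 1 - w))\<^sup>2) T (- cnj ((x - w) $ i)) (- 1)"
    by (simp add: T_def)
  from levi_ln[OF this T] have "levi (\<lambda>\<zeta>. ln (R\<^sup>2 - (norm (x + \<zeta> *s axis i 1 - w))\<^sup>2)) (ln T)
     (- cnj ((x - w) $ i) / of_real T) (- 1 / T - (cmod (- cnj ((x - w) $ i)) / T)\<^sup>2)" .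
  then show ?thesis unfolding norm_minus_cancel complex_mod_cnj power_divide by (rule that)
qed

text \<open>
  This is Ahlfors' method. By \<open>unit_lift_unique\<close> the density \<open>v\<close> is a function on all of \<open>\<complex>\<^sup>2\<close>, and it is
  positive where the Jacobian is not zero. Let \<open>T = R\<^sup>2 - (norm (x - w))\<^sup>2\<close> on the ball of radius \<open>R\<close>
  about \<open>w\<close>, and let \<open>x\<close> be a maximum of \<open>v * T ^ 4\<close>. There the Levi form of \<open>ln v + 4 * ln T\<close> is not
  positive in either coordinate direction. The logarithm of \<open>wronski\<close> contributes nothing, that of \<open>T\<close>
  at most \<open>8 * R\<^sup>2 / T\<^sup>2\<close> in total, and \<open>curvature_estimate\<close> turns this into \<open>c * sqrt v \<le> 8 * R\<^sup>2 / T\<^sup>2\<close>.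
  Comparison with the centre gives \<open>v w \<le> 64 / (c\<^sup>2 * R ^ 4)\<close> for every \<open>R\<close>.
\<close>

theorem not_dominable_of_degree_ge_4:
  assumes sqf: "squarefree P" and hom: "homogeneous d P" and nc: "normal_crossing (zero_locus P)" and d: "d \<ge> 4"
  shows "\<not> dominable_by_C2 (- zero_locus P)"
proof
  assume "dominable_by_C2 (- zero_locus P)"
  then obtain F w i A where hol: "holomorphic_into_P2 F UNIV" and omit: "range F \<subseteq> - zero_locus P"
    and w: "F w \<in> affine_dom i" "has_jacobian (affine_chart i \<circ> F) A w" "det A \<noteq> 0"
    unfolding dominable_by_C2_def by blast
  define p where "p = poly3_eval P"
  have fp: "form d p" unfolding p_def by (rule form_poly3_eval[OF hom])
  define m where "m = d - 1"
  have m: "d = Suc m" using d by (simp add: m_def)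
  have fpm: "form (Suc m) p" using fp m by simp
  note pf = formD(1)[OF fp]
  have nodal: "\<forall>z t. z \<noteq> 0 \<longrightarrow> gradv p z = 0 \<longrightarrow> hessv p z t = 0 \<longrightarrow> herm t z = 0 \<longrightarrow> t = 0"
    unfolding p_def using hessian_nondegenerate[OF sqf hom[unfolded m] nc] by blast
  obtain \<kappa> q \<delta> B c where c: "c > 0"
    and est: "\<forall>f f1 f2. p f = 1 \<longrightarrow> grad p f f1 = 0 \<longrightarrow> grad p f f2 = 0 \<longrightarrow>
       c * (cmod (det3 f f1 f2) * exp (weight p d \<kappa> q \<delta> B f / 2))
         \<le> curvature p d \<kappa> q \<delta> B f f1 + curvature p d \<kappa> q \<delta> B f f2"
    by (rule curvature_estimate[OF fp d nodal]) (rule that)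
  define V where "V = (\<lambda>f x. (cmod (wronski f x))\<^sup>2 * exp (weight p d \<kappa> q \<delta> B (f x)))"
  have ex: "\<exists>f N. unit_lift p f F N \<and> x \<in> N" for x
    using ex_unit_lift[OF hol omit, of d x] fp d unfolding p_def by (metis gr_zeroI not_numeral_le_zero)
  have Vuniq: "V f x = V g x" if "unit_lift p f F N" "x \<in> N" "unit_lift p g F M" "x \<in> M" for f g N M x
    unfolding V_def using unit_lift_unique[OF fpm that] by simp
  define v where "v = (\<lambda>x. SOME y. \<exists>f N. unit_lift p f F N \<and> x \<in> N \<and> y = V f x)"
  have vV: "v x = V f x" if "unit_lift p f F N" "x \<in> N" for f N x
  proof -
    have "\<exists>f N. unit_lift p f F N \<and> x \<in> N \<and> v x = V f x"
      unfolding v_def by (rule someI_ex) (use that in blast)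
    then show ?thesis using Vuniq that by metis
  qed
  have lift_facts: "open N" "\<And>x. x \<in> N \<Longrightarrow> vcdiff f x" "\<And>x. x \<in> N \<Longrightarrow> f x \<noteq> 0" "\<And>x. x \<in> N \<Longrightarrow> p (f x) = 1"
    "\<And>x. x \<in> N \<Longrightarrow> proj (f x) = F x" "\<And>x. x \<in> N \<Longrightarrow> gradv p (f x) \<noteq> 0"
    if "unit_lift p f F N" for f N
  proof -
    show "open N" "\<And>x. x \<in> N \<Longrightarrow> vcdiff f x" "\<And>x. x \<in> N \<Longrightarrow> f x \<noteq> 0" "\<And>x. x \<in> N \<Longrightarrow> p (f x) = 1"
      "\<And>x. x \<in> N \<Longrightarrow> proj (f x) = F x"
      using that by (auto simp: unit_lift_def lifts_def)
    show "gradv p (f x) \<noteq> 0" if "x \<in> N" for x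
    proof
      assume "gradv p (f x) = 0"
      then have "grad p (f x) (f x) = 0" by (simp add: grad_gradv)
      then have "of_nat d * p (f x) = 0" using Euler[OF fp] by simp
      then show False using \<open>\<And>x. x \<in> N \<Longrightarrow> p (f x) = 1\<close>[OF that] d by simp
    qed
  qed
  have contv: "isCont v x" for x
  proof -
    obtain f N where f: "unit_lift p f F N" "x \<in> N" using ex by blast
    note lf = lift_facts[OF f(1)]
    have fk: "\<And>w. w \<in> N \<Longrightarrow> cdiff (\<lambda>w. f w $ k) w" for k using lf(2) by (simp add: vcdiff_def)
    have cf: "continuous_on N f"
      by (intro continuous_at_imp_continuous_on ballI vcdiff_continuous lf(2))
    have cfk: "continuous_on N (\<lambda>w. f w $ k)" for k by (intro continuous_intros cf)
    have cgk: "continuous_on N (\<lambda>w. grad (\<lambda>w. f w $ k) w u)" for k u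
      by (rule grad_continuous_on[OF lf(1) fk])
    have cW: "continuous_on N (wronski f)"
      unfolding wronski_def[abs_def] det3_def vgrad_def vec_lambda_beta by (intro continuous_intros cfk cgk)
    have cg: "continuous_on N (\<lambda>x. gradv p (f x))"
      unfolding gradv_def
      by (intro continuous_on_vec_lambda continuous_on_compose2[OF polyfun_continuous[OF polyfun_pd[OF pf], of UNIV] cf]) auto
    have "continuous_on N (V f)"
      unfolding V_def weight_def by (intro continuous_intros cW cf cg) (use lf in auto)
    then have "continuous_on N v" by (rule continuous_on_eq) (simp add: vV[OF f(1)])
    then show ?thesis using lf(1) f(2) by (simp add: continuous_on_eq_continuous_at)
  qed
  have vw: "v w > 0"
  proof -
    obtain f N where f: "unit_lift p f F N" "w \<in> N" using ex by blast
    note lf = lift_facts[OF f(1)]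
    have fi: "f w $ i \<noteq> 0" using w(1) lf(3,5)[OF f(2)] in_affine_dom_proj by metis
    have "\<forall>\<^sub>F x in nhds w. x \<in> N" using eventually_nhds_in_open lf(1) f(2) by blast
    then have ev: "\<forall>\<^sub>F x in nhds w. f x \<noteq> 0 \<and> F x = proj (f x)"
      by (rule eventually_mono) (use lf in auto)
    obtain A' where A': "has_jacobian (affine_chart i \<circ> F) A' w"
      "wronski f w = (f w $ i) ^ 3 * det A' \<or> wronski f w = - ((f w $ i) ^ 3 * det A')"
      using lift_chart_jacobian[OF lf(2)[OF f(2)] lf(3)[OF f(2)] fi ev] by blast
    have "A' = A" using has_jacobian_entry[OF A'(1)] has_jacobian_entry[OF w(2)] by (simp add: vec_eq_iff)
    then have "wronski f w \<noteq> 0" using A'(2) w(3) fi by auto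
    then show ?thesis unfolding vV[OF f] V_def by simp
  qed
  have bound: "v w * R ^ 4 \<le> 64 / c\<^sup>2" if R: "R > 0" for R
  proof -
    define T where "T = (\<lambda>x. R\<^sup>2 - (norm (x - w))\<^sup>2)"
    (* v T^4 is the square of sqrt v T^2, which the curvature estimate bounds at the maximum *)
    have "continuous_on (cball w R) (\<lambda>x. v x * T x ^ 4)"
      unfolding T_def by (intro continuous_intros continuous_at_imp_continuous_on ballI contv)
    moreover have "cball w R \<noteq> {}" using R by simp
    ultimately have "\<exists>x\<in>cball w R. \<forall>y\<in>cball w R. v y * T y ^ 4 \<le> v x * T x ^ 4"
      by (intro continuous_attains_sup compact_cball)
    then obtain x where x: "x \<in> cball w R" and max: "\<And>y. y \<in> cball w R \<Longrightarrow> v y * T y ^ 4 \<le> v x * T x ^ 4"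
      by blast
    have Tw: "T w = R\<^sup>2" by (simp add: T_def)
    have le: "v w * (R\<^sup>2) ^ 4 \<le> v x * T x ^ 4" using max[of w] R by (simp add: Tw)
    then have "v x * T x ^ 4 > 0" using vw R by (smt (verit) mult_pos_pos zero_less_power)
    then have Tx0: "T x \<noteq> 0" and vx0: "v x \<noteq> 0" by auto
    have "norm (x - w) \<le> R" using x by (simp add: dist_norm norm_minus_commute)
    moreover have "norm (x - w) \<noteq> R" using Tx0 by (auto simp: T_def)
    ultimately have xR: "norm (x - w) < R" by simp
    then have Tx: "T x > 0" unfolding T_def using R by (simp add: power_strict_mono)
    obtain f N where f: "unit_lift p f F N" "x \<in> N" using ex by blast
    note lf = lift_facts[OF f(1)]
    have W0: "wronski f x \<noteq> 0" using vx0 unfolding vV[OF f] V_def by auto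
    have vx: "v x > 0" using W0 unfolding vV[OF f] V_def by simp
    define \<psi> where "\<psi> = (\<lambda>y. ln ((cmod (wronski f y))\<^sup>2) + weight p d \<kappa> q \<delta> B (f y) + 4 * ln (T y))"
    define e where "e = (\<lambda>k. vgrad f x (axis k 1))"
    have curv: "curvature p d \<kappa> q \<delta> B (f x) (e k) + 4 * (- 1 / T x - (cmod ((x - w) $ k))\<^sup>2 / (T x)\<^sup>2) \<le> 0" for k
    proof -
      let ?l = "\<lambda>\<zeta>. x + \<zeta> *s axis k 1"
      have "(\<lambda>\<zeta>. wronski f (?l \<zeta>)) analytic_on {0}" by (rule wronski_slice_analytic[OF lf(1,2) f(2)])
      moreover from this have "((\<lambda>\<zeta>. wronski f (?l \<zeta>)) has_field_derivative deriv (\<lambda>\<zeta>. wronski f (?l \<zeta>)) 0) (at 0)"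
        using analytic_at holomorphic_derivI by blast
      ultimately obtain c1 where j1: "jet (\<lambda>\<zeta>. wronski f (?l \<zeta>)) (wronski f (?l 0)) (deriv (\<lambda>\<zeta>. wronski f (?l \<zeta>)) 0) c1"
        using jet_analytic by blast
      obtain \<alpha>1 where l1: "levi (\<lambda>\<zeta>. ln ((cmod (wronski f (?l \<zeta>)))\<^sup>2)) (ln ((cmod (wronski f (?l 0)))\<^sup>2)) \<alpha>1 0"
        by (rule levi_log_holomorphic[OF j1]) (use W0 in simp)
      obtain c2 where "\<forall>j. jet (\<lambda>\<zeta>. f (?l \<zeta>) $ j) (f x $ j) (vgrad f x (axis k 1) $ j) (c2 $ j)"
        by (rule vcdiff_slice_jet[OF lf(1,2) f(2), of "axis k 1"], assumption, rule that)
      then have j2: "\<forall>j. jet (\<lambda>\<zeta>. f (?l \<zeta>) $ j) (f x $ j) (e k $ j) (c2 $ j)" unfolding e_def .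
      obtain \<alpha>2 where l2: "levi (\<lambda>\<zeta>. weight p d \<kappa> q \<delta> B (f (?l \<zeta>))) (weight p d \<kappa> q \<delta> B (f x)) \<alpha>2 (curvature p d \<kappa> q \<delta> B (f x) (e k))"
        by (rule levi_weight[OF pf j2[rule_format] lf(3)[OF f(2)] lf(6)[OF f(2)]]) (rule that)
      obtain \<alpha>3 where l3: "levi (\<lambda>\<zeta>. ln (T (?l \<zeta>))) (ln (T x)) \<alpha>3 (- 1 / T x - (cmod ((x - w) $ k))\<^sup>2 / (T x)\<^sup>2)"
        by (rule levi_ball_potential[OF xR, of k]) (rule that[unfolded T_def])
      note l = levi_add[OF levi_add[OF l1 l2] levi_cmult[OF l3, of 4]]
      have "\<forall>\<^sub>F \<zeta> in at 0. \<psi> (?l \<zeta>) \<le> \<psi> (?l 0)"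
      proof -
        have "isCont (wronski f) x"
        proof -
          have fk: "\<And>w. w \<in> N \<Longrightarrow> cdiff (\<lambda>w. f w $ k) w" for k using lf(2) by (simp add: vcdiff_def)
          have "continuous_on N (wronski f)"
            unfolding wronski_def[abs_def] det3_def vgrad_def vec_lambda_beta
            by (intro continuous_intros cdiff_continuous_on[OF fk] grad_continuous_on[OF lf(1) fk])
          then show ?thesis using lf(1) f(2) by (simp add: continuous_on_eq_continuous_at)
        qed
        then have "\<forall>\<^sub>F y in nhds x. wronski f y \<noteq> 0"
          using tendsto_imp_eventually_ne[of "wronski f" "wronski f x" "at x" 0] W0 by (simp add: isCont_def eventually_nhds_conv_at)
        moreover have "\<forall>\<^sub>F y in nhds x. y \<in> N" using eventually_nhds_in_open lf(1) f(2) by blast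
        moreover have "\<forall>\<^sub>F y in nhds x. y \<in> ball w R"
          using xR by (intro eventually_nhds_in_open) (auto simp: dist_norm norm_minus_commute)
        ultimately have ev\<psi>: "\<forall>\<^sub>F y in nhds x. \<psi> y \<le> \<psi> x"
        proof eventually_elim
          case (elim y)
          have "norm (y - w) < R" using elim(3) by (simp add: dist_norm norm_minus_commute)
          then have Ty: "T y > 0" unfolding T_def using R by (simp add: power_strict_mono)
          have vy: "v y > 0" using elim(1) unfolding vV[OF f(1) elim(2)] V_def by simp
          have \<psi>: "\<psi> u = ln (v u * T u ^ 4)" if "u \<in> N" "T u > 0" "wronski f u \<noteq> 0" for u
            unfolding vV[OF f(1) that(1)] V_def \<psi>_def using that(2,3)
            by (simp add: ln_mult_pos ln_realpow)
          have "v y * T y ^ 4 \<le> v x * T x ^ 4" using max[of y] elim(3) by auto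
          then show ?case
            unfolding \<psi>[OF elim(2) Ty elim(1)] \<psi>[OF f(2) Tx W0]
            using vy Ty vx Tx by (subst ln_le_cancel_iff) auto
        qed
        have fl: "filterlim ?l (nhds x) (at 0)"
        proof -
          have "(?l \<longlongrightarrow> ?l 0) (at 0)"
            using has_derivative_continuous[OF has_derivative_line[of x "axis k 1" 0]] by (simp add: continuous_within)
          then show ?thesis by simp
        qed
        show ?thesis using eventually_compose_filterlim[OF ev\<psi> fl] by simp
      qed
      then have "0 + curvature p d \<kappa> q \<delta> B (f x) (e k) + 4 * (- 1 / T x - (cmod ((x - w) $ k))\<^sup>2 / (T x)\<^sup>2) \<le> 0"
        unfolding \<psi>_def by (rule levi_local_max[OF l])
      then show ?thesis by simp
    qed
    have grad0: "grad p (f x) (e k) = 0" for k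
    proof -
      have "\<forall>\<^sub>F y in nhds x. y \<in> N" using eventually_nhds_in_open lf(1) f(2) by blast
      then have "\<forall>\<^sub>F y in nhds x. p (f y) = 1" by (rule eventually_mono) (use lf in auto)
      from grad_cong[OF this cdiff_polyfun[OF pf lf(2)[OF f(2)]]]
      have "grad (\<lambda>y. p (f y)) x = (\<lambda>v. 0)" by (simp add: cdiff_const(2))
      then show ?thesis using gr_polyfun[OF pf lf(2)[OF f(2)]] unfolding e_def by metis
    qed
    define X where "X = (norm (x - w))\<^sup>2"
    have "X = (cmod ((x - w) $ 1))\<^sup>2 + (cmod ((x - w) $ 2))\<^sup>2" by (simp add: X_def norm_square_vec sum_2)
    then have "curvature p d \<kappa> q \<delta> B (f x) (e 1) + curvature p d \<kappa> q \<delta> B (f x) (e 2) \<le> 4 * (2 / T x + X / (T x)\<^sup>2)"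
      using curv[of 1] curv[of 2] by (simp add: add_divide_distrib)
    also have "2 / T x + X / (T x)\<^sup>2 = (2 * T x + X) / (T x)\<^sup>2"
      using Tx by (simp add: add_divide_distrib power2_eq_square)
    also have "\<dots> \<le> 2 * R\<^sup>2 / (T x)\<^sup>2"
      by (intro divide_right_mono) (auto simp: T_def X_def)
    finally have "curvature p d \<kappa> q \<delta> B (f x) (e 1) + curvature p d \<kappa> q \<delta> B (f x) (e 2) \<le> 8 * R\<^sup>2 / (T x)\<^sup>2"
      by simp
    moreover have "det3 (f x) (e 1) (e 2) = wronski f x" by (simp add: wronski_def e_def)
    ultimately have main: "c * (cmod (wronski f x) * exp (weight p d \<kappa> q \<delta> B (f x) / 2)) \<le> 8 * R\<^sup>2 / (T x)\<^sup>2"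
      using est[rule_format, OF lf(4)[OF f(2)] grad0[of 1] grad0[of 2]] by simp
    define Z where "Z = cmod (wronski f x) * exp (weight p d \<kappa> q \<delta> B (f x) / 2)"
    have Z2: "Z\<^sup>2 = v x"
      unfolding vV[OF f] V_def Z_def by (simp add: power_mult_distrib exp_double[symmetric])
    have "c * Z * (T x)\<^sup>2 \<le> 8 * R\<^sup>2" using main Tx by (simp add: Z_def pos_le_divide_eq mult_ac)
    then have "(c * Z * (T x)\<^sup>2)\<^sup>2 \<le> (8 * R\<^sup>2)\<^sup>2" using c by (intro power_mono) (auto simp: Z_def)
    then have "c\<^sup>2 * (v x * T x ^ 4) \<le> 64 * R ^ 4"
      by (simp add: power_mult_distrib Z2 power_mult[symmetric] mult_ac)
    then have "c\<^sup>2 * (v w * (R\<^sup>2) ^ 4) \<le> 64 * R ^ 4"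
      using le by (smt (verit) mult_left_mono zero_le_power2)
    then have "(c\<^sup>2 * (v w * R ^ 4)) * R ^ 4 \<le> 64 * R ^ 4"
      by (simp add: power_mult[symmetric] power_add[symmetric] mult_ac)
    then have "c\<^sup>2 * (v w * R ^ 4) \<le> 64" using R by simp
    then show ?thesis using c by (simp add: pos_le_divide_eq mult_ac)
  qed
  (* large enough to contradict the bound, as R \<le> R^4 *)
  define R where "R = max 1 (65 / (c\<^sup>2 * v w))"
  have R1: "R \<ge> 1" "R \<ge> 65 / (c\<^sup>2 * v w)" by (simp_all add: R_def)
  have "R \<le> R ^ 4" using R1 by (simp add: self_le_power)
  then have "v w * (65 / (c\<^sup>2 * v w)) \<le> v w * R ^ 4" using R1 vw by (intro mult_left_mono) auto
  also have "\<dots> \<le> 64 / c\<^sup>2" using bound[of R] R1 by linarith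
  finally have "65 / c\<^sup>2 \<le> 64 / c\<^sup>2" using vw by simp
  then show False using c by (simp add: divide_le_cancel)
qed

section \<open>Linear algebra and low-degree forms\<close>

lemma det3_axis: "det3 (axis 1 1) a b = cross a b $ 1" "det3 (axis 2 1) a b = cross a b $ 2" "det3 (axis 3 1) a b = cross a b $ 3"
  by (simp_all add: det3_def cross_def axis_def)

lemma ex_det3:
  assumes "cross a b \<noteq> 0"
  obtains u where "det3 u a b \<noteq> 0"
proof -
  obtain k where "cross a b $ k \<noteq> 0" using assms by (auto simp: vec_eq_iff)
  then show ?thesis using that det3_axis[of a b] exhaust_3[of k] by metis
qed

lemma cross_eq_0_functional:
  assumes "cross a b = 0" "(\<Sum>k\<in>UNIV. l $ k * a $ k) = 0"
  shows "(\<Sum>k\<in>UNIV. l $ k * b $ k) *s a = 0"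
proof -
  have c: "a $ 2 * b $ 3 = a $ 3 * b $ 2" "a $ 3 * b $ 1 = a $ 1 * b $ 3" "a $ 1 * b $ 2 = a $ 2 * b $ 1"
    using assms(1) by (auto simp: cross_def vec_eq_iff forall_3)
  have l: "l $ 1 * a $ 1 + l $ 2 * a $ 2 + l $ 3 * a $ 3 = 0" using assms(2) by (simp add: sum_3)
  have "(l $ 1 * b $ 1 + l $ 2 * b $ 2 + l $ 3 * b $ 3) * a $ 1 = 0" using c l by algebra
  moreover have "(l $ 1 * b $ 1 + l $ 2 * b $ 2 + l $ 3 * b $ 3) * a $ 2 = 0" using c l by algebra
  moreover have "(l $ 1 * b $ 1 + l $ 2 * b $ 2 + l $ 3 * b $ 3) * a $ 3 = 0" using c l by algebra
  ultimately show ?thesis by (simp only: vec_eq_iff forall_3 sum_3 vector_smult_component zero_index simp_thms)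
qed

lemma ex_kernel_vector:
  assumes "a \<noteq> 0" "grad p z a = 0" "grad p z u \<noteq> 0"
  obtains v where "grad p z v = 0" "det3 v a u \<noteq> 0"
proof -
  have "cross a u \<noteq> 0"
    using cross_eq_0_functional[of a u "gradv p z"] assms by (auto simp: grad_gradv vec_eq_iff)
  then obtain e where e: "det3 e a u \<noteq> 0" using ex_det3 by blast
  define v where "v = e - (grad p z e / grad p z u) *s u"
  have "grad p z v = 0" using assms(3) by (simp add: v_def grad_diff grad_scale)
  moreover have "det3 v a u = det3 e a u" by (simp add: v_def det3_def algebra_simps)
  ultimately show ?thesis using that e by metis
qed

lemma form_1_linear:
  assumes "form (Suc 0) p"
  shows "p z = grad p 0 z"
proof -
  have "form 0 (pd p k)" for k using assms by (rule form_pd)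
  then have "pd p k z = pd p k 0" for k by (rule form_0_const)
  then show ?thesis using Euler[OF assms, of z] by (simp add: grad_def)
qed

lemma form_2_hess:
  assumes "form 2 p"
  shows "hess p z u v = hess p 0 u v" "grad p z v = hess p 0 z v" "p z = hess p 0 z z / 2"
proof -
  have f: "form (Suc (Suc 0)) p" using assms by (simp add: numeral_2_eq_2)
  have "form 0 (pd (pd p k) l)" for k l using f form_pd by blast
  then have "pd (pd p k) l z = pd (pd p k) l 0" for k l by (rule form_0_const)
  then show h: "hess p z u v = hess p 0 u v" for u v by (simp add: hess_def)
  show g: "grad p z v = hess p 0 z v" for v using Euler_hess[OF f, of z v] h by simp
  show "p z = hess p 0 z z / 2" using Euler[OF f, of z] g by simp
qed

lemma form_2_add:
  assumes "form 2 p"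
  shows "p (a + b) = p a + grad p a b + p b"
proof -
  have "hess p 0 b a = hess p 0 a b" by (rule hess_commute[OF formD(1)[OF assms]])
  then show ?thesis
    unfolding form_2_hess(2)[OF assms, of a b] form_2_hess(3)[OF assms, of "a + b"] form_2_hess(3)[OF assms, of a]
      form_2_hess(3)[OF assms, of b]
    by (simp add: hess_add_left hess_add_right add_divide_distrib)
qed

lemma
  assumes "form 3 p"
  shows form_3_add: "hess p (a + a') b c = hess p a b c + hess p a' b c"
    and form_3_scale: "hess p (k *s a) b c = k * hess p a b c"
    and form_3_swap: "hess p a b c = hess p b a c"
    and form_3_commute: "hess p a b c = hess p a c b"
    and form_3_grad: "grad p a b = hess p a a b / 2"
    and form_3_eval: "p a = hess p a a a / 6"
proof -
  have f: "form (Suc (Suc (Suc 0))) p" using assms by (simp add: numeral_3_eq_3)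
  note pf = formD(1)[OF assms]
  define t where "t = (\<lambda>k l m. pd (pd (pd p k) l) m 0)"
  have lin: "pd (pd p k) l z = (\<Sum>m\<in>UNIV. t k l m * z $ m)" for k l z
    using form_1_linear[of "pd (pd p k) l" z] f form_pd by (simp add: grad_def t_def)
  have s1: "t k l m = t l k m" for k l m by (simp add: t_def pd_commute[OF pf, of k l])
  have s2: "t k l m = t k m l" for k l m by (simp add: t_def pd_commute[OF polyfun_pd[OF pf], of k l m])
  have s3: "t k l m = t m l k" for k l m using s1 s2 by metis
  have h: "hess p a b c = (\<Sum>k\<in>UNIV. \<Sum>l\<in>UNIV. \<Sum>m\<in>UNIV. t k l m * a $ m * b $ k * c $ l)" for a b c
    by (simp add: hess_def lin sum_distrib_right sum_distrib_left mult_ac)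
  show "hess p (a + a') b c = hess p a b c + hess p a' b c" "hess p (k *s a) b c = k * hess p a b c"
    by (simp_all add: h algebra_simps sum.distrib sum_distrib_left)
  show "hess p a b c = hess p b a c"
  proof -
    have "hess p a b c = (\<Sum>l\<in>UNIV. \<Sum>k\<in>UNIV. \<Sum>m\<in>UNIV. t k l m * a $ m * b $ k * c $ l)"
      unfolding h by (rule sum.swap)
    also have "\<dots> = (\<Sum>l\<in>UNIV. \<Sum>m\<in>UNIV. \<Sum>k\<in>UNIV. t k l m * a $ m * b $ k * c $ l)"
      by (intro sum.cong refl sum.swap)
    also have "\<dots> = (\<Sum>l\<in>UNIV. \<Sum>m\<in>UNIV. \<Sum>k\<in>UNIV. t m l k * b $ k * a $ m * c $ l)"
      by (intro sum.cong refl) (simp add: s3 mult_ac)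
    also have "\<dots> = hess p b a c" unfolding h by (rule sum.swap)
    finally show ?thesis .
  qed
  show "hess p a b c = hess p a c b" by (rule hess_commute[OF pf])
  show g: "grad p a b = hess p a a b / 2" for b using Euler_hess[OF f, of a b] by simp
  show "p a = hess p a a a / 6" using Euler[OF f, of a] g by simp
qed

lemma form_3_expand:
  assumes f: "form 3 p"
  shows "p (x *s u + y *s v + z *s t) = p u * x ^ 3 + p v * y ^ 3 + p t * z ^ 3
     + grad p u v * x\<^sup>2 * y + grad p u t * x\<^sup>2 * z + grad p v u * y\<^sup>2 * x
     + grad p v t * y\<^sup>2 * z + grad p t u * z\<^sup>2 * x + grad p t v * z\<^sup>2 * y + hess p u v t * x * y * z"
proof -
  note sw = form_3_swap[OF f] and cm = form_3_commute[OF f]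
  have e: "hess p v u u = hess p u u v" "hess p u v u = hess p u u v"
    "hess p t u u = hess p u u t" "hess p u t u = hess p u u t"
    "hess p u v v = hess p v v u" "hess p v u v = hess p v v u"
    "hess p t v v = hess p v v t" "hess p v t v = hess p v v t"
    "hess p u t t = hess p t t u" "hess p t u t = hess p t t u"
    "hess p v t t = hess p t t v" "hess p t v t = hess p t t v"
    "hess p u t v = hess p u v t" "hess p v u t = hess p u v t" "hess p v t u = hess p u v t"
    "hess p t u v = hess p u v t" "hess p t v u = hess p u v t"
    using sw cm by metis+
  show ?thesis
    unfolding form_3_eval[OF f, of "x *s u + y *s v + z *s t"] form_3_eval[OF f, of u] form_3_eval[OF f, of v]
      form_3_eval[OF f, of t] form_3_grad[OF f]
    by (simp add: form_3_add[OF f] form_3_scale[OF f] hess_add_left hess_add_right hess_scale_left hess_scale_right e)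
       (simp add: field_simps power2_eq_square power3_eq_cube)
qed

text \<open>
  If \<open>p\<close> were constant on the line \<open>e2 + t *s e1\<close>, with \<open>e1\<close> and \<open>e2\<close> the first two unit vectors, then \<open>p
  (e1 + s *s e2)\<close> would by homogeneity be a multiple of \<open>s ^ Suc m\<close>, and \<open>p e1 = 0\<close>.
\<close>

lemma form_has_zero:
  assumes fp: "form (Suc m) p"
  obtains z where "z \<noteq> 0" "p z = 0"
proof (cases "p (axis 1 1) = 0")
  case True
  then show ?thesis using that[of "axis 1 1"] by simp
next
  case False
  let ?u = "axis 1 1 :: complex ^ 3" and ?e = "axis 2 1 :: complex ^ 3"
  obtain q where q: "\<And>t. p (?e + t *s ?u) = poly q t" using polyfun_line[OF formD(1)[OF fp]] by blast
  obtain r where r: "\<And>t. p (?u + t *s ?e) = poly r t" using polyfun_line[OF formD(1)[OF fp]] by blast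
  have "\<not> constant (poly q)"
  proof
    assume "constant (poly q)"
    then have c: "poly q t = poly q 0" for t by (simp add: constant_def)
    have "poly (r - monom (poly q 0) (Suc m)) (of_nat (Suc n)) = 0" for n
    proof -
      let ?s = "of_nat (Suc n) :: complex"
      have s: "?s \<noteq> 0" using of_nat_neq_0 by blast
      have "?u + ?s *s ?e = ?s *s (?e + (1 / ?s) *s ?u)"
        using s by (simp add: vector_add_ldistrib vector_smult_assoc del: of_nat_Suc)
      then have "poly r ?s = ?s ^ Suc m * poly q (1 / ?s)"
        using formD(2)[OF fp, of ?s] q r by metis
      then show ?thesis using c[of "1 / ?s"] by (simp add: poly_monom del: of_nat_Suc)
    qed
    then have "r - monom (poly q 0) (Suc m) = 0"
      by (intro poly_eq_0_of_infinite_roots[where h = "\<lambda>n. of_nat (Suc n)"]) (auto simp: inj_def)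
    then have "poly r 0 = 0" by (simp add: poly_monom)
    then show False using r[of 0] False by simp
  qed
  then obtain t where "poly q t = 0" using fundamental_theorem_of_algebra by blast
  moreover have "?e + t *s ?u \<noteq> 0" by (auto simp: vec_eq_iff forall_3 axis_def)
  ultimately show ?thesis using that q by metis
qed

section \<open>Dominating maps for curves of degree at most two\<close>

lemma dominable_by_combination:
  fixes a b c :: "complex ^ 2 \<Rightarrow> complex"
  assumes fp: "form d (poly3_eval P)" and basis: "det3 u v t \<noteq> 0"
    and a: "\<And>w. cdiff a w" and b: "\<And>w. cdiff b w" and c: "\<And>w. cdiff c w"
    and P: "\<And>w. poly3_eval P (a w *s u + b w *s v + c w *s t) \<noteq> 0"
    and nz: "\<And>w. a w *s u + b w *s v + c w *s t \<noteq> 0"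
    and W: "det3 (vector [a w0, b w0, c w0])
        (vector [grad a w0 (axis 1 1), grad b w0 (axis 1 1), grad c w0 (axis 1 1)])
        (vector [grad a w0 (axis 2 1), grad b w0 (axis 2 1), grad c w0 (axis 2 1)]) \<noteq> 0"
  shows "dominable_by_C2 (- zero_locus P)"
proof (rule dominable_by_lift[OF fp])
  let ?f = "\<lambda>w. a w *s u + b w *s v + c w *s t"
  have k: "cdiff (\<lambda>w. ?f w $ k) w \<and> grad (\<lambda>w. ?f w $ k) w e = grad a w e * u $ k + grad b w e * v $ k + grad c w e * t $ k"
    for k w e
  proof -
    have 1: "cdiff (\<lambda>w. a w * u $ k) w" "grad (\<lambda>w. a w * u $ k) w e = grad a w e * u $ k"
      using cdiff_cmult[OF a, of "u $ k"] gr_cmult[OF a, of "u $ k"] by (simp_all add: mult.commute)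
    have 2: "cdiff (\<lambda>w. b w * v $ k) w" "grad (\<lambda>w. b w * v $ k) w e = grad b w e * v $ k"
      using cdiff_cmult[OF b, of "v $ k"] gr_cmult[OF b, of "v $ k"] by (simp_all add: mult.commute)
    have 3: "cdiff (\<lambda>w. c w * t $ k) w" "grad (\<lambda>w. c w * t $ k) w e = grad c w e * t $ k"
      using cdiff_cmult[OF c, of "t $ k"] gr_cmult[OF c, of "t $ k"] by (simp_all add: mult.commute)
    show ?thesis
      using cdiff_add[OF cdiff_add[OF 1(1) 2(1)] 3(1)] gr_add[OF cdiff_add[OF 1(1) 2(1)] 3(1)] gr_add[OF 1(1) 2(1)]
      by (simp add: 1(2) 2(2) 3(2))
  qed
  show "vcdiff ?f w" for w using k by (simp add: vcdiff_def)
  have vg: "vgrad ?f w e = grad a w e *s u + grad b w e *s v + grad c w e *s t" for w e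
    using k by (simp add: vgrad_def vec_eq_iff)
  have mult: "det3 (x1 *s u + y1 *s v + z1 *s t) (x2 *s u + y2 *s v + z2 *s t) (x3 *s u + y3 *s v + z3 *s t)
      = det3 (vector [x1, y1, z1]) (vector [x2, y2, z2]) (vector [x3, y3, z3]) * det3 u v t"
    for x1 x2 x3 y1 y2 y3 z1 z2 z3
    by (simp add: det3_def) algebra
  show "wronski ?f w0 \<noteq> 0" unfolding wronski_def vg mult using W basis by simp
qed (use P nz in auto)

lemma grad_slice_eqI:
  assumes "cdiff f w" "((\<lambda>c. f (w + c *s v)) has_field_derivative D) (at 0)"
  shows "grad f w v = D"
proof -
  have "((\<lambda>c. f (w + c *s v)) has_field_derivative grad f (w + 0 *s v) v) (at 0)"
    by (rule cdiff_slice) (use assms in simp)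
  then show ?thesis using DERIV_unique[OF _ assms(2)] by simp
qed

lemma dominable_degree_0:
  assumes "P \<noteq> 0" "homogeneous 0 P"
  shows "dominable_by_C2 (- zero_locus P)"
proof -
  have f0: "form 0 (poly3_eval P)" by (rule form_poly3_eval[OF assms(2)])
  have nz: "poly3_eval P z \<noteq> 0" for z
  proof
    assume "poly3_eval P z = 0"
    then have "poly3_eval P w = poly3_eval 0 w" for w
      using form_0_const[OF f0, of w] form_0_const[OF f0, of z] by simp
    then show False using poly3_eval_inject[of P 0] assms(1) by blast
  qed
  show ?thesis
  proof (rule dominable_by_combination[OF f0, of "axis 1 1" "axis 2 1" "axis 3 1" "\<lambda>w. 1" "\<lambda>w. w $ 1" "\<lambda>w. w $ 2" 0])
    show "(1 :: complex) *s axis 1 1 + w $ 1 *s axis 2 1 + w $ 2 *s axis 3 1 \<noteq> (0 :: complex ^ 3)" for w :: "complex ^ 2"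
      by (auto simp: vec_eq_iff axis_def intro!: exI[of _ 1])
  qed (auto simp: nz det3_def axis_def cdiff_const cdiff_coord)
qed

lemma dominable_degree_1:
  assumes "P \<noteq> 0" "homogeneous 1 P"
  shows "dominable_by_C2 (- zero_locus P)"
proof -
  define p where "p = poly3_eval P"
  have f: "form 1 p" unfolding p_def by (rule form_poly3_eval[OF assms(2)])
  have f': "form (Suc 0) p" using f by simp
  note lin = form_1_linear[OF f']
  obtain u where u: "p u \<noteq> 0" using poly3_eval_inject[of P 0] assms(1) unfolding p_def by (metis poly3_eval_zero ext)
  obtain a where a: "a \<noteq> 0" "p a = 0" using form_has_zero[OF f'] .
  obtain v where v: "grad p 0 v = 0" "det3 v a u \<noteq> 0"
    using ex_kernel_vector[of a p 0 u] a u lin by metis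
  have val: "p (x *s v + y *s a + 1 *s u) = p u" for x y
  proof -
    have "grad p 0 a = 0" using a(2) lin[of a] by simp
    then have "grad p 0 (x *s v + y *s a + 1 *s u) = grad p 0 u" using v(1) by (simp add: grad_add grad_scale)
    then show ?thesis using lin[of u] lin[of "x *s v + y *s a + 1 *s u"] by simp
  qed
  show ?thesis
  proof (rule dominable_by_combination[OF f[unfolded p_def] v(2), of "\<lambda>w. w $ 1" "\<lambda>w. w $ 2" "\<lambda>w. 1" 0])
    show "poly3_eval P (w $ 1 *s v + w $ 2 *s a + 1 *s u) \<noteq> 0" for w :: "complex ^ 2"
      using val u unfolding p_def by simp
    show "w $ 1 *s v + w $ 2 *s a + 1 *s u \<noteq> 0" for w :: "complex ^ 2"
      using val[of "w $ 1" "w $ 2"] u form_at_0[OF f'] by metis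
  qed (auto simp: det3_def axis_def cdiff_const cdiff_coord)
qed

text \<open>
  Let \<open>a\<close> be a smooth point of the conic; at a node, the directions of the two branches are such
  points. On the lines \<open>y \<mapsto> s *s v + y *s a + u\<close> through \<open>a\<close> the form is affine in \<open>y\<close> with constant
  leading coefficient \<open>K\<close>, so it can be given the value of an exponential.
\<close>

lemma dominable_degree_2:
  assumes sqf: "squarefree P" and hom: "homogeneous 2 P" and nc: "normal_crossing (zero_locus P)"
  shows "dominable_by_C2 (- zero_locus P)"
proof -
  define p where "p = poly3_eval P"
  have f: "form 2 p" unfolding p_def by (rule form_poly3_eval[OF hom])
  have f': "form (Suc (Suc 0)) p" using f by (simp add: numeral_2_eq_2)
  have "\<exists>a u. p a = 0 \<and> grad p a u \<noteq> 0"
  proof -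
    obtain z where z: "z \<noteq> 0" "p z = 0" using form_has_zero[OF f'] .
    show ?thesis
    proof (cases "\<exists>u. grad p z u \<noteq> 0")
      case True with z show ?thesis by blast
    next
      case False
      obtain a b where ab: "hess p z a a = 0" "hess p z a b \<noteq> 0"
        using singular_point_is_node[OF sqf hom[unfolded numeral_2_eq_2] nc z(1)] False unfolding p_def by metis
      have "hess p 0 a a = 0" using ab(1) form_2_hess(1)[OF f, of z a a] by simp
      then have "p a = 0" using form_2_hess(3)[OF f, of a] by simp
      moreover have "grad p a b \<noteq> 0"
        using ab(2) form_2_hess(1)[OF f, of z a b] form_2_hess(2)[OF f, of a b] by simp
      ultimately show ?thesis by blast
    qed
  qed
  then obtain a u where a: "p a = 0" and k: "grad p a u \<noteq> 0" by blast
  have ga: "grad p a a = 0" using Euler[OF f, of a] a by simp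
  have a0: "a \<noteq> 0"
  proof
    assume "a = 0"
    then have "grad p a u = hess p 0 0 u" using form_2_hess(2)[OF f] by simp
    then show False using k by (simp add: hess_def)
  qed
  obtain v where v: "grad p a v = 0" "det3 v a u \<noteq> 0" using ex_kernel_vector[OF a0 ga k] .
  define K where "K = grad p a u"
  have K: "K \<noteq> 0" using k by (simp add: K_def)
  define r where "r = (\<lambda>s. p v * s\<^sup>2 + grad p v u * s + p u)"
  define x where "x = (\<lambda>w :: complex ^ 2. (exp (w $ 2) - r (w $ 1)) / K)"
  have val: "p (s *s v + y *s a + 1 *s u) = y * K + r s" for s y
  proof -
    have "p (y *s a + (s *s v + u)) = p (y *s a) + grad p (y *s a) (s *s v + u) + p (s *s v + u)"
      by (rule form_2_add[OF f])
    also have "p (y *s a) = 0" using formD(2)[OF f] a by simp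
    also have "grad p (y *s a) (s *s v + u) = y * K"
    proof -
      have "grad p (y *s a) e = y * grad p a e" for e
        using form_2_hess(2)[OF f] by (simp add: hess_scale_left)
      then show ?thesis using v(1) by (simp add: grad_add grad_scale K_def)
    qed
    also have "p (s *s v + u) = r s"
    proof -
      have "grad p (s *s v) u = s * grad p v u" using form_2_hess(2)[OF f] by (simp add: hess_scale_left)
      then show ?thesis unfolding form_2_add[OF f] by (simp add: r_def formD(2)[OF f] mult.commute)
    qed
    finally show ?thesis by (simp add: add_ac)
  qed
  have xd: "cdiff x w" for w
    unfolding x_def r_def
    by (intro cdiff_divide cdiff_diff cdiff_add cdiff_mult cdiff_power cdiff_exp cdiff_const cdiff_coord K)
  have pe: "p (w $ 1 *s v + x w *s a + 1 *s u) = exp (w $ 2)" for w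
    unfolding val using K by (simp add: x_def)
  have x2: "grad x 0 (axis 2 1) = 1 / K"
  proof -
    have "(\<lambda>c. x (0 + c *s axis 2 1)) = (\<lambda>c. (exp c - r 0) / K)"
      by (simp add: x_def axis_def)
    moreover have "((\<lambda>c. (exp c - r 0) / K) has_field_derivative 1 / K) (at 0)"
      using K by (auto intro!: derivative_eq_intros)
    ultimately show ?thesis by (intro grad_slice_eqI[OF xd]) simp
  qed
  show ?thesis
  proof (rule dominable_by_combination[OF f[unfolded p_def] v(2), of "\<lambda>w. w $ 1" x "\<lambda>w. 1" 0])
    show "poly3_eval P (w $ 1 *s v + x w *s a + 1 *s u) \<noteq> 0" for w
      using pe unfolding p_def by simp
    show "w $ 1 *s v + x w *s a + 1 *s u \<noteq> 0" for w
      using pe[of w] form_at_0[OF f'] by (metis exp_not_eq_zero)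
  qed (auto simp: det3_def axis_def[of _ "1::complex"] cdiff_const cdiff_coord xd x2[unfolded axis_def] K)
qed

section \<open>Flows along a pencil of conics\<close>

text \<open>
  The entire functions with \<open>cosh_sqrt (x\<^sup>2) = cosh x\<close> and \<open>sinhc_sqrt (x\<^sup>2) * x = sinh x\<close>.
\<close>

definition cosh_sqrt :: "complex \<Rightarrow> complex" where
  "cosh_sqrt x = suminf (\<lambda>n. (1 / fact (2 * n)) * x ^ n)"

definition sinhc_sqrt :: "complex \<Rightarrow> complex" where
  "sinhc_sqrt x = suminf (\<lambda>n. (1 / fact (2 * n + 1)) * x ^ n)"

lemma cosh_sqrt_sums: "(\<lambda>n. (1 / fact (2 * n)) * (x\<^sup>2) ^ n) sums cosh (x :: complex)"
proof -
  have "strict_mono (\<lambda>n :: nat. 2 * n)" by (simp add: strict_mono_def)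
  then have "(\<lambda>n. (\<lambda>n. if even n then x ^ n /\<^sub>R fact n else 0) (2 * n)) sums cosh x"
    using cosh_converges[of x] by (subst sums_mono_reindex) (auto elim!: evenE)
  then show ?thesis by (simp add: power_mult scaleR_conv_of_real divide_inverse of_real_inverse)
qed

lemma sinhc_sqrt_sums: "(\<lambda>n. (1 / fact (2 * n + 1)) * (x\<^sup>2) ^ n * x) sums sinh (x :: complex)"
proof -
  have pw: "x ^ Suc (2 * n) = (x\<^sup>2) ^ n * x" for n by (simp add: power_mult[symmetric] mult.commute)
  have "strict_mono (\<lambda>n :: nat. 2 * n + 1)" by (simp add: strict_mono_def)
  then have "(\<lambda>n. (\<lambda>n. if even n then 0 else x ^ n /\<^sub>R fact n) (2 * n + 1)) sums sinh x"
    using sinh_converges[of x] by (subst sums_mono_reindex) (auto elim!: oddE)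
  then show ?thesis 
    by (simp add: pw scaleR_conv_of_real of_real_inverse divide_inverse mult.assoc del: fact_Suc power_Suc)
qed

lemma cosh_sqrt_summable: "summable (\<lambda>n. (1 / fact (2 * n)) * (y :: complex) ^ n)"
  using sums_summable[OF cosh_sqrt_sums[of "csqrt y"]] by simp

lemma sinhc_sqrt_summable: "summable (\<lambda>n. (1 / fact (2 * n + 1)) * (y :: complex) ^ n)"
proof (cases "y = 0")
  case True then show ?thesis using sums_summable[OF powser_sums_zero] by (simp only:)
next
  case False
  then have "csqrt y \<noteq> 0" by simp
  then show ?thesis
    using summable_divide[OF sums_summable[OF sinhc_sqrt_sums[of "csqrt y"]], of "csqrt y"] by simp
qed

lemma cosh_sqrt_derivative: "\<exists>D. (cosh_sqrt has_field_derivative D) (at x)"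
  unfolding cosh_sqrt_def[abs_def]
  using termdiffs_strong_converges_everywhere[OF cosh_sqrt_summable] by blast

lemma sinhc_sqrt_derivative: "\<exists>D. (sinhc_sqrt has_field_derivative D) (at x)"
  unfolding sinhc_sqrt_def[abs_def]
  using termdiffs_strong_converges_everywhere[OF sinhc_sqrt_summable] by blast

lemma cosh_sqrt_0 [simp]: "cosh_sqrt 0 = 1" and sinhc_sqrt_0 [simp]: "sinhc_sqrt 0 = 1"
  unfolding cosh_sqrt_def sinhc_sqrt_def using sums_unique[OF powser_sums_zero] by (metis fact_0 mult_0_right div_by_1 add_0 fact_1)+

lemma cosh_sinhc_sqrt: "(cosh_sqrt y)\<^sup>2 - y * (sinhc_sqrt y)\<^sup>2 = 1"
proof -
  define x where "x = csqrt y"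
  have y: "y = x\<^sup>2" by (simp add: x_def)
  have c: "cosh_sqrt y = cosh x" unfolding y cosh_sqrt_def using cosh_sqrt_sums by (rule sums_unique[symmetric])
  have "sinh x = suminf (\<lambda>n. (1 / fact (2 * n + 1)) * (x\<^sup>2) ^ n * x)" using sinhc_sqrt_sums by (rule sums_unique)
  also have "\<dots> = sinhc_sqrt y * x"
    unfolding y sinhc_sqrt_def using suminf_mult2[OF sinhc_sqrt_summable] by metis
  finally have s: "sinh x = sinhc_sqrt y * x" .
  have "(cosh_sqrt y)\<^sup>2 - y * (sinhc_sqrt y)\<^sup>2 = (cosh x)\<^sup>2 - (sinh x)\<^sup>2"
    unfolding c s unfolding y by (simp add: power_mult_distrib mult_ac)
  then show ?thesis by (simp add: cosh_square_eq)
qed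

text \<open>
  Let \<open>q\<close> be the function \<open>A x\<^sup>2 + B x z + C z\<^sup>2 + D x + E z\<close>. The affine vector field \<open>(- q\<^sub>z, q\<^sub>x)\<close>
  preserves \<open>q\<close>, has the value \<open>V = (V1, V2)\<close> at \<open>(0, s)\<close>, and the square of its linear part \<open>N\<close> is the
  scalar \<open>\<Delta> = B\<^sup>2 - 4 A C\<close>. After time \<open>\<tau>\<close> its flow has moved \<open>(0, s)\<close> by \<open>\<sigma> V + \<kappa> N V\<close> with \<open>\<sigma> = sinh (\<tau> \<surd>\<Delta>)
  / \<surd>\<Delta>\<close> and \<open>\<kappa> = (cosh (\<tau> \<surd>\<Delta>) - 1) / \<Delta>\<close>. The invariance of \<open>q\<close> uses of these functions only the relation
  \<open>rel\<close>.
\<close>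

lemma conic_flow:
  fixes A B C D E s \<sigma> \<kappa> :: complex
  assumes rel: "\<sigma>\<^sup>2 = 2 * \<kappa> + (B\<^sup>2 - 4 * A * C) * \<kappa>\<^sup>2"
  defines "V1 \<equiv> - (2 * C * s + E)" and "V2 \<equiv> B * s + D"
  defines "x \<equiv> \<sigma> * V1 + \<kappa> * (- B * V1 - 2 * C * V2)" and "z \<equiv> s + \<sigma> * V2 + \<kappa> * (2 * A * V1 + B * V2)"
  shows "A * x\<^sup>2 + B * x * z + C * z\<^sup>2 + D * x + E * z = C * s\<^sup>2 + E * s"
proof -
  define U1 where "U1 = \<sigma> * V1 + \<kappa> * (- B * V1 - 2 * C * V2)"
  define U2 where "U2 = \<sigma> * V2 + \<kappa> * (2 * A * V1 + B * V2)"
  have "A * x\<^sup>2 + B * x * z + C * z\<^sup>2 + D * x + E * z - (C * s\<^sup>2 + E * s)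
     = V2 * U1 - V1 * U2 + (A * U1\<^sup>2 + B * U1 * U2 + C * U2\<^sup>2)"
    unfolding x_def z_def U1_def[symmetric] by (simp add: U2_def[symmetric] add.assoc) (simp add: V1_def V2_def algebra_simps power2_eq_square)
  also have "\<dots> = (A * V1\<^sup>2 + B * V1 * V2 + C * V2\<^sup>2) * (\<sigma>\<^sup>2 - (2 * \<kappa> + (B\<^sup>2 - 4 * A * C) * \<kappa>\<^sup>2))"
    unfolding U1_def U2_def by algebra
  also have "\<dots> = 0" using rel by simp
  finally show ?thesis by simp
qed

text \<open>
  The surface on which the form is \<open>1\<close> contains the line of all points \<open>(0, 1, s)\<close>. On the plane \<open>Y = 1
  - t X\<close> the equation of the surface is \<open>X\<close> times that of a conic, and for a suitable \<open>t\<close> depending on \<open>s\<close>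
  this conic passes through \<open>(0, 1, s)\<close>. Moving that point along the conic by \<open>conic_flow\<close> for a complex
  time is an entire map of \<open>s\<close> and the time into the surface. At time zero the flow leaves the line \<open>X
  = 0\<close> transversally if \<open>V1 \<noteq> 0\<close>, which can be achieved by the choice of \<open>s\<close> because \<open>q23\<close> and \<open>q33\<close> are not
  both zero.
\<close>

theorem dominable_cubic_normal_form:
  assumes fp: "form 3 (poly3_eval P)" and basis: "det3 e1 e2 e3 \<noteq> 0"
    and nf: "\<And>X Y Z. poly3_eval P (X *s e1 + Y *s e2 + Z *s e3) =
      X * (q11 * X\<^sup>2 + q22 * Y\<^sup>2 + q33 * Z\<^sup>2 + q12 * X * Y + q13 * X * Z + q23 * Y * Z) + Y ^ 3"
    and ne: "q23 \<noteq> 0 \<or> q33 \<noteq> 0"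
  shows "dominable_by_C2 (- zero_locus P)"
proof -
  obtain s0 where s0: "2 * q33 * s0 + q23 \<noteq> 0"
  proof (cases "q23 = 0")
    case True then show ?thesis using that[of 1] ne by simp
  next
    case False then show ?thesis using that[of 0] by simp
  qed
  define t where "t = (\<lambda>s. (q22 + q33 * s\<^sup>2 + q23 * s) / 3)"
  define A where "A = (\<lambda>s. q11 + q22 * (t s)\<^sup>2 - q12 * t s - (t s) ^ 3)"
  define B where "B = (\<lambda>s. q13 - q23 * t s)"
  define D where "D = (\<lambda>s. 3 * (t s)\<^sup>2 + q12 - 2 * q22 * t s)"
  define \<Delta> where "\<Delta> = (\<lambda>s. (B s)\<^sup>2 - 4 * A s * q33)"
  define V1 where "V1 = (\<lambda>s. - (2 * q33 * s + q23))"
  define V2 where "V2 = (\<lambda>s. B s * s + D s)"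
  define N1 where "N1 = (\<lambda>s. - B s * V1 s - 2 * q33 * V2 s)"
  define N2 where "N2 = (\<lambda>s. 2 * A s * V1 s + B s * V2 s)"
  (* the flow for time 2 w_2: the double-argument formulas avoid a division by \<Delta> *)
  define S where "S = (\<lambda>w :: complex ^ 2. w $ 2 * sinhc_sqrt (\<Delta> (w $ 1) * (w $ 2)\<^sup>2))"
  define \<sigma> where "\<sigma> = (\<lambda>w. 2 * S w * cosh_sqrt (\<Delta> (w $ 1) * (w $ 2)\<^sup>2))"
  define \<kappa> where "\<kappa> = (\<lambda>w. 2 * (S w)\<^sup>2)"
  define x where "x = (\<lambda>w. \<sigma> w * V1 (w $ 1) + \<kappa> w * N1 (w $ 1))"
  define z where "z = (\<lambda>w. w $ 1 + \<sigma> w * V2 (w $ 1) + \<kappa> w * N2 (w $ 1))"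
  define y where "y = (\<lambda>w. 1 - t (w $ 1) * x w)"
  have rel: "(\<sigma> w)\<^sup>2 = 2 * \<kappa> w + ((B (w $ 1))\<^sup>2 - 4 * A (w $ 1) * q33) * (\<kappa> w)\<^sup>2" for w
  proof -
    let ?y = "\<Delta> (w $ 1) * (w $ 2)\<^sup>2"
    have "(cosh_sqrt ?y)\<^sup>2 = 1 + ?y * (sinhc_sqrt ?y)\<^sup>2" using cosh_sinhc_sqrt[of ?y] by (simp add: algebra_simps)
    also have "\<dots> = 1 + \<Delta> (w $ 1) * (S w)\<^sup>2" by (simp add: S_def power_mult_distrib)
    finally have "(\<sigma> w)\<^sup>2 = 4 * (S w)\<^sup>2 * (1 + \<Delta> (w $ 1) * (S w)\<^sup>2)"
      by (simp add: \<sigma>_def power_mult_distrib)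
    then show ?thesis unfolding \<kappa>_def \<Delta>_def by algebra
  qed
  have conic: "A s * (x w)\<^sup>2 + B s * x w * z w + q33 * (z w)\<^sup>2 + D s * x w + q23 * z w = q33 * s\<^sup>2 + q23 * s"
    if "s = w $ 1" for s w
    unfolding x_def z_def N1_def N2_def V1_def V2_def that by (rule conic_flow[OF rel])
  have one: "poly3_eval P (x w *s e1 + y w *s e2 + z w *s e3) = 1" for w
  proof -
    define s where "s = w $ 1"
    have t3: "3 * t s = q22 + q33 * s\<^sup>2 + q23 * s" by (simp add: t_def)
    have yw: "y w = 1 - t s * x w" by (simp add: y_def s_def)
    have "q11 * (x w)\<^sup>2 + q22 * (y w)\<^sup>2 + q33 * (z w)\<^sup>2 + q12 * x w * y w + q13 * x w * z w + q23 * y w * z w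
        = t s * (3 - 3 * t s * x w + (t s)\<^sup>2 * (x w)\<^sup>2)"
      using conic[OF s_def] t3 unfolding yw A_def B_def D_def by algebra
    then show ?thesis unfolding nf yw by algebra
  qed
  have s1: "cdiff (\<lambda>w :: complex ^ 2. w $ 1) w" and s2: "cdiff (\<lambda>w :: complex ^ 2. w $ 2) w" for w
    by (rule cdiff_coord)+
  note intros = cdiff_add cdiff_diff cdiff_minus cdiff_mult cdiff_power cdiff_const s1 s2
  have td: "cdiff (\<lambda>w :: complex ^ 2. t (w $ 1)) w" for w
    unfolding t_def by (intro cdiff_divide intros) simp
  have Ad: "cdiff (\<lambda>w :: complex ^ 2. A (w $ 1)) w" and Bd: "cdiff (\<lambda>w :: complex ^ 2. B (w $ 1)) w"
    and Dd: "cdiff (\<lambda>w :: complex ^ 2. D (w $ 1)) w" for w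
    unfolding A_def B_def D_def by (intro intros td)+
  have \<Delta>d: "cdiff (\<lambda>w :: complex ^ 2. \<Delta> (w $ 1) * (w $ 2)\<^sup>2) w" for w
    unfolding \<Delta>_def by (intro intros Ad Bd)
  have V1d: "cdiff (\<lambda>w :: complex ^ 2. V1 (w $ 1)) w" and V2d: "cdiff (\<lambda>w :: complex ^ 2. V2 (w $ 1)) w" for w
    unfolding V1_def V2_def by (intro intros Bd Dd)+
  have N1d: "cdiff (\<lambda>w :: complex ^ 2. N1 (w $ 1)) w" and N2d: "cdiff (\<lambda>w :: complex ^ 2. N2 (w $ 1)) w" for w
    unfolding N1_def N2_def by (intro intros Ad Bd V1d V2d)+
  have sd: "cdiff (\<lambda>w :: complex ^ 2. sinhc_sqrt (\<Delta> (w $ 1) * (w $ 2)\<^sup>2)) w"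
    and cd: "cdiff (\<lambda>w :: complex ^ 2. cosh_sqrt (\<Delta> (w $ 1) * (w $ 2)\<^sup>2)) w" for w
    using cdiff_compose[OF \<Delta>d] sinhc_sqrt_derivative cosh_sqrt_derivative by blast+
  have Sd: "cdiff S w" for w unfolding S_def by (intro intros sd)
  have \<sigma>d: "cdiff \<sigma> w" and \<kappa>d: "cdiff \<kappa> w" for w unfolding \<sigma>_def \<kappa>_def by (intro intros Sd cd)+
  have xd: "cdiff x w" for w unfolding x_def by (intro intros \<sigma>d \<kappa>d V1d N1d)
  have zd: "cdiff z w" for w unfolding z_def by (intro intros \<sigma>d \<kappa>d V2d N2d)
  have yd: "cdiff y w" for w unfolding y_def by (intro intros td xd)
  define w0 :: "complex ^ 2" where "w0 = vector [s0, 0]"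
  have l1: "(w0 + c *s axis 1 1) $ 1 = s0 + c" "(w0 + c *s axis 1 1) $ 2 = 0"
    and l2: "(w0 + c *s axis 2 1) $ 1 = s0" "(w0 + c *s axis 2 1) $ 2 = c" for c
    by (simp_all add: w0_def axis_def)
  have S1: "S (w0 + c *s axis 1 1) = 0" for c unfolding S_def l1 by simp
  have x1: "x (w0 + c *s axis 1 1) = 0" and z1: "z (w0 + c *s axis 1 1) = s0 + c" and y1: "y (w0 + c *s axis 1 1) = 1" for c
    unfolding y_def x_def z_def \<sigma>_def \<kappa>_def S1 l1 by simp_all
  have v0: "x w0 = 0" "y w0 = 1" "z w0 = s0" using x1[of 0] y1[of 0] z1[of 0] by simp_all
  have gx1: "grad x w0 (axis 1 1) = 0" and gy1: "grad y w0 (axis 1 1) = 0" and gz1: "grad z w0 (axis 1 1) = 1"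
    by (rule grad_slice_eqI[OF xd] grad_slice_eqI[OF yd] grad_slice_eqI[OF zd];
        unfold x1 y1 z1; auto intro!: derivative_eq_intros)+
  obtain D1 where D1: "(sinhc_sqrt has_field_derivative D1) (at (\<Delta> s0 * 0\<^sup>2))" using sinhc_sqrt_derivative by blast
  obtain D2 where D2: "(cosh_sqrt has_field_derivative D2) (at (\<Delta> s0 * 0\<^sup>2))" using cosh_sqrt_derivative by blast
  have q: "((\<lambda>c. \<Delta> s0 * c\<^sup>2) has_field_derivative 0) (at 0)" by (auto intro!: derivative_eq_intros)
  have dS: "((\<lambda>c. S (w0 + c *s axis 2 1)) has_field_derivative 1) (at 0)"
    unfolding S_def l2 using DERIV_mult[OF DERIV_ident DERIV_chain2[OF D1 q]] by simp
  have d\<sigma>: "((\<lambda>c. \<sigma> (w0 + c *s axis 2 1)) has_field_derivative 2) (at 0)"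
  proof -
    have S0: "S (w0 + 0 *s axis 2 1) = 0" by (simp add: S_def w0_def)
    show ?thesis unfolding \<sigma>_def l2
      using DERIV_mult[OF DERIV_cmult[OF dS, of 2] DERIV_chain2[OF D2 q]] S0 by simp
  qed
  have d\<kappa>: "((\<lambda>c. \<kappa> (w0 + c *s axis 2 1)) has_field_derivative 0) (at 0)"
  proof -
    have S0: "S (w0 + 0 *s axis 2 1) = 0" by (simp add: S_def w0_def)
    show ?thesis unfolding \<kappa>_def power2_eq_square
      using DERIV_cmult[OF DERIV_mult[OF dS dS], of 2] S0 by simp
  qed
  have dx: "((\<lambda>c. x (w0 + c *s axis 2 1)) has_field_derivative 2 * V1 s0) (at 0)"
    unfolding x_def l2 by (rule derivative_eq_intros d\<sigma> d\<kappa> refl | simp)+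
  have dz: "((\<lambda>c. z (w0 + c *s axis 2 1)) has_field_derivative 2 * V2 s0) (at 0)"
    unfolding z_def l2 by (rule derivative_eq_intros d\<sigma> d\<kappa> refl | simp)+
  have dy: "((\<lambda>c. y (w0 + c *s axis 2 1)) has_field_derivative - t s0 * (2 * V1 s0)) (at 0)"
    unfolding y_def l2 by (rule derivative_eq_intros dx refl | simp)+
  show ?thesis
  proof (rule dominable_by_combination[OF fp basis xd yd zd, where ?w0.0 = w0])
    show "poly3_eval P (x w *s e1 + y w *s e2 + z w *s e3) \<noteq> 0" for w unfolding one by simp
    show "x w *s e1 + y w *s e2 + z w *s e3 \<noteq> 0" for w
    proof
      assume "x w *s e1 + y w *s e2 + z w *s e3 = 0"
      then have "poly3_eval P 0 = 1" using one[of w] by simp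
      then show False using form_at_0[of 2 "poly3_eval P"] fp by (simp add: numeral_3_eq_3 numeral_2_eq_2)
    qed
    have "V1 s0 \<noteq> 0" using s0 unfolding V1_def neg_equal_0_iff_equal .
    then show "det3 (vector [x w0, y w0, z w0])
        (vector [grad x w0 (axis 1 1), grad y w0 (axis 1 1), grad z w0 (axis 1 1)])
        (vector [grad x w0 (axis 2 1), grad y w0 (axis 2 1), grad z w0 (axis 2 1)]) \<noteq> 0"
      unfolding v0 gx1 gy1 gz1 grad_slice_eqI[OF xd dx] grad_slice_eqI[OF yd dy] grad_slice_eqI[OF zd dz]
      by (simp add: det3_def)
  qed
qed

section \<open>Plane cubics\<close>

lemma ex_cube_root: obtains x :: complex where "x ^ 3 = c"
proof (cases "c = 0")
  case True then show ?thesis using that[of 0] by simp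
next
  case False
  have "exp (Ln c / 3) ^ 3 = exp (of_nat 3 * (Ln c / 3))" by (rule exp_of_nat_mult[symmetric])
  then show ?thesis using that[of "exp (Ln c / 3)"] False by simp
qed

text \<open>
  The cubic part in \<open>x\<close> and \<open>y\<close> is \<open>(\<alpha> * x + \<beta> * y) ^ 3\<close> up to a multiple of \<open>x * y\<close> by a linear form, and
  \<open>k * x * y * w\<close> absorbs that multiple by a change of the coordinate \<open>w\<close>. This leaves \<open>X * (k * x * y) +
  Y ^ 3\<close> with \<open>Y = \<alpha> * x + \<beta> * y\<close>.
\<close>

lemma dominable_node_with_branch:
  assumes fp: "form 3 (poly3_eval P)" and basis: "det3 z a b \<noteq> 0"
    and nf: "\<And>x y w. poly3_eval P (x *s a + y *s b + w *s z) =
      \<alpha> ^ 3 * x ^ 3 + \<beta> ^ 3 * y ^ 3 + g1 * x\<^sup>2 * y + g2 * y\<^sup>2 * x + k * x * y * w"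
    and k: "k \<noteq> 0" and \<beta>: "\<beta> \<noteq> 0"
  shows "dominable_by_C2 (- zero_locus P)"
proof -
  define A where "A = (g1 - 3 * \<alpha>\<^sup>2 * \<beta>) / k"
  define B where "B = (g2 - 3 * \<alpha> * \<beta>\<^sup>2) / k"
  have AB: "A * k = g1 - 3 * \<alpha>\<^sup>2 * \<beta>" "B * k = g2 - 3 * \<alpha> * \<beta>\<^sup>2" using k by (simp_all add: A_def B_def)
  define e2 where "e2 = (1 / \<beta>) *s (b - B *s z)"
  define e3 where "e3 = a - (\<alpha> / \<beta>) *s b + (B * \<alpha> / \<beta> - A) *s z"
  show ?thesis
  proof (rule dominable_cubic_normal_form[OF fp, of z e2 e3])
    have "det3 z e2 e3 * \<beta> = - det3 z a b"
      using \<beta> by (simp add: det3_def e2_def e3_def field_simps)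
    then show "det3 z e2 e3 \<noteq> 0" using basis by auto
    fix X Y Z :: complex
    define x where "x = Z"
    define y where "y = (Y - \<alpha> * Z) / \<beta>"
    define w where "w = X - A * x - B * y"
    have Y: "Y = \<alpha> * x + \<beta> * y" using \<beta> by (simp add: x_def y_def)
    have "X *s z + Y *s e2 + Z *s e3 = x *s a + y *s b + w *s z"
      using \<beta> by (simp add: vec_eq_iff e2_def e3_def x_def y_def w_def field_simps)
    then have "poly3_eval P (X *s z + Y *s e2 + Z *s e3) =
        \<alpha> ^ 3 * x ^ 3 + \<beta> ^ 3 * y ^ 3 + g1 * x\<^sup>2 * y + g2 * y\<^sup>2 * x + k * x * y * w"
      using nf by simp
    also have "\<dots> = X * (k * (x * y)) + Y ^ 3"
      unfolding w_def Y using AB by algebra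
    also have "k * (x * y) = 0 * X\<^sup>2 + 0 * Y\<^sup>2 + (- (k * \<alpha> / \<beta>)) * Z\<^sup>2 + 0 * X * Y + 0 * X * Z + (k / \<beta>) * Y * Z"
      using \<beta> by (simp add: x_def y_def field_simps power2_eq_square)
    finally show "poly3_eval P (X *s z + Y *s e2 + Z *s e3) =
      X * (0 * X\<^sup>2 + 0 * Y\<^sup>2 + (- (k * \<alpha> / \<beta>)) * Z\<^sup>2 + 0 * X * Y + 0 * X * Z + (k / \<beta>) * Y * Z) + Y ^ 3" .
    show "k / \<beta> \<noteq> 0 \<or> - (k * \<alpha> / \<beta>) \<noteq> 0" using k \<beta> by simp
  qed
qed

text \<open>
  The form is the product of \<open>x\<close>, \<open>y\<close> and a third linear form. The map has the coordinates \<open>x\<close> and \<open>y\<close>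
  exponential and the third factor \<open>1\<close>.
\<close>

lemma dominable_triangle:
  assumes fp: "form 3 (poly3_eval P)" and basis: "det3 a b z \<noteq> 0"
    and nf: "\<And>x y w. poly3_eval P (x *s a + y *s b + w *s z) = g1 * x\<^sup>2 * y + g2 * y\<^sup>2 * x + k * x * y * w"
    and k: "k \<noteq> 0"
  shows "dominable_by_C2 (- zero_locus P)"
proof -
  define x where "x = (\<lambda>w :: complex ^ 2. exp (w $ 1))"
  define y where "y = (\<lambda>w :: complex ^ 2. exp (w $ 2))"
  define u where "u = (\<lambda>w. (1 - g1 * x w - g2 * y w) / k)"
  have xd: "cdiff x w" and yd: "cdiff y w" for w unfolding x_def y_def by (intro cdiff_exp cdiff_coord)+
  have ud: "cdiff u w" for w unfolding u_def by (intro cdiff_divide cdiff_diff cdiff_mult cdiff_const xd yd k)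
  have val: "poly3_eval P (x w *s a + y w *s b + u w *s z) = x w * y w" for w
  proof -
    have "k * u w = 1 - g1 * x w - g2 * y w" using k by (simp add: u_def)
    then show ?thesis unfolding nf by algebra
  qed
  have l: "(0 + c *s axis 1 1 :: complex ^ 2) $ 1 = c" "(0 + c *s axis 1 1 :: complex ^ 2) $ 2 = 0"
    "(0 + c *s axis 2 1 :: complex ^ 2) $ 1 = 0" "(0 + c *s axis 2 1 :: complex ^ 2) $ 2 = c" for c
    by (simp_all add: axis_def)
  have gr: "grad x 0 (axis 1 1) = 1" "grad x 0 (axis 2 1) = 0" "grad y 0 (axis 1 1) = 0" "grad y 0 (axis 2 1) = 1"
    "grad u 0 (axis 1 1) = - g1 / k" "grad u 0 (axis 2 1) = - g2 / k"
    by (rule grad_slice_eqI[OF xd] grad_slice_eqI[OF yd] grad_slice_eqI[OF ud];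
        simp only: u_def x_def y_def l; (rule derivative_eq_intros refl k | simp add: k)+)+
  show ?thesis
  proof (rule dominable_by_combination[OF fp basis xd yd ud, where ?w0.0 = 0])
    show "poly3_eval P (x w *s a + y w *s b + u w *s z) \<noteq> 0" for w unfolding val by (simp add: x_def y_def)
    show "x w *s a + y w *s b + u w *s z \<noteq> 0" for w
    proof
      assume "x w *s a + y w *s b + u w *s z = 0"
      then have "poly3_eval P 0 = x w * y w" using val[of w] by simp
      then show False using form_at_0[of 2 "poly3_eval P"] fp
        by (simp add: numeral_3_eq_3 numeral_2_eq_2 x_def y_def)
    qed
    show "det3 (vector [x 0, y 0, u 0])
        (vector [grad x 0 (axis 1 1), grad y 0 (axis 1 1), grad u 0 (axis 1 1)])
        (vector [grad x 0 (axis 2 1), grad y 0 (axis 2 1), grad u 0 (axis 2 1)]) \<noteq> 0"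
      unfolding gr using k by (simp add: det3_def u_def x_def y_def field_simps)
  qed
qed

text \<open>
  In the basis of \<open>singular_point_is_node\<close> the coordinate \<open>w\<close> along the node occurs in the product \<open>x *
  y * w\<close> only. The coefficients of \<open>x ^ 3\<close> and \<open>y ^ 3\<close> are the values of the form at \<open>a\<close> and \<open>b\<close>, and both
  are zero only for a triangle.
\<close>

lemma dominable_nodal_cubic:
  assumes sqf: "squarefree P" and hom: "homogeneous 3 P" and nc: "normal_crossing (zero_locus P)"
    and z: "z \<noteq> 0" "\<And>v. grad (poly3_eval P) z v = 0"
  shows "dominable_by_C2 (- zero_locus P)"
proof -
  define p where "p = poly3_eval P"
  have f: "form 3 p" unfolding p_def by (rule form_poly3_eval[OF hom])
  have hom': "homogeneous (Suc 2) P" using hom by simp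
  obtain a b where ab: "det3 z a b \<noteq> 0" "hess p z a a = 0" "hess p z b b = 0" "hess p z a b \<noteq> 0"
    using singular_point_is_node[OF sqf hom' nc z] unfolding p_def by blast
  have gz: "grad p z v = 0" for v using z(2) by (simp add: p_def)
  have pz: "p z = 0" using Euler[OF f, of z] gz by simp
  have "hess p a a z = 0" "hess p b b z = 0"
    using ab form_3_swap[OF f] form_3_commute[OF f] by metis+
  then have az: "grad p a z = 0" "grad p b z = 0" by (simp_all add: form_3_grad[OF f])
  define k where "k = hess p a b z"
  have k: "k \<noteq> 0" using ab(4) form_3_swap[OF f] form_3_commute[OF f] unfolding k_def by metis
  have nf: "p (x *s a + y *s b + w *s z) = p a * x ^ 3 + p b * y ^ 3 + grad p a b * x\<^sup>2 * y + grad p b a * y\<^sup>2 * x + k * x * y * w" for x y w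
    unfolding form_3_expand[OF f] k_def by (simp add: pz gz az)
  obtain \<alpha> where \<alpha>: "\<alpha> ^ 3 = p a" by (rule ex_cube_root)
  obtain \<beta> where \<beta>: "\<beta> ^ 3 = p b" by (rule ex_cube_root)
  consider "\<beta> \<noteq> 0" | "\<alpha> \<noteq> 0" | "\<alpha> = 0" "\<beta> = 0" by blast
  then show ?thesis
  proof cases
    case 1
    show ?thesis
      by (rule dominable_node_with_branch[OF f[unfolded p_def] ab(1) _ k 1, where \<alpha> = \<alpha> and ?g1.0 = "grad p a b" and ?g2.0 = "grad p b a"])
         (use nf \<alpha> \<beta> in \<open>simp add: p_def\<close>)
  next
    case 2
    have basis: "det3 z b a \<noteq> 0" using ab(1) by (auto simp: det3_def algebra_simps)
    have nf': "p (x *s b + y *s a + w *s z) = \<beta> ^ 3 * x ^ 3 + \<alpha> ^ 3 * y ^ 3 + grad p b a * x\<^sup>2 * y + grad p a b * y\<^sup>2 * x + k * x * y * w" for x y w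
      using nf[of y x w] \<alpha> \<beta> by (simp add: add_ac mult_ac)
    show ?thesis
      by (rule dominable_node_with_branch[OF f[unfolded p_def] basis _ k 2, where \<alpha> = \<beta> and ?g1.0 = "grad p b a" and ?g2.0 = "grad p a b"])
         (use nf' in \<open>simp add: p_def\<close>)
  next
    case 3
    have basis: "det3 a b z \<noteq> 0" using ab(1) by (auto simp: det3_def algebra_simps)
    show ?thesis
      by (rule dominable_triangle[OF f[unfolded p_def] basis _ k, where ?g1.0 = "grad p a b" and ?g2.0 = "grad p b a"])
         (use nf \<alpha> \<beta> 3 in \<open>simp add: p_def\<close>)
  qed
qed

text \<open>
  On the circle of radius \<open>r = 3 * cmod c0 / cmod c1\<close> the linear term dominates, so that the
  polynomial is larger there than its value \<open>c0\<close> at the centre; without a zero inside this would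
  contradict the minimum modulus principle.
\<close>

lemma small_root:
  fixes c0 c1 c2 c3 :: complex
  assumes c: "3 * cmod c0 \<le> cmod c1" "9 * (cmod c2 + cmod c3) * cmod c0 < (cmod c1)\<^sup>2"
  obtains s where "c0 + c1 * s + c2 * s\<^sup>2 + c3 * s ^ 3 = 0" "cmod s * cmod c1 \<le> 3 * cmod c0"
proof (cases "c0 = 0")
  case True then show ?thesis using that[of 0] by simp
next
  case False
  have c1: "cmod c1 > 0" using c(1) False by (smt (verit) zero_less_norm_iff)
  define r where "r = 3 * cmod c0 / cmod c1"
  have r: "0 < r" "r \<le> 1" "cmod c1 * r = 3 * cmod c0" using False c1 c(1) by (auto simp: r_def)
  define g where "g = (\<lambda>s. c0 + c1 * s + c2 * s\<^sup>2 + c3 * s ^ 3)"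
  define e where "e = cmod c0 - (cmod c2 + cmod c3) * r\<^sup>2"
  have "(cmod c1 * r)\<^sup>2 = (3 * cmod c0)\<^sup>2" unfolding r(3) ..
  then have "r\<^sup>2 * (cmod c1)\<^sup>2 = 9 * (cmod c0)\<^sup>2" by (simp add: power_mult_distrib mult.commute)
  then have "(cmod c2 + cmod c3) * r\<^sup>2 * (cmod c1)\<^sup>2 = (9 * (cmod c2 + cmod c3) * cmod c0) * cmod c0"
    by algebra
  also have "\<dots> < (cmod c1)\<^sup>2 * cmod c0" using c(2) False by (intro mult_strict_right_mono) auto
  finally have "(cmod c2 + cmod c3) * r\<^sup>2 < cmod c0" using c1 by (simp add: mult.commute)
  then have e: "e > 0" by (simp add: e_def)
  have "\<exists>s\<in>cball 0 r. g s = 0"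
  proof (rule ccontr)
    assume no: "\<not> ?thesis"
    have "cmod c0 + e \<le> cmod (g 0)"
    proof (rule minimum_modulus[where g = g and x = 0 and \<rho> = r and \<rho>' = "r + 1"])
      show "g holomorphic_on ball 0 (r + 1)" unfolding g_def by (intro holomorphic_intros)
      show "cmod c0 + e \<le> cmod (g s)" if s: "cmod s = r" for s
      proof -
        have "cmod (c1 * s) = 3 * cmod c0" by (simp add: norm_mult s r(3))
        moreover have "cmod (c2 * s\<^sup>2) = cmod c2 * r\<^sup>2" by (simp add: norm_mult norm_power s)
        moreover have "cmod (c3 * s ^ 3) \<le> cmod c3 * r\<^sup>2"
          unfolding norm_mult norm_power s using r by (intro mult_left_mono power_decreasing) auto
        moreover have "cmod (c1 * s) \<le> cmod (g s) + cmod c0 + cmod (c2 * s\<^sup>2) + cmod (c3 * s ^ 3)"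
        proof -
          have "cmod (c1 * s) = cmod (g s - c0 - c2 * s\<^sup>2 - c3 * s ^ 3)" by (simp add: g_def)
          then show ?thesis
            using norm_triangle_ineq4[of "g s - c0 - c2 * s\<^sup>2" "c3 * s ^ 3"] norm_triangle_ineq4[of "g s - c0" "c2 * s\<^sup>2"]
              norm_triangle_ineq4[of "g s" c0] by linarith
        qed
        ultimately show ?thesis by (simp add: e_def distrib_right)
      qed
    qed (use r no e in \<open>auto intro: add_nonneg_pos\<close>)
    then show False using e by (simp add: g_def)
  qed
  then obtain s where "g s = 0" "cmod s \<le> r" by auto
  then show ?thesis using that[of s] c1 by (simp add: g_def r_def pos_le_divide_eq)
qed

definition hessian_det :: "(complex ^ 3 \<Rightarrow> complex) \<Rightarrow> complex ^ 3 \<Rightarrow> complex" where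
  "hessian_det p z = det ((\<chi> i j. pd (pd p i) j z) :: complex ^ 3 ^ 3)"

lemma form_hessian_det:
  assumes f: "form 3 p"
  shows "form 3 (hessian_det p)"
proof -
  have f1: "form (Suc (Suc (Suc 0))) p" using f by (simp add: numeral_3_eq_3)
  have f2: "form (Suc 0) (pd (pd p i) j)" for i j using f1 form_pd by blast
  have eq: "hessian_det p = (\<lambda>z. pd (pd p 1) 1 z * pd (pd p 2) 2 z * pd (pd p 3) 3 z
      + pd (pd p 1) 2 z * pd (pd p 2) 3 z * pd (pd p 3) 1 z + pd (pd p 1) 3 z * pd (pd p 2) 1 z * pd (pd p 3) 2 z
      - pd (pd p 1) 1 z * pd (pd p 2) 3 z * pd (pd p 3) 2 z - pd (pd p 1) 2 z * pd (pd p 2) 1 z * pd (pd p 3) 3 z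
      - pd (pd p 1) 3 z * pd (pd p 2) 2 z * pd (pd p 3) 1 z)"
    by (simp add: hessian_det_def det_3 fun_eq_iff)
  have sc: "pd (pd p i) j (c *s z) = c * pd (pd p i) j z" for i j c z using formD(2)[OF f2] by simp
  show ?thesis unfolding form_def
  proof (intro conjI allI)
    show "polyfun (hessian_det p)" unfolding eq
      by (intro polyfun_add polyfun_diff polyfun_mult formD(1)[OF f2])
    show "hessian_det p (c *s z) = c ^ 3 * hessian_det p z" for c z
      unfolding eq sc by (simp add: algebra_simps power3_eq_cube)
  qed
qed

lemma hessian_det_kernel:
  assumes "hessian_det p z = 0"
  obtains k where "k \<noteq> 0" "hessv p z k = 0"
proof -
  let ?M = "(\<chi> i j. pd (pd p i) j z) :: complex ^ 3 ^ 3"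
  have "\<not> invertible ?M" using assms by (simp add: hessian_det_def invertible_det_nz)
  then have "\<not> (\<forall>x. ?M *v x = 0 \<longrightarrow> x = 0)"
    using invertible_left_inverse matrix_left_invertible_ker by blast
  then obtain k where "k \<noteq> 0" "?M *v k = 0" by blast
  moreover have "?M *v k = hessv p z k"
    by (simp add: hessv_def grad_def matrix_vector_mult_def)
  ultimately show ?thesis using that by simp
qed

text \<open>
  Near a smooth point the curve is a graph over its tangent direction \<open>v\<close>. For each small \<open>\<zeta>\<close>,
  \<open>small_root\<close> provides a root of the cubic equation for \<open>s\<close> of size \<open>O(\<zeta>\<^sup>2)\<close>; dividing the equation by
  \<open>\<zeta>\<^sup>2\<close> gives the limit of \<open>s \<zeta> / \<zeta>\<^sup>2\<close>. A second-order jet of the branch is all that the Levi form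
  needs.
\<close>

lemma smooth_point_jet:
  assumes f: "form 3 p" and z: "p z = 0" "grad p z v = 0" "grad p z n \<noteq> 0"
  obtains s b where "s 0 = 0" "jet s 0 0 b" "\<forall>\<^sub>F \<zeta> in at 0. p (z + \<zeta> *s v + s \<zeta> *s n) = 0"
proof -
  define K where "K = grad p z n"
  have K: "K \<noteq> 0" using z(3) by (simp add: K_def)
  define d where "d = (\<lambda>\<zeta>. grad p v z + p v * \<zeta>)"
  define c1 where "c1 = (\<lambda>\<zeta>. K + hess p z v n * \<zeta> + grad p v n * \<zeta>\<^sup>2)"
  define c2 where "c2 = (\<lambda>\<zeta>. grad p n z + grad p n v * \<zeta>)"
  define c3 where "c3 = p n"
  have expand: "p (z + \<zeta> *s v + s *s n) = \<zeta>\<^sup>2 * d \<zeta> + c1 \<zeta> * s + c2 \<zeta> * s\<^sup>2 + c3 * s ^ 3" for \<zeta> s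
  proof -
    have "p (1 *s z + \<zeta> *s v + s *s n) = \<zeta>\<^sup>2 * d \<zeta> + c1 \<zeta> * s + c2 \<zeta> * s\<^sup>2 + c3 * s ^ 3"
      unfolding form_3_expand[OF f] d_def c1_def c2_def c3_def K_def
      by (simp add: z algebra_simps power2_eq_square power3_eq_cube)
    then show ?thesis by simp
  qed
  have lc1: "(c1 \<longlongrightarrow> K) (at 0)" unfolding c1_def by (auto intro!: tendsto_eq_intros)
  have lc2: "(c2 \<longlongrightarrow> grad p n z) (at 0)" unfolding c2_def by (auto intro!: tendsto_eq_intros)
  have ld: "(d \<longlongrightarrow> grad p v z) (at 0)" unfolding d_def by (auto intro!: tendsto_eq_intros)
  define good where "good = (\<lambda>\<zeta>. 3 * cmod (\<zeta>\<^sup>2 * d \<zeta>) \<le> cmod (c1 \<zeta>)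
      \<and> 9 * (cmod (c2 \<zeta>) + cmod c3) * cmod (\<zeta>\<^sup>2 * d \<zeta>) < (cmod (c1 \<zeta>))\<^sup>2)"
  have lz: "((\<lambda>\<zeta>. cmod (\<zeta>\<^sup>2 * d \<zeta>)) \<longlongrightarrow> cmod (0\<^sup>2 * grad p v z)) (at 0)" by (intro tendsto_intros ld)
  have "((\<lambda>\<zeta>. cmod (c1 \<zeta>) - 3 * cmod (\<zeta>\<^sup>2 * d \<zeta>)) \<longlongrightarrow> cmod K - 3 * cmod (0\<^sup>2 * grad p v z)) (at 0)"
    by (intro tendsto_intros lc1 ld)
  then have "\<forall>\<^sub>F \<zeta> in at 0. 0 < cmod (c1 \<zeta>) - 3 * cmod (\<zeta>\<^sup>2 * d \<zeta>)"
    by (rule order_tendstoD(1)) (simp add: K)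
  moreover have "((\<lambda>\<zeta>. (cmod (c1 \<zeta>))\<^sup>2 - 9 * (cmod (c2 \<zeta>) + cmod c3) * cmod (\<zeta>\<^sup>2 * d \<zeta>))
      \<longlongrightarrow> (cmod K)\<^sup>2 - 9 * (cmod (grad p n z) + cmod c3) * cmod (0\<^sup>2 * grad p v z)) (at 0)"
    by (intro tendsto_intros lc1 lc2 ld)
  then have "\<forall>\<^sub>F \<zeta> in at 0. 0 < (cmod (c1 \<zeta>))\<^sup>2 - 9 * (cmod (c2 \<zeta>) + cmod c3) * cmod (\<zeta>\<^sup>2 * d \<zeta>)"
    by (rule order_tendstoD(1)) (simp add: K)
  ultimately have ev_good: "\<forall>\<^sub>F \<zeta> in at 0. good \<zeta>"
    by eventually_elim (simp add: good_def)
  have "\<exists>s. (good \<zeta> \<longrightarrow> p (z + \<zeta> *s v + s *s n) = 0 \<and> cmod s * cmod (c1 \<zeta>) \<le> 3 * cmod (\<zeta>\<^sup>2 * d \<zeta>)) \<and> (\<zeta> = 0 \<longrightarrow> s = 0)" for \<zeta>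
  proof (cases "\<zeta> = 0")
    case True
    then show ?thesis using z by (intro exI[of _ 0]) simp
  next
    case False
    show ?thesis
    proof (cases "good \<zeta>")
      case True
      then show ?thesis
        using small_root[of "\<zeta>\<^sup>2 * d \<zeta>" "c1 \<zeta>" "c2 \<zeta>" c3] \<open>\<zeta> \<noteq> 0\<close> unfolding good_def expand by metis
    qed (use False in blast)
  qed
  then obtain s where s: "\<And>\<zeta>. good \<zeta> \<Longrightarrow> p (z + \<zeta> *s v + s \<zeta> *s n) = 0"
    "\<And>\<zeta>. good \<zeta> \<Longrightarrow> cmod (s \<zeta>) * cmod (c1 \<zeta>) \<le> 3 * cmod (\<zeta>\<^sup>2 * d \<zeta>)" "s 0 = 0" by metis
  define u where "u = (\<lambda>\<zeta>. s \<zeta> / \<zeta>\<^sup>2)"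
  define M where "M = 6 * (cmod (grad p v z) + 1) / cmod K"
  have M: "M \<ge> 0" unfolding M_def by (intro divide_nonneg_nonneg) auto
  have nz: "\<forall>\<^sub>F \<zeta> in at 0. \<zeta> \<noteq> (0 :: complex)" by (simp add: eventually_at_filter)
  have ev_c1: "\<forall>\<^sub>F \<zeta> in at 0. cmod K / 2 < cmod (c1 \<zeta>)"
    by (rule order_tendstoD(1)[OF tendsto_norm[OF lc1]]) (simp add: K)
  have ev_d: "\<forall>\<^sub>F \<zeta> in at 0. cmod (d \<zeta>) < cmod (grad p v z) + 1"
    by (rule order_tendstoD(2)[OF tendsto_norm[OF ld]]) simp
  have ev_u: "\<forall>\<^sub>F \<zeta> in at 0. cmod (u \<zeta>) \<le> M"
    using ev_good nz ev_c1 ev_d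
  proof eventually_elim
    case (elim \<zeta>)
    have "cmod (u \<zeta>) * cmod (c1 \<zeta>) \<le> 3 * cmod (d \<zeta>)"
      using s(2)[OF elim(1)] elim(2) by (simp add: u_def norm_divide norm_mult norm_power field_simps)
    moreover have "cmod (u \<zeta>) * (cmod K / 2) \<le> cmod (u \<zeta>) * cmod (c1 \<zeta>)"
      using elim(3) by (intro mult_left_mono) auto
    ultimately have "cmod (u \<zeta>) * (cmod K / 2) \<le> 3 * cmod (d \<zeta>)" by (rule order_trans[rotated])
    also have "\<dots> \<le> 3 * (cmod (grad p v z) + 1)" using elim(4) by simp
    finally show ?case using K by (simp add: M_def field_simps)
  qed
  (* the contribution of s^2 and s^3; it is negligible because u is bounded *)
  define R where "R = (\<lambda>\<zeta>. (c2 \<zeta> * (u \<zeta>)\<^sup>2 * \<zeta>\<^sup>2 + c3 * (u \<zeta>) ^ 3 * \<zeta> ^ 4) / c1 \<zeta>)"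
  have "((\<lambda>\<zeta>. (cmod (c2 \<zeta>) * M\<^sup>2 * cmod \<zeta> ^ 2 + cmod c3 * M ^ 3 * cmod \<zeta> ^ 4) / cmod (c1 \<zeta>))
      \<longlongrightarrow> (cmod (grad p n z) * M\<^sup>2 * cmod 0 ^ 2 + cmod c3 * M ^ 3 * cmod 0 ^ 4) / cmod K) (at 0)"
    by (intro tendsto_intros lc1 lc2) (simp add: K)
  then have bnd: "((\<lambda>\<zeta>. (cmod (c2 \<zeta>) * M\<^sup>2 * cmod \<zeta> ^ 2 + cmod c3 * M ^ 3 * cmod \<zeta> ^ 4) / cmod (c1 \<zeta>)) \<longlongrightarrow> 0) (at 0)"
    by simp
  have R0: "(R \<longlongrightarrow> 0) (at 0)"
  proof (rule Lim_null_comparison[OF _ bnd])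
    show "\<forall>\<^sub>F \<zeta> in at 0. norm (R \<zeta>) \<le> (cmod (c2 \<zeta>) * M\<^sup>2 * cmod \<zeta> ^ 2 + cmod c3 * M ^ 3 * cmod \<zeta> ^ 4) / cmod (c1 \<zeta>)"
      using ev_u
    proof eventually_elim
      case (elim \<zeta>)
      have "cmod (c2 \<zeta> * (u \<zeta>)\<^sup>2 * \<zeta>\<^sup>2) \<le> cmod (c2 \<zeta>) * M\<^sup>2 * cmod \<zeta> ^ 2"
        unfolding norm_mult norm_power using elim by (intro mult_right_mono mult_left_mono power_mono) auto
      moreover have "cmod (c3 * (u \<zeta>) ^ 3 * \<zeta> ^ 4) \<le> cmod c3 * M ^ 3 * cmod \<zeta> ^ 4"
        unfolding norm_mult norm_power using elim by (intro mult_right_mono mult_left_mono power_mono) auto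
      ultimately have "cmod (c2 \<zeta> * (u \<zeta>)\<^sup>2 * \<zeta>\<^sup>2 + c3 * (u \<zeta>) ^ 3 * \<zeta> ^ 4) \<le> cmod (c2 \<zeta>) * M\<^sup>2 * cmod \<zeta> ^ 2 + cmod c3 * M ^ 3 * cmod \<zeta> ^ 4"
        by (rule norm_triangle_mono)
      then show ?case unfolding R_def norm_divide by (rule divide_right_mono) simp
    qed
  qed
  have "((\<lambda>\<zeta>. - d \<zeta> / c1 \<zeta> - R \<zeta>) \<longlongrightarrow> - grad p v z / K - 0) (at 0)"
    by (intro tendsto_intros ld lc1 R0 K)
  moreover have "\<forall>\<^sub>F \<zeta> in at 0. - d \<zeta> / c1 \<zeta> - R \<zeta> = (s \<zeta> - 0 - 0 * \<zeta>) / \<zeta>\<^sup>2"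
    using ev_good nz ev_c1
  proof eventually_elim
    case (elim \<zeta>)
    have c1: "c1 \<zeta> \<noteq> 0" using elim(3) by auto
    have su: "s \<zeta> = u \<zeta> * \<zeta>\<^sup>2" using elim(2) by (simp add: u_def)
    have "\<zeta>\<^sup>2 * d \<zeta> + c1 \<zeta> * s \<zeta> + c2 \<zeta> * (s \<zeta>)\<^sup>2 + c3 * (s \<zeta>) ^ 3 = 0" using s(1)[OF elim(1)] unfolding expand .
    then have "\<zeta>\<^sup>2 * (d \<zeta> + c1 \<zeta> * u \<zeta> + (c2 \<zeta> * (u \<zeta>)\<^sup>2 * \<zeta>\<^sup>2 + c3 * (u \<zeta>) ^ 3 * \<zeta> ^ 4)) = 0"
      unfolding su by (simp add: algebra_simps power2_eq_square power3_eq_cube power4_eq_xxxx)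
    then have "d \<zeta> + c1 \<zeta> * u \<zeta> + (c2 \<zeta> * (u \<zeta>)\<^sup>2 * \<zeta>\<^sup>2 + c3 * (u \<zeta>) ^ 3 * \<zeta> ^ 4) = 0" using elim(2) by simp
    then have "u \<zeta> * c1 \<zeta> = - d \<zeta> - (c2 \<zeta> * (u \<zeta>)\<^sup>2 * \<zeta>\<^sup>2 + c3 * (u \<zeta>) ^ 3 * \<zeta> ^ 4)" by algebra
    then have "u \<zeta> = (- d \<zeta> - (c2 \<zeta> * (u \<zeta>)\<^sup>2 * \<zeta>\<^sup>2 + c3 * (u \<zeta>) ^ 3 * \<zeta> ^ 4)) / c1 \<zeta>"
      by (metis c1 nonzero_mult_div_cancel_right)
    also have "\<dots> = - d \<zeta> / c1 \<zeta> - R \<zeta>" unfolding R_def by (rule diff_divide_distrib)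
    finally show ?case by (simp add: u_def)
  qed
  ultimately have "((\<lambda>\<zeta>. (s \<zeta> - 0 - 0 * \<zeta>) / \<zeta>\<^sup>2) \<longlongrightarrow> - grad p v z / K - 0) (at 0)"
    by (rule Lim_transform_eventually)
  then have "jet s 0 0 (- grad p v z / K - 0)" using s(3) by (simp add: jet_def)
  moreover have "\<forall>\<^sub>F \<zeta> in at 0. p (z + \<zeta> *s v + s \<zeta> *s n) = 0" using ev_good by (rule eventually_mono) (rule s(1))
  ultimately show ?thesis using that s(3) by blast
qed

text \<open>
  Let \<open>H\<close> be the Hessian determinant. The quotient \<open>cmod (H z) / norm z ^ 3\<close> is a function on the
  compact curve and attains its minimum. If the minimum were positive, \<open>3 * ln ((norm z)\<^sup>2) - ln
  ((cmod (H z))\<^sup>2)\<close> would have a local maximum along the curve; but the logarithm of \<open>H\<close> is harmonic,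
  and the Levi form of \<open>ln ((norm z)\<^sup>2)\<close> is positive.
\<close>

lemma ex_flex:
  assumes f: "form 3 p" and smooth: "\<And>z. z \<noteq> 0 \<Longrightarrow> \<exists>v. grad p z v \<noteq> 0"
  obtains z where "z \<noteq> 0" "p z = 0" "hessian_det p z = 0"
proof -
  have f1: "form (Suc 2) p" using f by simp
  define H where "H = hessian_det p"
  have fH: "form 3 H" unfolding H_def by (rule form_hessian_det[OF f])
  define S where "S = sphere 0 1 \<inter> {z. p z = 0}"
  have comp: "compact S" unfolding S_def
    by (intro compact_Int_closed compact_sphere closed_Collect_eq continuous_intros polyfun_continuous formD(1)[OF f])
  have unit: "of_real (inverse (norm z)) *s z \<in> S" if "z \<noteq> 0" "p z = 0" for z
  proof -
    have "norm (of_real (inverse (norm z)) *s z) = 1" using that unfolding norm_smult norm_of_real by simp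
    then show ?thesis using that formD(2)[OF f] by (simp add: S_def)
  qed
  obtain z1 where "z1 \<noteq> 0" "p z1 = 0" using form_has_zero[OF f1] .
  then have "S \<noteq> {}" using unit by blast
  then have "\<exists>z\<in>S. \<forall>y\<in>S. cmod (H z) \<le> cmod (H y)"
    by (intro continuous_attains_inf comp continuous_intros polyfun_continuous formD(1)[OF fH])
  then obtain z where z: "z \<in> S" and min: "\<And>y. y \<in> S \<Longrightarrow> cmod (H z) \<le> cmod (H y)" by blast
  have z1: "norm z = 1" "p z = 0" "z \<noteq> 0" using z by (auto simp: S_def)
  have minH: "cmod (H z) * norm y ^ 3 \<le> cmod (H y)" if "y \<noteq> 0" "p y = 0" for y
  proof -
    have "cmod (H z) \<le> cmod (H (of_real (inverse (norm y)) *s y))" by (rule min[OF unit[OF that]])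
    also have "\<dots> = cmod (H y) / norm y ^ 3"
      unfolding formD(2)[OF fH] by (simp add: norm_mult norm_power norm_inverse divide_inverse power_inverse mult.commute)
    finally show ?thesis using that(1) by (simp add: pos_le_divide_eq)
  qed
  have "H z = 0"
  proof (rule ccontr)
    assume Hz: "H z \<noteq> 0"
    obtain n where n: "grad p z n \<noteq> 0" using smooth[OF z1(3)] by blast
    have gz: "grad p z z = 0" using Euler[OF f, of z] z1(2) by simp
    obtain v where v: "grad p z v = 0" "det3 v z n \<noteq> 0" using ex_kernel_vector[OF z1(3) gz n] .
    obtain s b where s: "s 0 = 0" "jet s 0 0 b" "\<forall>\<^sub>F \<zeta> in at 0. p (z + \<zeta> *s v + s \<zeta> *s n) = 0"
      using smooth_point_jet[OF f z1(2) v(1) n] by blast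
    define \<gamma> where "\<gamma> = (\<lambda>\<zeta>. z + \<zeta> *s v + s \<zeta> *s n)"
    have j: "jet (\<lambda>\<zeta>. \<gamma> \<zeta> $ k) (z $ k) (v $ k) ((b *s n) $ k)" for k
    proof -
      have "jet (\<lambda>\<zeta>. \<zeta>) 0 1 0" by (simp add: jet_def)
      from jet_add[OF jet_add[OF jet_const[of "z $ k"] jet_mult[OF this jet_const[of "v $ k"]]] jet_mult[OF s(2) jet_const[of "n $ k"]]]
      show ?thesis by (simp add: \<gamma>_def)
    qed
    have \<gamma>0: "\<gamma> 0 = z" by (simp add: \<gamma>_def s(1))
    have \<gamma>nz: "\<gamma> \<zeta> \<noteq> 0" for \<zeta>
    proof
      assume "\<gamma> \<zeta> = 0"
      then have "det3 v (\<gamma> \<zeta>) n = 0" by (simp add: det3_def)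
      moreover have "det3 v (\<gamma> \<zeta>) n = det3 v z n" by (simp add: \<gamma>_def det3_def algebra_simps)
      ultimately show False using v(2) by simp
    qed
    obtain \<alpha> where l1: "levi (\<lambda>\<zeta>. ln ((cmod (H (\<gamma> \<zeta>)))\<^sup>2)) (ln ((cmod (H z))\<^sup>2)) \<alpha> 0"
      by (rule levi_log_holomorphic[OF jet_polyfun[OF formD(1)[OF fH] j] Hz])
    note l2 = levi_ln_norm_square[OF j z1(3)]
    note l = levi_add[OF levi_cmult[OF l1, of "-1"] levi_cmult[OF l2, of 3]]
    have "\<forall>\<^sub>F \<zeta> in at 0. - 1 * ln ((cmod (H (\<gamma> \<zeta>)))\<^sup>2) + 3 * ln ((norm (\<gamma> \<zeta>))\<^sup>2)
        \<le> - 1 * ln ((cmod (H (\<gamma> 0)))\<^sup>2) + 3 * ln ((norm (\<gamma> 0))\<^sup>2)"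
      using s(3)
    proof eventually_elim
      case (elim \<zeta>)
      have m: "cmod (H z) * norm (\<gamma> \<zeta>) ^ 3 \<le> cmod (H (\<gamma> \<zeta>))"
        by (rule minH[OF \<gamma>nz]) (use elim in \<open>simp add: \<gamma>_def\<close>)
      have pos: "cmod (H z) > 0" "norm (\<gamma> \<zeta>) > 0" using Hz \<gamma>nz by auto
      then have pos3: "cmod (H z) * norm (\<gamma> \<zeta>) ^ 3 > 0" by simp
      then have "ln (cmod (H z) * norm (\<gamma> \<zeta>) ^ 3) \<le> ln (cmod (H (\<gamma> \<zeta>)))"
        using m by (subst ln_le_cancel_iff) auto
      moreover have "ln (cmod (H z) * norm (\<gamma> \<zeta>) ^ 3) = ln (cmod (H z)) + 3 * ln (norm (\<gamma> \<zeta>))"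
        using pos by (simp add: ln_mult_pos ln_realpow)
      moreover have "ln ((cmod (H (\<gamma> \<zeta>)))\<^sup>2) = 2 * ln (cmod (H (\<gamma> \<zeta>)))" "ln ((norm (\<gamma> \<zeta>))\<^sup>2) = 2 * ln (norm (\<gamma> \<zeta>))"
        "ln ((cmod (H z))\<^sup>2) = 2 * ln (cmod (H z))"
        using pos pos3 m by (auto simp: ln_realpow)
      ultimately show ?case by (simp add: \<gamma>0 z1(1))
    qed
    then have "- 1 * 0 + 3 * residual v z \<le> 0" by (rule levi_local_max[OF l])
    then have "residual v z \<le> 0" by simp
    then have "(norm (v - (herm v z / of_real ((norm z)\<^sup>2)) *s z))\<^sup>2 \<le> 0"
      unfolding orthogonal_decomposition(2)[OF z1(3)] using z1(1) by simp
    then have "v = (herm v z / of_real ((norm z)\<^sup>2)) *s z" by simp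
    then obtain c where c: "v = c *s z" by blast
    have "det3 v z n = 0" unfolding c by (simp add: det3_def algebra_simps)
    then show False using v(2) by simp
  qed
  then show ?thesis using that z1 unfolding H_def by blast
qed

text \<open>
  At a flex \<open>z\<close> the kernel of the Hessian contains a vector \<open>k\<close>. It is not a multiple of \<open>z\<close>, whose image
  under the Hessian is twice the gradient. On the span of \<open>k\<close> and \<open>z\<close>, the inflectional tangent, the
  form is a multiple of a cube, so with respect to \<open>z\<close>, \<open>k\<close> and a third vector it has the normal form \<open>X
  * Q + Y ^ 3\<close>.
\<close>

lemma dominable_smooth_cubic:
  assumes hom: "homogeneous 3 P" and smooth: "\<And>z. z \<noteq> 0 \<Longrightarrow> \<exists>v. grad (poly3_eval P) z v \<noteq> 0"
  shows "dominable_by_C2 (- zero_locus P)"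
proof -
  define p where "p = poly3_eval P"
  have f: "form 3 p" unfolding p_def by (rule form_poly3_eval[OF hom])
  have f1: "form (Suc 2) p" using f by simp
  note pf = formD(1)[OF f]
  have sm: "\<exists>v. grad p z v \<noteq> 0" if "z \<noteq> 0" for z using smooth[OF that] by (simp add: p_def)
  obtain z where z: "z \<noteq> 0" "p z = 0" "hessian_det p z = 0" using ex_flex[OF f sm] by blast
  obtain k where k: "k \<noteq> 0" "hessv p z k = 0" using hessian_det_kernel[OF z(3)] .
  have hk: "hess p z k v = 0" for v by (simp add: hess_hessv[OF pf] k(2))
  have hk': "hess p z v k = 0" "hess p k z v = 0" "hess p k v z = 0" "hess p v z k = 0" "hess p v k z = 0" for v
    using hk form_3_swap[OF f] form_3_commute[OF f] by metis+
  have gzz: "grad p z z = 0" using Euler[OF f, of z] z(2) by simp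
  have gzk: "grad p z k = 0" and gkz: "grad p k z = 0" by (simp_all add: form_3_grad[OF f] hk')
  have "\<exists>u. det3 u k z \<noteq> 0 \<and> grad p z u \<noteq> 0"
  proof -
    have "cross k z \<noteq> 0"
    proof
      assume c: "cross k z = 0"
      obtain j where j: "z $ j \<noteq> 0" using z(1) by (auto simp: vec_eq_iff)
      have "z $ j *s k = k $ j *s z"
        using c exhaust_3[of j] by (auto simp: cross_def vec_eq_iff forall_3 mult.commute)
      then have "hessv p z (z $ j *s k) = hessv p z (k $ j *s z)" by simp
      then have "k $ j *s (of_nat 2 *s gradv p z) = 0"
        unfolding hessv_smult using k(2) hessv_self[OF f1, of z] by simp
      moreover have "gradv p z \<noteq> 0" using sm[OF z(1)] by (auto simp: grad_gradv)
      ultimately have "k $ j = 0" by (simp add: vector_smult_assoc)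
      then have "k = 0" using \<open>z $ j *s k = k $ j *s z\<close> j by (simp add: vec_eq_iff)
      then show False using k(1) by simp
    qed
    then obtain u where u: "det3 u k z \<noteq> 0" using ex_det3 by blast
    have "grad p z u \<noteq> 0"
      using det3_functional_zero[OF u _ gzk gzz] sm[OF z(1)] by blast
    with u show ?thesis by blast
  qed
  then obtain u where u: "det3 u k z \<noteq> 0" and gzu: "grad p z u \<noteq> 0" by blast
  (* the inflectional tangent is not a component: otherwise some k + c z would be a singular point *)
  have pk: "p k \<noteq> 0"
  proof
    assume pk: "p k = 0"
    (* chosen so that the derivative at m in the direction u vanishes *)
    define c where "c = csqrt (- hess p k k u / hess p z z u)"
    have hz: "hess p z z u \<noteq> 0" using gzu by (simp add: form_3_grad[OF f])
    have c2: "c\<^sup>2 * hess p z z u = - hess p k k u" using hz by (simp add: c_def)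
    define m where "m = k + c *s z"
    have m: "hess p m m v = hess p k k v + c\<^sup>2 * hess p z z v" for v
      unfolding m_def by (simp add: form_3_add[OF f] form_3_scale[OF f] hess_add_left hess_scale_left hk hk' power2_eq_square)
    have "hess p k k k = 0" "hess p z z z = 0" using pk z(2) by (simp_all add: form_3_eval[OF f])
    then have "grad p m k = 0" "grad p m z = 0" "grad p m u = 0"
      using c2 by (simp_all add: form_3_grad[OF f] m hk hk')
    then have "grad p m v = 0" for v using det3_functional_zero[OF u] by blast
    moreover have "m \<noteq> 0"
    proof
      assume "m = 0"
      then have "k = (- c) *s z" by (simp add: m_def eq_neg_iff_add_eq_0)
      then have "det3 u k z = 0" by (simp add: det3_def algebra_simps)
      then show False using u by simp
    qed
    ultimately show False using sm by blast
  qed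
  obtain r where r: "r ^ 3 = p k" by (rule ex_cube_root)
  have r0: "r \<noteq> 0" using r pk by auto
  define e where "e = (1 / r) *s k"
  have pe: "p e = 1" unfolding e_def formD(2)[OF f] using r r0 pk by (simp add: power_divide)
  have he: "grad p e z = 0" "grad p z e = 0" "hess p u e z = 0"
    unfolding e_def by (simp_all add: form_3_grad[OF f] form_3_scale[OF f] hess_scale_left hess_scale_right hk hk')
  have "det3 u e z = (1 / r) * det3 u k z"
    unfolding e_def det3_def vector_smult_component by algebra
  then have basis: "det3 u e z \<noteq> 0" using u r0 by simp
  show ?thesis
  proof (rule dominable_cubic_normal_form[OF f[unfolded p_def] basis, where ?q11.0 = "p u" and ?q22.0 = "grad p e u"
        and ?q33.0 = "grad p z u" and ?q12.0 = "grad p u e" and ?q13.0 = "grad p u z" and ?q23.0 = 0])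
    show "poly3_eval P (X *s u + Y *s e + Z *s z) = X * (p u * X\<^sup>2 + grad p e u * Y\<^sup>2 + grad p z u * Z\<^sup>2
        + grad p u e * X * Y + grad p u z * X * Z + 0 * Y * Z) + Y ^ 3" for X Y Z
      unfolding p_def[symmetric] form_3_expand[OF f]
      by (simp add: pe he z(2) algebra_simps power2_eq_square power3_eq_cube)
  qed (use gzu in simp)
qed

theorem theorem5p3:
  fixes D :: "P2 set" and d :: nat
  assumes "normal_crossing_divisor D d"
  shows "dominable_by_C2 (- D) \<longleftrightarrow> d \<le> 3"
proof -
  obtain P where P: "squarefree P" "homogeneous d P" "D = zero_locus P" and nc: "normal_crossing (zero_locus P)"
    using assms by (auto simp: normal_crossing_divisor_def reduced_curve_def)
  have P0: "P \<noteq> 0" using P(1) by auto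
  show ?thesis
  proof
    assume "dominable_by_C2 (- D)"
    then show "d \<le> 3" using not_dominable_of_degree_ge_4[OF P(1,2) nc] P(3) by (cases "d \<le> 3") auto
  next
    assume "d \<le> 3"
    then consider "d = 0" | "d = 1" | "d = 2" | "d = 3" by linarith
    then have "dominable_by_C2 (- zero_locus P)"
    proof cases
      case 1 then show ?thesis using dominable_degree_0[OF P0] P(2) by simp
    next
      case 2 then show ?thesis using dominable_degree_1[OF P0] P(2) by simp
    next
      case 3 then show ?thesis using dominable_degree_2[OF P(1) _ nc] P(2) by simp
    next
      case 4
      then have hom: "homogeneous 3 P" using P(2) by simp
      show ?thesis
      proof (cases "\<exists>z. z \<noteq> 0 \<and> (\<forall>v. grad (poly3_eval P) z v = 0)")
        case True
        then show ?thesis using dominable_nodal_cubic[OF P(1) hom nc] by blast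
      next
        case False
        then show ?thesis using dominable_smooth_cubic[OF hom] by blast
      qed
    qed
    then show "dominable_by_C2 (- D)" using P(3) by simp
  qed
qed

end
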